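(* Let $A$ be a division Albert algebra over $K$, let $L\subset A$ be a cubic subfield and let $g\in\mathbf{Str}(A)(K)$ satisfy $g(L)=L$. Then there exist $r\in\mathbf{Str}(A)(K)$ which is $R$-equivalent to $1$, $g_1\in N_{\mathbf{H}}(\mathbf{G}^L)(K)$ and $g_2\in\mathbf{G}^L(K)$, with $g_1(L)=g_2(L)=L$, such that $g=rg_1g_2$.
   Context: $K$ is an infinite field of characteristic different from $2$ and $3$. $\mathbf{Str}(A)$ is the group of norm similitudes of the division Albert algebra $A$; $\mathbf{G}=[\mathbf{Str}(A),\mathbf{Str}(A)]$; $\mathbf{H}=\mathbf{Aut}(A)$; $\mathbf{G}^L=\{x\in\mathbf{G}\mid x(l)=l\ \forall l\in L\}$ (contained in $\mathbf{H}$); $N_{\mathbf{H}}(\mathbf{G}^L)$ is its normalizer in $\mathbf{H}$. $R$-equivalence to $1$: connected to $1$ by a chain of rational curves $\mathbb{A}^1\dashrightarrow\mathbf{Str}(A)$ defined at $0,1$; these elements form a normal subgroup. *)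

theory Defs
  imports "HOL-Analysis.Analysis" "HOL-Computational_Algebra.Polynomial"
begin

text \<open>The Albert algebra is modelled on the coordinate space K^27 (a fixed basis),
 as a cubic norm structure (N, sharp, e): N a cubic form, sharp a quadratic map, e the unit.
 K-linear maps A -> A are 27 x 27 matrices acting by *v.\<close>

type_synonym 'k alb = "'k ^ 27"
type_synonym 'k endo = "'k ^ 27 ^ 27"

definition cubic_form :: "('k::field alb \<Rightarrow> 'k) \<Rightarrow> bool" where
  "cubic_form N \<longleftrightarrow> (\<exists>c :: 27 \<Rightarrow> 27 \<Rightarrow> 27 \<Rightarrow> 'k.
     \<forall>x. N x = (\<Sum>i\<in>UNIV. \<Sum>j\<in>UNIV. \<Sum>k\<in>UNIV. c i j k * x$i * x$j * x$k))"

definition quadratic_map :: "('k::field alb \<Rightarrow> 'k alb) \<Rightarrow> bool" where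
  "quadratic_map S \<longleftrightarrow> (\<exists>d :: 27 \<Rightarrow> 27 \<Rightarrow> 27 \<Rightarrow> 'k.
     \<forall>x l. S x $ l = (\<Sum>i\<in>UNIV. \<Sum>j\<in>UNIV. d l i j * x$i * x$j))"

definition lin :: "('k::field alb \<Rightarrow> 'k) \<Rightarrow> 'k alb \<Rightarrow> 'k alb \<Rightarrow> 'k" where
  "lin f x y = (THE b. \<exists>c d. \<forall>t. f (x + t *s y) = f x + t * b + t^2 * c + t^3 * d)"

text \<open>Bilinear trace T(y,z) = - (D_y D_z log N)(1), linear trace T(x) = T(x,1).\<close>
definition trace2 :: "('k::field alb \<Rightarrow> 'k) \<Rightarrow> 'k alb \<Rightarrow> 'k alb \<Rightarrow> 'k alb \<Rightarrow> 'k" where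
  "trace2 N e y z = lin N e y * lin N e z - lin (\<lambda>x. lin N x y) e z"

definition trace1 :: "('k::field alb \<Rightarrow> 'k) \<Rightarrow> 'k alb \<Rightarrow> 'k alb \<Rightarrow> 'k" where
  "trace1 N e x = trace2 N e x e"

definition cross :: "('k::field alb \<Rightarrow> 'k alb) \<Rightarrow> 'k alb \<Rightarrow> 'k alb \<Rightarrow> 'k alb" where
  "cross S x y = S (x + y) - S x - S y"

text \<open>Cubic norm structure axioms (McCrimmon / Petersson--Racine).\<close>
definition cubic_norm_structure ::
  "('k::field alb \<Rightarrow> 'k) \<Rightarrow> ('k alb \<Rightarrow> 'k alb) \<Rightarrow> 'k alb \<Rightarrow> bool" where
  "cubic_norm_structure N S e \<longleftrightarrow>
     cubic_form N \<and> quadratic_map S \<and>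
     N e = 1 \<and> S e = e \<and>
     (\<forall>x. S (S x) = N x *s x) \<and>
     (\<forall>x y. trace2 N e (S x) y = lin N x y) \<and>
     (\<forall>x. cross S e x = trace1 N e x *s e - x)"

text \<open>Division Albert algebra: a 27-dimensional nondegenerate cubic norm structure
 whose norm is anisotropic (every nonzero element invertible).\<close>
definition division_albert ::
  "('k::field alb \<Rightarrow> 'k) \<Rightarrow> ('k alb \<Rightarrow> 'k alb) \<Rightarrow> 'k alb \<Rightarrow> bool" where
  "division_albert N S e \<longleftrightarrow>
     cubic_norm_structure N S e \<and>
     (\<forall>y. (\<forall>z. trace2 N e y z = 0) \<longrightarrow> y = 0) \<and>
     (\<forall>x. x \<noteq> 0 \<longrightarrow> N x \<noteq> 0)"

definition jprod ::
  "('k::field alb \<Rightarrow> 'k) \<Rightarrow> ('k alb \<Rightarrow> 'k alb) \<Rightarrow> 'k alb \<Rightarrow> 'k alb \<Rightarrow> 'k alb \<Rightarrow> 'k alb" where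
  "jprod N S e x y = inverse 2 *s (cross S x y + trace1 N e x *s y + trace1 N e y *s x
      - trace1 N e (cross S x y) *s e)"

definition cubic_subfield ::
  "('k::field alb \<Rightarrow> 'k) \<Rightarrow> ('k alb \<Rightarrow> 'k alb) \<Rightarrow> 'k alb \<Rightarrow> 'k alb set \<Rightarrow> bool" where
  "cubic_subfield N S e L \<longleftrightarrow>
     (\<exists>b1 b2 b3. L = {a1 *s b1 + a2 *s b2 + a3 *s b3 | a1 a2 a3. True} \<and>
        (\<forall>a1 a2 a3. a1 *s b1 + a2 *s b2 + a3 *s b3 = 0 \<longrightarrow> a1 = 0 \<and> a2 = 0 \<and> a3 = 0)) \<and>
     e \<in> L \<and>
     (\<forall>x\<in>L. \<forall>y\<in>L. jprod N S e x y \<in> L) \<and>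
     (\<forall>x\<in>L. \<forall>y\<in>L. \<forall>z\<in>L. jprod N S e (jprod N S e x y) z = jprod N S e x (jprod N S e y z)) \<and>
     (\<forall>x\<in>L. x \<noteq> 0 \<longrightarrow> (\<exists>y\<in>L. jprod N S e x y = e))"

definition Str :: "('k::field alb \<Rightarrow> 'k) \<Rightarrow> 'k endo set" where
  "Str N = {g. det g \<noteq> 0 \<and> (\<exists>\<nu>. \<forall>x. N (g *v x) = \<nu> * N x)}"

text \<open>K-points of G = [Str(A),Str(A)]: the norm isometries.\<close>
definition Gpts :: "('k::field alb \<Rightarrow> 'k) \<Rightarrow> 'k endo set" where
  "Gpts N = {g. det g \<noteq> 0 \<and> (\<forall>x. N (g *v x) = N x)}"

definition Aut :: "('k::field alb \<Rightarrow> 'k) \<Rightarrow> ('k alb \<Rightarrow> 'k alb) \<Rightarrow> 'k alb \<Rightarrow> 'k endo set" where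
  "Aut N S e = {g. det g \<noteq> 0 \<and> (\<forall>x y. g *v jprod N S e x y = jprod N S e (g *v x) (g *v y))}"

definition GL_fix :: "('k::field alb \<Rightarrow> 'k) \<Rightarrow> 'k alb set \<Rightarrow> 'k endo set" where
  "GL_fix N L = {g \<in> Gpts N. \<forall>l\<in>L. g *v l = l}"

definition normalizer_H ::
  "('k::field alb \<Rightarrow> 'k) \<Rightarrow> ('k alb \<Rightarrow> 'k alb) \<Rightarrow> 'k alb \<Rightarrow> 'k alb set \<Rightarrow> 'k endo set" where
  "normalizer_H N S e L = {h \<in> Aut N S e. (\<lambda>x. h ** x ** matrix_inv h) ` GL_fix N L = GL_fix N L}"

text \<open>Rational curves A^1 --> Str(A) \<subseteq> GL(A): matrices of rational functions P/Q.\<close>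
definition curve_at :: "(27 \<Rightarrow> 27 \<Rightarrow> 'k::field poly) \<Rightarrow> 'k poly \<Rightarrow> 'k \<Rightarrow> 'k endo" where
  "curve_at P Q t = (\<chi> i j. poly (P i j) t / poly Q t)"

definition defined_at :: "(27 \<Rightarrow> 27 \<Rightarrow> 'k::field poly) \<Rightarrow> 'k poly \<Rightarrow> 'k \<Rightarrow> bool" where
  "defined_at P Q t \<longleftrightarrow> poly Q t \<noteq> 0 \<and> det (curve_at P Q t) \<noteq> 0"

definition R_link :: "('k::field alb \<Rightarrow> 'k) \<Rightarrow> 'k endo \<Rightarrow> 'k endo \<Rightarrow> bool" where
  "R_link N x y \<longleftrightarrow> (\<exists>P Q.
     (\<forall>t. defined_at P Q t \<longrightarrow> curve_at P Q t \<in> Str N) \<and>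
     defined_at P Q 0 \<and> defined_at P Q 1 \<and>
     curve_at P Q 0 = x \<and> curve_at P Q 1 = y)"

definition R_equiv_one :: "('k::field alb \<Rightarrow> 'k) \<Rightarrow> 'k endo \<Rightarrow> bool" where
  "R_equiv_one N g \<longleftrightarrow> (R_link N)\<^sup>*\<^sup>* (mat 1) g"

end

theory Submission
  imports "HOL-Algebra.Algebraic_Closure_Type" Defs
begin

text \<open>
  Let V be the orthogonal complement of L for the trace form. It is a vector space over L under
  l . x = - (l \<times> x), and the L-component q(x) of - x# is a quadratic form on it. It suffices to find r which is
  R-equivalent to 1 and agrees with g on L: then g = r h, where h is a norm isometry that fixes L pointwise.

  Most R-trivial elements arise as follows. Let v, w in V be q-orthogonal, with m = q(w) / q(v) outside K. Then there
  is a rational curve of similarities that starts at the identity and acts on L as multiplication by 1 + m t^2. On V it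
  is (1 + m t^2)^{-1} times the reflection along v + t w, applied to a polynomial of degree two in t with coefficients
  in V. Over an algebraic closure L becomes a frame of idempotents, and the curve consists of similarities if certain
  vectors are divisible by 1 + m_i t^2, where the m_i are the conjugates of m. These linear conditions on the
  coefficients can be solved by a dimension count, because the norm is anisotropic.

  If g is multiplication by u on L, then u is, up to a scalar, the product of a square and a quotient q(y) / q(x);
  these are realised by U-operators and by the curves above. Otherwise g induces an automorphism \<tau> of order three
  on L. Take x in V with q(x) nonzero and let S be the nine-dimensional subalgebra generated by L and x. It acts on
  its orthogonal complement Y, and there x = \<zeta> + \<zeta>* with \<zeta> semilinear over L. The map s -> \<zeta> s \<zeta>* of S is
  \<tau>-semilinear on L. Up to U-operators it has the form s -> (1 + \<delta> p) s (1 - \<delta> p), where p is in S and \<delta> is a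
  square root of a scalar and commutes with S; this is the endpoint of a curve as above for the subfield K[p] and
  vectors v, w in Y.
\<close>

section \<open>Cubic norm structures\<close>

lemma six_neq_zero: "(2::'a::field) \<noteq> 0 \<Longrightarrow> (3::'a) \<noteq> 0 \<Longrightarrow> (6::'a) \<noteq> 0"
  using no_zero_divisors[of "2::'a" 3] by simp

locale cubic_jordan =
  fixes cr :: "'a::field ^ 'n \<Rightarrow> 'a ^ 'n \<Rightarrow> 'a ^ 'n"  (infixl "\<bowtie>" 75)
    and T :: "'a ^ 'n \<Rightarrow> 'a ^ 'n \<Rightarrow> 'a"
    and e :: "'a ^ 'n"
  assumes two_nonzero: "(2::'a) \<noteq> 0" and three_nonzero: "(3::'a) \<noteq> 0"
    and cross_add_left: "(x + y) \<bowtie> z = x \<bowtie> z + y \<bowtie> z"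
    and cross_scale_left: "(c *s x) \<bowtie> y = c *s (x \<bowtie> y)"
    and cross_commute: "x \<bowtie> y = y \<bowtie> x"
    and trace_add_left: "T (x + y) z = T x z + T y z"
    and trace_scale_left: "T (c *s x) y = c * T x y"
    and trace_commute: "T x y = T y x"
    and trace_cross_assoc: "T (x \<bowtie> y) z = T x (y \<bowtie> z)"
    and sharp_sharp_polarized: "(w \<bowtie> x) \<bowtie> (y \<bowtie> z) + (w \<bowtie> y) \<bowtie> (x \<bowtie> z) + (w \<bowtie> z) \<bowtie> (x \<bowtie> y)
       = T (x \<bowtie> y) z *s w + T (w \<bowtie> y) z *s x + T (w \<bowtie> x) z *s y + T (w \<bowtie> x) y *s z"
    and cross_unit_left: "e \<bowtie> x = T x e *s e - x"
    and trace_unit_unit: "T e e = 3"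
begin

lemma cross_add_right: "x \<bowtie> (y + z) = x \<bowtie> y + x \<bowtie> z"
  by (metis cross_add_left cross_commute)

lemma cross_scale_right: "x \<bowtie> (c *s y) = c *s (x \<bowtie> y)"
  by (metis cross_scale_left cross_commute)

lemma trace_add_right: "T x (y + z) = T x y + T x z"
  by (metis trace_add_left trace_commute)

lemma trace_scale_right: "T x (c *s y) = c * T x y"
  by (metis trace_scale_left trace_commute)

lemma cross_minus_left: "(- x) \<bowtie> y = - (x \<bowtie> y)"
  using cross_scale_left[of "-1" x y] by simp

lemma cross_minus_right: "x \<bowtie> (- y) = - (x \<bowtie> y)"
  by (metis cross_minus_left cross_commute)

lemma trace_minus_left: "T (- x) y = - T x y"
  using trace_scale_left[of "-1" x y] by simp

lemma trace_minus_right: "T x (- y) = - T x y"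
  by (metis trace_minus_left trace_commute)

lemma cross_diff_left: "(x - y) \<bowtie> z = x \<bowtie> z - y \<bowtie> z"
  using cross_add_left[of x "- y" z] by (simp add: cross_minus_left)

lemma cross_diff_right: "x \<bowtie> (y - z) = x \<bowtie> y - x \<bowtie> z"
  by (metis cross_diff_left cross_commute)

lemma trace_diff_left: "T (x - y) z = T x z - T y z"
  using trace_add_left[of x "- y" z] by (simp add: trace_minus_left)

lemma trace_diff_right: "T x (y - z) = T x y - T x z"
  by (metis trace_diff_left trace_commute)

lemma cross_zero [simp]: "0 \<bowtie> x = 0" "x \<bowtie> 0 = 0"
  using cross_diff_left[of 0 0 x] cross_diff_right[of x 0 0] by simp_all

lemma trace_zero [simp]: "T 0 x = 0" "T x 0 = 0"
  using trace_diff_left[of 0 0 x] trace_diff_right[of x 0 0] by simp_all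

lemmas bilinear_simps = cross_add_left cross_add_right cross_scale_left cross_scale_right cross_minus_left
  cross_minus_right cross_diff_left cross_diff_right trace_add_left trace_add_right trace_scale_left
  trace_scale_right trace_minus_left trace_minus_right trace_diff_left trace_diff_right

lemma cross_sum_left: "(\<Sum>i\<in>A. f i) \<bowtie> y = (\<Sum>i\<in>A. f i \<bowtie> y)"
  by (induction A rule: infinite_finite_induct) (simp_all add: cross_add_left)

lemma cross_sum_right: "x \<bowtie> (\<Sum>i\<in>A. f i) = (\<Sum>i\<in>A. x \<bowtie> f i)"
  by (induction A rule: infinite_finite_induct) (simp_all add: cross_add_right)

lemma trace_sum_left: "T (\<Sum>i\<in>A. f i) y = (\<Sum>i\<in>A. T (f i) y)"
  by (induction A rule: infinite_finite_induct) (simp_all add: trace_add_left)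

lemma trace_sum_right: "T x (\<Sum>i\<in>A. f i) = (\<Sum>i\<in>A. T x (f i))"
  by (induction A rule: infinite_finite_induct) (simp_all add: trace_add_right)

lemma trace_cross_left_commute: "T x (y \<bowtie> z) = T y (x \<bowtie> z)"
  by (metis trace_cross_assoc cross_commute)

lemma trace_cross_right_commute: "T (x \<bowtie> y) z = T (x \<bowtie> z) y"
  by (metis trace_cross_assoc trace_commute cross_commute)

definition sharp :: "'a ^ 'n \<Rightarrow> 'a ^ 'n" where
  "sharp x = inverse 2 *s (x \<bowtie> x)"

definition cnorm :: "'a ^ 'n \<Rightarrow> 'a" where
  "cnorm x = T x (sharp x) / 3"

definition U_op :: "'a ^ 'n \<Rightarrow> 'a ^ 'n \<Rightarrow> 'a ^ 'n" where
  "U_op x y = T x y *s x - sharp x \<bowtie> y"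

definition jordan :: "'a ^ 'n \<Rightarrow> 'a ^ 'n \<Rightarrow> 'a ^ 'n" where
  "jordan x y = inverse 2 *s (x \<bowtie> y + T x e *s y + T y e *s x - T (x \<bowtie> y) e *s e)"

lemma four_nonzero: "(4::'a) \<noteq> 0"
proof -
  have "(4::'a) = 2 * 2" by simp
  then show ?thesis using two_nonzero by (metis mult_eq_0_iff)
qed

lemmas six_nonzero = six_neq_zero[OF two_nonzero three_nonzero]

lemma cross_self: "x \<bowtie> x = 2 *s sharp x"
  using two_nonzero by (simp add: sharp_def)

lemma trace_sharp_self: "T x (sharp x) = 3 * cnorm x" "T (sharp x) x = 3 * cnorm x"
  using three_nonzero by (simp_all add: cnorm_def trace_commute[of "sharp x"])

lemma trace_cross_self: "T (x \<bowtie> x) y = 2 * T (sharp x) y" "T (x \<bowtie> y) x = 2 * T (sharp x) y"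
  "T (y \<bowtie> x) x = 2 * T (sharp x) y" "T x (x \<bowtie> y) = 2 * T (sharp x) y" "T x (y \<bowtie> x) = 2 * T (sharp x) y"
proof -
  show square: "T (x \<bowtie> x) y = 2 * T (sharp x) y" for x y by (simp add: cross_self trace_scale_left)
  show swapped: "T (x \<bowtie> y) x = 2 * T (sharp x) y" for x y using square[of x y] by (metis trace_cross_right_commute)
  show "T (y \<bowtie> x) x = 2 * T (sharp x) y" using swapped by (metis cross_commute)
  show "T x (x \<bowtie> y) = 2 * T (sharp x) y" using swapped by (metis trace_commute)
  show "T x (y \<bowtie> x) = 2 * T (sharp x) y" using swapped by (metis trace_commute cross_commute)
qed

lemma sharp_scale: "sharp (c *s x) = c^2 *s sharp x"
  by (simp add: sharp_def bilinear_simps power2_eq_square ac_simps)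

lemma sharp_minus: "sharp (- x) = sharp x"
  by (simp add: sharp_def bilinear_simps)

lemma sharp_zero [simp]: "sharp 0 = 0"
  by (simp add: sharp_def)

lemma sharp_add: "sharp (x + y) = sharp x + x \<bowtie> y + sharp y"
proof -
  have "2 *s sharp (x + y) = 2 *s (sharp x + x \<bowtie> y + sharp y)"
    by (simp add: cross_self[symmetric] bilinear_simps cross_commute[of y x] vector_add_ldistrib
        vec_eq_iff algebra_simps)
  then show ?thesis by (rule vec.scale_left_imp_eq[OF two_nonzero])
qed

lemma sharp_unit [simp]: "sharp e = e"
proof -
  have "e \<bowtie> e = 2 *s e" using cross_unit_left[of e] trace_unit_unit by (simp add: vec_eq_iff algebra_simps)
  then show ?thesis using two_nonzero by (simp add: sharp_def)
qed

lemma cnorm_unit [simp]: "cnorm e = 1"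
  using three_nonzero by (simp add: cnorm_def trace_unit_unit)

lemma cnorm_zero [simp]: "cnorm 0 = 0"
  by (simp add: cnorm_def)

lemma unit_nonzero: "e \<noteq> 0"
  using trace_unit_unit three_nonzero by auto

lemma sharp_sharp: "sharp (sharp x) = cnorm x *s x"
proof (rule vec.scale_left_imp_eq)
  have "(24::'a) = 4 * 6" by simp
  then show "(24::'a) \<noteq> 0" using four_nonzero six_nonzero by (metis mult_eq_0_iff)
  have "(24 *s sharp (sharp x)) $ i = (24 *s (cnorm x *s x)) $ i" for i
    using sharp_sharp_polarized[of x x x x]
    by (auto simp: cross_self bilinear_simps trace_sharp_self vec_eq_iff sharp_scale algebra_simps)
  then show "24 *s sharp (sharp x) = 24 *s (cnorm x *s x)" unfolding vec_eq_iff by blast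
qed

lemma sharp_cross_cross: "sharp x \<bowtie> (x \<bowtie> y) = cnorm x *s y + T (sharp x) y *s x"
proof (rule vec.scale_left_imp_eq)
  show "(6 :: 'a) \<noteq> 0" by (rule six_nonzero)
  have "(6 *s (sharp x \<bowtie> (x \<bowtie> y))) $ i = (6 *s (cnorm x *s y + T (sharp x) y *s x)) $ i" for i
    using sharp_sharp_polarized[of x x x y]
    by (simp add: cross_self bilinear_simps trace_sharp_self trace_cross_self cross_commute[of "x \<bowtie> y"] vec_eq_iff
        algebra_simps)
  then show "6 *s (sharp x \<bowtie> (x \<bowtie> y)) = 6 *s (cnorm x *s y + T (sharp x) y *s x)"
    unfolding vec_eq_iff by blast
qed

lemma cross_cross_common:
  "(x \<bowtie> y) \<bowtie> (x \<bowtie> z) + sharp x \<bowtie> (y \<bowtie> z)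
    = T (sharp x) y *s z + T (sharp x) z *s y + T (x \<bowtie> y) z *s x"
proof (rule vec.scale_left_imp_eq[OF two_nonzero])
  have "(2 *s ((x \<bowtie> y) \<bowtie> (x \<bowtie> z) + sharp x \<bowtie> (y \<bowtie> z))) $ i
    = (2 *s (T (sharp x) y *s z + T (sharp x) z *s y + T (x \<bowtie> y) z *s x)) $ i" for i
    using sharp_sharp_polarized[of x x y z]
    by (simp add: cross_self bilinear_simps trace_sharp_self trace_cross_self cross_commute[of "x \<bowtie> z"] vec_eq_iff
        algebra_simps)
  then show "2 *s ((x \<bowtie> y) \<bowtie> (x \<bowtie> z) + sharp x \<bowtie> (y \<bowtie> z))
    = 2 *s (T (sharp x) y *s z + T (sharp x) z *s y + T (x \<bowtie> y) z *s x)"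
    unfolding vec_eq_iff by blast
qed

lemma sharp_cross: "sharp (x \<bowtie> y) = T (sharp x) y *s y + T x (sharp y) *s x - sharp x \<bowtie> sharp y"
proof (rule vec.scale_left_imp_eq[OF four_nonzero])
  have "(4 *s sharp (x \<bowtie> y)) $ i = (4 *s (T (sharp x) y *s y + T x (sharp y) *s x - sharp x \<bowtie> sharp y)) $ i" for i
    using sharp_sharp_polarized[of x x y y]
    by (simp add: cross_self bilinear_simps trace_sharp_self trace_cross_self trace_commute[of "sharp y"]
        cross_commute[of y x] vec_eq_iff algebra_simps)
  then show "4 *s sharp (x \<bowtie> y) = 4 *s (T (sharp x) y *s y + T x (sharp y) *s x - sharp x \<bowtie> sharp y)"
    unfolding vec_eq_iff by blast
qed

lemma cnorm_scale: "cnorm (c *s x) = c^3 * cnorm x"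
  by (simp add: cnorm_def sharp_scale bilinear_simps power2_eq_square power3_eq_cube)

lemma cnorm_add: "cnorm (x + y) = cnorm x + T (sharp x) y + T x (sharp y) + cnorm y"
proof -
  have "3 * cnorm (x + y) = 3 * (cnorm x + T (sharp x) y + T x (sharp y) + cnorm y)"
    by (simp add: trace_sharp_self[symmetric] sharp_add bilinear_simps trace_cross_self
        trace_commute[of y "sharp x"]
        trace_commute[of "sharp y" x] algebra_simps)
  then show ?thesis by (rule mult_left_cancel[THEN iffD1, OF three_nonzero])
qed

lemma cnorm_cross: "cnorm (x \<bowtie> y) = T (sharp x) y * T x (sharp y) - cnorm x * cnorm y"
proof -
  have sharps: "T (sharp x \<bowtie> sharp y) (x \<bowtie> y) = 3 * (cnorm x * cnorm y) + T (sharp x) y * T x (sharp y)"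
  proof -
    have "T (sharp x \<bowtie> sharp y) (x \<bowtie> y) = T (sharp y) (sharp x \<bowtie> (x \<bowtie> y))"
      by (metis trace_cross_assoc cross_commute)
    also have "\<dots> = 3 * (cnorm x * cnorm y) + T (sharp x) y * T x (sharp y)"
      by (simp add: sharp_cross_cross bilinear_simps trace_sharp_self trace_commute[of "sharp y" x])
    finally show ?thesis .
  qed
  have "3 * cnorm (x \<bowtie> y) = 3 * (T (sharp x) y * T x (sharp y) - cnorm x * cnorm y)"
    by (simp add: trace_sharp_self(2)[symmetric] sharp_cross bilinear_simps sharps trace_cross_self
        trace_commute[of "sharp y" x] algebra_simps
        trace_cross_self(4)[of y x, unfolded cross_commute[of y x]])
  then show ?thesis by (rule mult_left_cancel[THEN iffD1, OF three_nonzero])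
qed

lemma trace_sharp_sharp: "T (sharp (sharp x)) y = cnorm x * T x y"
  by (simp add: sharp_sharp bilinear_simps)

lemma cnorm_sharp: "cnorm (sharp x) = cnorm x ^ 2"
proof -
  have "3 * cnorm (sharp x) = 3 * (cnorm x)^2"
    by (simp add: trace_sharp_self(2)[symmetric] trace_sharp_sharp power2_eq_square) (simp add: trace_sharp_self)
  then show ?thesis by (rule mult_left_cancel[THEN iffD1, OF three_nonzero])
qed

lemma cnorm_diff: "cnorm (x - y) = cnorm x - T (sharp x) y + T x (sharp y) - cnorm y"
  using cnorm_add[of x "- y"] cnorm_scale[of "-1" y] by (simp add: sharp_minus bilinear_simps)

lemma cnorm_U_op: "cnorm (U_op x y) = cnorm x ^ 2 * cnorm y"
proof -
  let ?s = "sharp x \<bowtie> y"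
  have linear_term: "T (sharp x) ?s = 2 * (cnorm x * T x y)"
    by (simp add: trace_cross_self trace_sharp_sharp)
  have quadratic_term: "T x (sharp ?s) = cnorm x * (T x y)^2 + cnorm x * T (sharp x) (sharp y)"
    by (simp add: sharp_cross sharp_sharp bilinear_simps trace_sharp_self trace_cross_self power2_eq_square
        algebra_simps)
  have cubic_term: "cnorm ?s = cnorm x * T x y * T (sharp x) (sharp y) - cnorm x ^ 2 * cnorm y"
    by (simp add: cnorm_cross trace_sharp_sharp cnorm_sharp)
  show ?thesis
    unfolding U_op_def cnorm_diff
    by (simp add: cnorm_scale sharp_scale bilinear_simps linear_term quadratic_term cubic_term
        power2_eq_square power3_eq_cube algebra_simps)
qed

lemma trace_cross_unit: "T (x \<bowtie> y) e = T x e * T y e - T x y"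
proof -
  have "T (x \<bowtie> y) e = T x (e \<bowtie> y)" by (metis trace_cross_assoc cross_commute)
  then show ?thesis by (simp add: cross_unit_left bilinear_simps)
qed

lemma cross_unit_right: "x \<bowtie> e = T x e *s e - x"
  by (metis cross_unit_left cross_commute)

lemma cross_sharp_self:
  "x \<bowtie> sharp x
    = (T x e * T (sharp x) e - cnorm x) *s e - T x e *s sharp x - T (sharp x) e *s x"
proof (rule vec.scale_left_imp_eq[OF three_nonzero])
  have "(3 *s (x \<bowtie> sharp x)) $ i
    = (3 *s ((T x e * T (sharp x) e - cnorm x) *s e - T x e *s sharp x - T (sharp x) e *s x)) $ i" for i
    using cross_cross_common[of x e x]
    by (simp add: trace_cross_self, simp add: cross_self cross_unit_left cross_unit_right bilinear_simps
        trace_sharp_self cross_commute[of "sharp x" x]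
        vec_eq_iff algebra_simps)
  then show "3 *s (x \<bowtie> sharp x)
    = 3 *s ((T x e * T (sharp x) e - cnorm x) *s e - T x e *s sharp x - T (sharp x) e *s x)"
    unfolding vec_eq_iff by blast
qed

end

section \<open>Peirce decomposition\<close>

context cubic_jordan
begin

definition frame :: "'a ^ 'n \<Rightarrow> 'a ^ 'n \<Rightarrow> 'a ^ 'n \<Rightarrow> bool" where
  "frame a b c \<longleftrightarrow> a \<bowtie> a = 0 \<and> b \<bowtie> b = 0 \<and> c \<bowtie> c = 0 \<and> a \<bowtie> b = c \<and> b \<bowtie> c = a \<and> c \<bowtie> a = b
     \<and> T a a = 1 \<and> T b b = 1 \<and> T c c = 1 \<and> T a b = 0 \<and> T b c = 0 \<and> T c a = 0 \<and> a + b + c = e"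

lemma frame_rotate: "frame a b c \<Longrightarrow> frame b c a"
  by (auto simp: frame_def algebra_simps)

lemma frame_swap: "frame a b c \<Longrightarrow> frame b a c"
  using trace_commute cross_commute by (auto simp: frame_def algebra_simps)

lemma frame_flip: "frame a b c \<Longrightarrow> frame a c b"
  using frame_swap frame_rotate by blast

lemma frameD:
  assumes "frame a b c"
  shows "a \<bowtie> a = 0" "b \<bowtie> b = 0" "c \<bowtie> c = 0" "a \<bowtie> b = c" "b \<bowtie> c = a" "c \<bowtie> a = b"
    "b \<bowtie> a = c" "c \<bowtie> b = a" "a \<bowtie> c = b" "T a a = 1" "T b b = 1" "T c c = 1"
    "T a b = 0" "T b c = 0" "T c a = 0" "T b a = 0" "T c b = 0" "T a c = 0"
  using assms trace_commute cross_commute unfolding frame_def by metis+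

lemma frame_sum: "frame a b c \<Longrightarrow> e = a + b + c"
  by (simp add: frame_def)

definition peirce :: "'a ^ 'n \<Rightarrow> 'a ^ 'n \<Rightarrow> 'a ^ 'n \<Rightarrow> 'a ^ 'n \<Rightarrow> bool" where
  "peirce a b c x \<longleftrightarrow> T x a = 0 \<and> T x b = 0 \<and> T x c = 0 \<and> a \<bowtie> x = - x \<and> b \<bowtie> x = 0 \<and> c \<bowtie> x = 0"

lemma peirce_swap: "peirce a b c x \<Longrightarrow> peirce a c b x"
  by (simp add: peirce_def)

lemma peirce_zero: "peirce a b c 0"
  by (simp add: peirce_def)

lemma peirce_add: "peirce a b c x \<Longrightarrow> peirce a b c y \<Longrightarrow> peirce a b c (x + y)"
  by (simp add: peirce_def bilinear_simps)

lemma peirce_scale: "peirce a b c x \<Longrightarrow> peirce a b c (k *s x)"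
  by (simp add: peirce_def bilinear_simps)

lemma peirce_minus: "peirce a b c x \<Longrightarrow> peirce a b c (- x)"
  by (simp add: peirce_def bilinear_simps)

lemma peirce_diff: "peirce a b c x \<Longrightarrow> peirce a b c y \<Longrightarrow> peirce a b c (x - y)"
  by (simp add: peirce_def bilinear_simps)

lemmas peirce_intros = peirce_zero peirce_add peirce_scale peirce_minus peirce_diff

definition quad :: "'a ^ 'n \<Rightarrow> 'a" where
  "quad x = T x x / 2"

lemma quad_scale: "quad (k *s x) = k^2 * quad x"
  by (simp add: quad_def bilinear_simps power2_eq_square)

lemma trace_self_quad: "T x x = 2 * quad x"
  using two_nonzero by (simp add: quad_def)

lemma sharp_idempotent: assumes "frame a b c" shows "sharp a = 0"
  using assms by (simp add: frameD sharp_def)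

lemma cross_same_peirce:
  assumes "frame a b c" "peirce a b c x" "peirce a b c y"
  shows "x \<bowtie> y = - (T x y *s a)"
  using cross_cross_common[of a x y] assms by (simp add: sharp_idempotent[OF assms(1)] peirce_def bilinear_simps)

lemma sharp_peirce:
  assumes "frame a b c" "peirce a b c x" shows "sharp x = - (quad x *s a)"
proof (rule vec.scale_left_imp_eq[OF two_nonzero])
  show "2 *s sharp x = 2 *s (- (quad x *s a))"
    using cross_same_peirce[OF assms assms(2)] by (simp add: cross_self trace_self_quad)
qed

lemma trace_distinct_peirce:
  assumes "frame a b c" "peirce a b c x" "peirce b c a y"
  shows "T x y = 0"
proof -
  have "b \<bowtie> (b \<bowtie> y) = y" using assms by (simp add: peirce_def bilinear_simps)
  then have "T x y = T (b \<bowtie> x) (b \<bowtie> y)" by (metis trace_cross_assoc cross_commute)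
  then show ?thesis using assms by (simp add: peirce_def)
qed

lemma peirce_cross:
  assumes frame: "frame a b c" and x: "peirce a b c x" and y: "peirce b c a y"
  shows "peirce c a b (x \<bowtie> y)"
proof -
  note fd = frameD[OF frame]
  have trace_xy: "T x y = 0" by (rule trace_distinct_peirce[OF assms])
  have trace_idempotents: "T (x \<bowtie> y) a = 0" "T (x \<bowtie> y) b = 0" "T (x \<bowtie> y) c = 0"
    using x y trace_xy by (simp_all add: trace_cross_assoc cross_commute[of y] peirce_def bilinear_simps)
  note trace_commutes = trace_commute[of a] trace_commute[of b] trace_commute[of c]
  note expand = peirce_def fd bilinear_simps trace_cross_assoc trace_commutes cross_commute[of y]
  have cross_c: "c \<bowtie> (x \<bowtie> y) = - (x \<bowtie> y)"
    using sharp_sharp_polarized[of a b x y] x y trace_xy by (simp add: expand) (simp add: eq_neg_iff_add_eq_0)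
  have cross_a: "a \<bowtie> (x \<bowtie> y) = 0"
    using sharp_sharp_polarized[of b c x y] x y trace_xy by (simp add: expand)
  have cross_b: "b \<bowtie> (x \<bowtie> y) = 0"
    using sharp_sharp_polarized[of c a x y] x y trace_xy by (simp add: expand)
  show ?thesis using trace_idempotents cross_a cross_b cross_c by (simp add: peirce_def)
qed

lemma cross_cross_peirce:
  assumes frame: "frame a b c" and x: "peirce a b c x" and y: "peirce b c a y"
  shows "x \<bowtie> (x \<bowtie> y) = quad x *s y"
proof -
  have "T (x \<bowtie> a) y = 0" using x trace_distinct_peirce[OF assms]
    by (simp add: cross_commute[of x] peirce_def bilinear_simps)
  then show ?thesis
  using cross_cross_common[of x a y] x y
  by (simp add: sharp_peirce[OF frame x] cross_commute[of x a] peirce_def bilinear_simps frameD[OF frame]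
      trace_commute[of a y])
qed

lemma cross_cross_peirce_polarized:
  assumes frame: "frame a b c" and x: "peirce a b c x" and x': "peirce a b c x'" and y: "peirce b c a y"
  shows "x \<bowtie> (x' \<bowtie> y) + x' \<bowtie> (x \<bowtie> y) = T x x' *s y"
proof -
  have "quad (x + x') = quad x + quad x' + T x x'"
    using two_nonzero by (simp add: quad_def bilinear_simps trace_commute[of x' x] add_divide_distrib)
  then show ?thesis
    using cross_cross_peirce[OF frame peirce_add[OF x x'] y] cross_cross_peirce[OF frame x y]
      cross_cross_peirce[OF frame x' y]
    by (simp add: bilinear_simps vec_eq_iff algebra_simps)
qed

lemma cross_cross_peirce_polarized':
  assumes frame: "frame a b c" and x: "peirce a b c x" and x': "peirce a b c x'" and y: "peirce c a b y"
  shows "x \<bowtie> (x' \<bowtie> y) + x' \<bowtie> (x \<bowtie> y) = T x x' *s y"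
  using cross_cross_peirce_polarized[OF frame_flip[OF frame] peirce_swap[OF x] peirce_swap[OF x'] peirce_swap[OF y]]
  by simp

lemma quad_cross:
  assumes frame: "frame a b c" and x: "peirce a b c x" and y: "peirce b c a y"
  shows "quad (x \<bowtie> y) = quad x * quad y"
proof -
  have "T (x \<bowtie> y) (x \<bowtie> y) = T y (x \<bowtie> (x \<bowtie> y))" by (metis trace_cross_assoc cross_commute)
  then have "T (x \<bowtie> y) (x \<bowtie> y) = quad x * T y y" by (simp add: cross_cross_peirce[OF assms] bilinear_simps)
  then show ?thesis by (simp add: quad_def[of "x \<bowtie> y"] quad_def[of y])
qed

lemma cross_of_crosses_peirce:
  assumes frame: "frame a b c" and u: "peirce a b c u" and x: "peirce b c a x" and y: "peirce c a b y"
  shows "(u \<bowtie> x) \<bowtie> (u \<bowtie> y) = T (u \<bowtie> x) y *s u - quad u *s (x \<bowtie> y)"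
proof -
  have xy: "peirce a b c (x \<bowtie> y)" by (rule peirce_cross[OF frame_rotate[OF frame] x y])
  then have sharp_u: "sharp u \<bowtie> (x \<bowtie> y) = quad u *s (x \<bowtie> y)"
    by (simp add: sharp_peirce[OF frame u] bilinear_simps peirce_def)
  have orthogonal: "T (sharp u) x = 0" "T (sharp u) y = 0"
    using x y by (simp_all add: sharp_peirce[OF frame u] bilinear_simps peirce_def trace_commute[of a x]
      trace_commute[of a y])
  show ?thesis using cross_cross_common[of u x y] unfolding sharp_u orthogonal by (simp add: eq_diff_eq)
qed

definition frame_orthogonal :: "'a ^ 'n \<Rightarrow> 'a ^ 'n \<Rightarrow> 'a ^ 'n \<Rightarrow> 'a ^ 'n \<Rightarrow> bool" where
  "frame_orthogonal a b c x \<longleftrightarrow> T x a = 0 \<and> T x b = 0 \<and> T x c = 0"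

lemma frame_orthogonal_flip: "frame_orthogonal a b c x \<Longrightarrow> frame_orthogonal a c b x"
  by (simp add: frame_orthogonal_def)

lemma cross_unit_frame_orthogonal:
  assumes "frame a b c" "frame_orthogonal a b c x"
  shows "T x e = 0" "e \<bowtie> x = - x"
proof -
  show "T x e = 0"
    using assms(2) by (simp add: frame_sum[OF assms(1)] frame_orthogonal_def bilinear_simps)
  then show "e \<bowtie> x = - x" by (simp add: cross_unit_left)
qed

lemma frame_orthogonal_cross:
  assumes "frame a b c" "frame_orthogonal a b c x"
  shows "frame_orthogonal a b c (a \<bowtie> x)" "frame_orthogonal a b c (b \<bowtie> x)"
  using assms(2)
  by (simp_all add: frame_orthogonal_def cross_commute[of _ x] trace_cross_assoc frameD[OF assms(1)])

lemma cross_unit_idempotent: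
  assumes "frame a b c" shows "a \<bowtie> e = e - a" "b \<bowtie> e = e - b"
  by (simp_all add: frame_sum[OF assms] bilinear_simps frameD[OF assms])

lemma cross_idempotent_twice:
  assumes frame: "frame a b c" and x: "frame_orthogonal a b c x"
  shows "a \<bowtie> (a \<bowtie> x) = - (a \<bowtie> x)"
  using cross_cross_common[of a e x] x cross_unit_frame_orthogonal[OF frame x]
    cross_unit_frame_orthogonal[OF frame frame_orthogonal_cross(1)[OF frame x]]
    frame_orthogonal_cross(1)[OF frame x]
  by (simp add: sharp_idempotent[OF frame] cross_unit_idempotent[OF frame] bilinear_simps
      frame_orthogonal_def trace_commute[of a x] trace_commute[of e x] eq_neg_iff_add_eq_0 algebra_simps)

lemma cross_idempotents_anticommute:
  assumes frame: "frame a b c" and x: "frame_orthogonal a b c x"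
  shows "a \<bowtie> (b \<bowtie> x) + b \<bowtie> (a \<bowtie> x) = 0"
proof -
  note unit = cross_unit_frame_orthogonal(2)[OF frame] and idem = cross_unit_idempotent[OF frame]
  have products: "(a \<bowtie> b) \<bowtie> (e \<bowtie> x) = - (c \<bowtie> x)"
    "(a \<bowtie> e) \<bowtie> (b \<bowtie> x) = - (b \<bowtie> x) - a \<bowtie> (b \<bowtie> x)"
    "(a \<bowtie> x) \<bowtie> (b \<bowtie> e) = - (a \<bowtie> x) - b \<bowtie> (a \<bowtie> x)"
    using unit[OF x] unit[OF frame_orthogonal_cross(1)[OF frame x]] unit[OF frame_orthogonal_cross(2)[OF frame x]]
    by (simp_all add: idem frameD[OF frame] bilinear_simps cross_commute[of "a \<bowtie> x"])
  have traces: "T (b \<bowtie> e) x = 0" "T (a \<bowtie> e) x = 0" "T (a \<bowtie> b) x = 0" "T (a \<bowtie> b) e = 1"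
    using x cross_unit_frame_orthogonal(1)[OF frame x]
    by (simp_all add: idem bilinear_simps trace_commute[of _ x] frameD[OF frame] frame_orthogonal_def)
      (simp add: frame_sum[OF frame] bilinear_simps frameD[OF frame])
  have sum: "a \<bowtie> x + b \<bowtie> x + c \<bowtie> x = - x"
    using unit[OF x] by (simp add: frame_sum[OF frame] bilinear_simps)
  have "x = - (c \<bowtie> x) + (- (b \<bowtie> x) - a \<bowtie> (b \<bowtie> x)) + (- (a \<bowtie> x) - b \<bowtie> (a \<bowtie> x))"
    using sharp_sharp_polarized[of a b e x] unfolding products traces by simp
  also have "\<dots> = - (a \<bowtie> x + b \<bowtie> x + c \<bowtie> x) - (a \<bowtie> (b \<bowtie> x) + b \<bowtie> (a \<bowtie> x))" by simp
  also have "\<dots> = x - (a \<bowtie> (b \<bowtie> x) + b \<bowtie> (a \<bowtie> x))" unfolding sum by simp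
  finally show ?thesis by (metis add_diff_cancel_left' diff_add_cancel eq_iff_diff_eq_0 diff_zero)
qed

lemma cross_idempotents_orthogonal:
  assumes frame: "frame a b c" and x: "frame_orthogonal a b c x"
  shows "b \<bowtie> (a \<bowtie> x) = 0"
proof -
  note twice = cross_idempotent_twice[OF frame] and anti = cross_idempotents_anticommute[OF frame]
  have ab: "a \<bowtie> (b \<bowtie> x) = - (b \<bowtie> (a \<bowtie> x))" using anti[OF x] by (simp add: eq_neg_iff_add_eq_0)
  have "a \<bowtie> (b \<bowtie> (a \<bowtie> x)) = b \<bowtie> (a \<bowtie> x)"
    using anti[OF frame_orthogonal_cross(1)[OF frame x]] by (simp add: twice[OF x] bilinear_simps)
  moreover have "a \<bowtie> (a \<bowtie> (b \<bowtie> x)) = - (a \<bowtie> (b \<bowtie> x))"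
    by (rule twice[OF frame_orthogonal_cross(2)[OF frame x]])
  ultimately have "b \<bowtie> (a \<bowtie> x) + b \<bowtie> (a \<bowtie> x) = 0"
    unfolding ab by (simp add: bilinear_simps)
  then have "2 *s (b \<bowtie> (a \<bowtie> x)) = 0" by (simp add: vec_eq_iff)
  then show ?thesis using two_nonzero by simp
qed

lemma peirce_cross_idempotent:
  assumes frame: "frame a b c" and x: "frame_orthogonal a b c x"
  shows "peirce a b c (- (a \<bowtie> x))"
  using cross_idempotent_twice[OF assms] cross_idempotents_orthogonal[OF assms]
    cross_idempotents_orthogonal[OF frame_flip[OF frame] frame_orthogonal_flip[OF x]]
    frame_orthogonal_cross(1)[OF assms]
  by (simp add: peirce_def frame_orthogonal_def bilinear_simps)

lemma peirce_decomposition: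
  assumes frame: "frame a b c" and x: "frame_orthogonal a b c x"
  shows "x = - (a \<bowtie> x) - (b \<bowtie> x) - (c \<bowtie> x)"
proof -
  have "a \<bowtie> x + b \<bowtie> x + c \<bowtie> x = - x"
    using cross_unit_frame_orthogonal(2)[OF assms] by (simp add: frame_sum[OF frame] bilinear_simps)
  then have "x = - (a \<bowtie> x + b \<bowtie> x + c \<bowtie> x)" by simp
  then show ?thesis by (simp only: minus_add_distrib diff_conv_add_uminus)
qed

lemma sharp_cnorm_diagonal:
  assumes frame: "frame a b c"
  shows "sharp (k *s a + l *s b + m *s c) = (l * m) *s a + (m * k) *s b + (k * l) *s c"
    and "cnorm (k *s a + l *s b + m *s c) = k * l * m"
proof -
  note idempotents = sharp_idempotent[OF frame] sharp_idempotent[OF frame_rotate[OF frame]]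
    sharp_idempotent[OF frame_rotate[OF frame_rotate[OF frame]]]
  show sharp: "sharp (k *s a + l *s b + m *s c) = (l * m) *s a + (m * k) *s b + (k * l) *s c"
    by (simp add: sharp_add bilinear_simps sharp_scale idempotents frameD[OF frame] ac_simps)
  have "3 * cnorm (k *s a + l *s b + m *s c) = 3 * (k * l * m)"
    unfolding trace_sharp_self(1)[symmetric] sharp by (simp add: bilinear_simps frameD[OF frame] algebra_simps)
  then show "cnorm (k *s a + l *s b + m *s c) = k * l * m"
    by (rule mult_left_cancel[THEN iffD1, OF three_nonzero])
qed

lemma sharp_cnorm_off_diagonal:
  assumes frame: "frame a b c" and x: "peirce a b c x" and y: "peirce b c a y" and z: "peirce c a b z"
  shows "sharp (x + y + z) = - (quad x *s a) - quad y *s b - quad z *s c + (x \<bowtie> y + x \<bowtie> z + y \<bowtie> z)"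
    and "cnorm (x + y + z) = T x (y \<bowtie> z)"
proof -
  note bca = frame_rotate[OF frame] and cab = frame_rotate[OF frame_rotate[OF frame]]
  show sharp: "sharp (x + y + z) = - (quad x *s a) - quad y *s b - quad z *s c + (x \<bowtie> y + x \<bowtie> z + y \<bowtie> z)"
    by (simp add: sharp_add bilinear_simps sharp_peirce[OF frame x] sharp_peirce[OF bca y] sharp_peirce[OF cab z])
  have products: "peirce c a b (x \<bowtie> y)" "peirce b c a (z \<bowtie> x)" "peirce a b c (y \<bowtie> z)"
    using peirce_cross[OF frame x y] peirce_cross[OF cab z x] peirce_cross[OF bca y z] by auto
  have orthogonal: "T x (x \<bowtie> y) = 0" "T x (z \<bowtie> x) = 0" "T y (x \<bowtie> y) = 0" "T y (y \<bowtie> z) = 0"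
     "T z (z \<bowtie> x) = 0" "T z (y \<bowtie> z) = 0"
    using trace_distinct_peirce[OF frame x products(2)] trace_distinct_peirce[OF cab products(1) x]
      trace_distinct_peirce[OF bca y products(1)] trace_distinct_peirce[OF frame products(3) y]
      trace_distinct_peirce[OF bca products(2) z] trace_distinct_peirce[OF cab z products(3)]
      trace_commute by metis+
  have cyclic: "T y (z \<bowtie> x) = T x (y \<bowtie> z)" "T z (x \<bowtie> y) = T x (y \<bowtie> z)"
    by (metis trace_cross_left_commute cross_commute)+
  have "3 * cnorm (x + y + z) = 3 * T x (y \<bowtie> z)"
    unfolding trace_sharp_self(1)[symmetric] sharp using x y z orthogonal
    by (simp add: bilinear_simps peirce_def cross_commute[of x z] cyclic)
  then show "cnorm (x + y + z) = T x (y \<bowtie> z)" by (rule mult_left_cancel[THEN iffD1, OF three_nonzero])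
qed

lemma cnorm_frame:
  assumes frame: "frame a b c" and x: "peirce a b c x" and y: "peirce b c a y" and z: "peirce c a b z"
  shows "cnorm (k *s a + l *s b + m *s c + (x + y + z))
    = k * l * m - k * quad x - l * quad y - m * quad z + T x (y \<bowtie> z)"
proof -
  let ?l = "k *s a + l *s b + m *s c"
  note bca = frame_rotate[OF frame] and cab = frame_rotate[OF frame_rotate[OF frame]]
  note swap_idempotents = trace_commute[of a] trace_commute[of b] trace_commute[of c]
  have "T ?l (x \<bowtie> y) = 0" "T ?l (x \<bowtie> z) = 0" "T ?l (y \<bowtie> z) = 0"
    using peirce_cross[OF frame x y] peirce_cross[OF cab z x] peirce_cross[OF bca y z]
    by (simp_all add: bilinear_simps swap_idempotents cross_commute[of x z] peirce_def)
  then have "T ?l (sharp (x + y + z)) = - k * quad x - l * quad y - m * quad z"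
    unfolding sharp_cnorm_off_diagonal(1)[OF assms]
    by (simp only: trace_add_right) (simp add: bilinear_simps frameD[OF frame] algebra_simps)
  moreover have "T (sharp ?l) (x + y + z) = 0"
    unfolding sharp_cnorm_diagonal(1)[OF frame] using x y z
    by (simp add: bilinear_simps peirce_def swap_idempotents)
  ultimately show ?thesis
    unfolding cnorm_add[of ?l] sharp_cnorm_diagonal(2)[OF frame] sharp_cnorm_off_diagonal(2)[OF assms] by simp
qed

end

context cubic_jordan
begin

lemma jordan_linear_right: "jordan l (x + y) = jordan l x + jordan l y" "jordan l (k *s x) = k *s jordan l x"
  by (simp_all add: jordan_def bilinear_simps vec_eq_iff algebra_simps)

lemma jordan_commute: "jordan x y = jordan y x"
  by (simp add: jordan_def cross_commute[of y x] algebra_simps)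

lemma jordan_unit: "jordan e x = x"
proof (rule vec.scale_left_imp_eq[OF two_nonzero])
  show "2 *s jordan e x = 2 *s x"
    using two_nonzero by (simp add: jordan_def cross_unit_left bilinear_simps trace_unit_unit vec_eq_iff
      algebra_simps)
qed

lemma jordan_linear_left: "jordan (x + y) z = jordan x z + jordan y z" "jordan (k *s x) z = k *s jordan x z"
  "jordan (x - y) z = jordan x z - jordan y z"
  using jordan_linear_right(1)[of z x y] jordan_linear_right(2)[of z k x] jordan_linear_right(1)[of z "x - y" y]
  by (simp_all add: jordan_commute[of _ z])

lemma jordan_zero: "jordan x 0 = 0" "jordan 0 x = 0"
  by (simp_all add: jordan_def)

lemma trace_jordan: "T (jordan x y) z = T y (jordan x z)"
  unfolding jordan_def
  by (simp add: bilinear_simps trace_cross_unit trace_cross_assoc[of x y z] trace_commute[of "y" "x \<bowtie> z"]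
      trace_cross_left_commute[of x y z] trace_commute[of e z] trace_commute[of y x] algebra_simps)

lemma jordan_self: "jordan x x = sharp x + T x e *s x - T (sharp x) e *s e"
proof (rule vec.scale_left_imp_eq[OF two_nonzero])
  show "2 *s jordan x x = 2 *s (sharp x + T x e *s x - T (sharp x) e *s e)"
    using two_nonzero by (simp add: jordan_def cross_self bilinear_simps vec_eq_iff algebra_simps)
qed

lemma two_jordan: "2 *s jordan x y = x \<bowtie> y + T x e *s y + T y e *s x - T (x \<bowtie> y) e *s e"
  using two_nonzero by (simp add: jordan_def)

lemma cross_cross_left:
  "x \<bowtie> (x \<bowtie> y) = T x e *s ((T x e * T y e - T x y) *s e - x \<bowtie> y)
    + T y e *s (T (sharp x) e *s e - sharp x)
    - sharp x \<bowtie> y - T (sharp x) e *s y - T (sharp x) y *s e - (T x e * T y e - T x y) *s x"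
  using cross_cross_common[of x e y]
  by (simp add: cross_unit_left cross_unit_right bilinear_simps trace_cross_unit trace_commute[of e y])
      (simp add: vec_eq_iff algebra_simps)

lemma U_op_jordan: "U_op x y = 2 *s jordan x (jordan x y) - jordan (jordan x x) y"
proof (rule vec.scale_left_imp_eq[OF two_nonzero])
  have t: "T x x = T x e * T x e - 2 * T (sharp x) e"
    using trace_cross_unit[of x x] by (simp add: cross_self bilinear_simps)
  have "2 *s (2 *s jordan x (jordan x y) - jordan (jordan x x) y)
    = 2 *s (jordan x (2 *s jordan x y)) - 2 *s jordan (jordan x x) y"
    by (simp add: jordan_linear_right vec.scale_right_diff_distrib)
  also have "\<dots> = 2 *s U_op x y"
    unfolding two_jordan jordan_self U_op_def
    by (simp add: two_jordan bilinear_simps cross_unit_left cross_unit_right trace_unit_unit trace_cross_unit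
        cross_cross_left cross_self trace_cross_self t)
      (simp add: vec_eq_iff algebra_simps)
  finally show "2 *s U_op x y = 2 *s (2 *s jordan x (jordan x y) - jordan (jordan x x) y)" by simp
qed

lemma linearized_characteristic:
  "2 *s jordan (jordan y y) x + U_op y x - T y e *s (2 *s jordan y x) + T (sharp y) e *s x
    = T x e *s sharp y + T y x *s y + (T (sharp y) x - T (sharp y) e * T x e) *s e"
proof -
  have t: "T (y \<bowtie> x) e = T y e * T x e - T y x" "T (sharp y \<bowtie> x) e = T (sharp y) e * T x e - T (sharp y) x"
    by (simp_all add: trace_cross_unit)
  show ?thesis unfolding two_jordan jordan_self U_op_def
    by (simp add: bilinear_simps cross_unit_left trace_unit_unit t) (simp add: vec_eq_iff algebra_simps)
qed

lemma U_op_unit: "U_op e y = y"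
  by (simp add: U_op_def cross_unit_left trace_commute[of e y])

lemma U_op_linear: "U_op x (y + z) = U_op x y + U_op x z" "U_op x (k *s y) = k *s U_op x y"
  by (simp_all add: U_op_def bilinear_simps vec_eq_iff algebra_simps)

lemma trace_U_op: "T (U_op x y) z = T y (U_op x z)"
  by (simp add: U_op_def bilinear_simps trace_cross_left_commute[of "sharp x" y z] trace_cross_assoc
      trace_commute[of y x])

definition act :: "'a ^ 'n \<Rightarrow> 'a ^ 'n \<Rightarrow> 'a ^ 'n" where "act l x = - (l \<bowtie> x)"

definition jinverse :: "'a ^ 'n \<Rightarrow> 'a ^ 'n" where "jinverse l = inverse (cnorm l) *s sharp l"

lemma act_linear: "act l (x + y) = act l x + act l y" "act l (x - y) = act l x - act l y"
  "act l (k *s x) = k *s act l x" "act l (- x) = - act l x" "act l 0 = 0"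
  "act (l + l') x = act l x + act l' x" "act (l - l') x = act l x - act l' x"
  "act (k *s l) x = k *s act l x" "act (- l) x = - act l x" "act 0 x = 0"
  by (simp_all add: act_def bilinear_simps vec.scale_minus_right)

lemma act_unit: "T x e = 0 \<Longrightarrow> act e x = x"
  by (simp add: act_def cross_unit_left)

lemma trace_act: "T (act x y) z = T y (act x z)"
  by (simp add: act_def bilinear_simps) (metis trace_cross_assoc cross_commute)

lemma trace_cross_act: "T (x \<bowtie> y) l = - T x (act l y)"
  by (simp add: act_def bilinear_simps trace_cross_assoc cross_commute[of l])

end

section \<open>Polynomial curves and R-triviality\<close>

definition poly_fun :: "nat \<Rightarrow> ('a::field \<Rightarrow> 'a) \<Rightarrow> bool" where
  "poly_fun d F \<longleftrightarrow> (\<exists>p. degree p \<le> d \<and> (\<forall>t. F t = poly p t))"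

definition poly_curve :: "nat \<Rightarrow> ('a::field \<Rightarrow> 'a ^ 'n) \<Rightarrow> bool" where
  "poly_curve d F \<longleftrightarrow> (\<forall>i. poly_fun d (\<lambda>t. F t $ i))"

lemma poly_fun_const: "poly_fun d (\<lambda>t. c)"
  unfolding poly_fun_def by (rule exI[of _ "[:c:]"]) simp

lemma poly_fun_add: "poly_fun d F \<Longrightarrow> poly_fun d G \<Longrightarrow> poly_fun d (\<lambda>t. F t + G t)"
  unfolding poly_fun_def using degree_add_le poly_add by metis

lemma poly_fun_mult: "poly_fun d F \<Longrightarrow> poly_fun d' G \<Longrightarrow> poly_fun (d + d') (\<lambda>t. F t * G t)"
  unfolding poly_fun_def by (metis poly_mult degree_mult_le add_mono order_trans)

lemma poly_fun_minus: "poly_fun d F \<Longrightarrow> poly_fun d (\<lambda>t. - F t)"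
  unfolding poly_fun_def by (metis poly_minus degree_minus)

lemma poly_fun_mono: "poly_fun d F \<Longrightarrow> d \<le> d' \<Longrightarrow> poly_fun d' F"
  unfolding poly_fun_def by (meson order_trans)

lemma poly_fun_cmult: "poly_fun d F \<Longrightarrow> poly_fun d (\<lambda>t. c * F t)"
  using poly_fun_mult[OF poly_fun_const[of 0 c]] by simp

lemma poly_fun_mult_const: "poly_fun d F \<Longrightarrow> poly_fun d (\<lambda>t. F t * c)"
  using poly_fun_cmult[of d F c] by (simp add: mult.commute)

lemma poly_fun_sum: "(\<And>i. i \<in> A \<Longrightarrow> poly_fun d (F i)) \<Longrightarrow> poly_fun d (\<lambda>t. \<Sum>i\<in>A. F i t)"
  by (induction A rule: infinite_finite_induct) (auto intro: poly_fun_const poly_fun_add)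

lemma poly_fun_power: "poly_fun d (\<lambda>t. t ^ d)"
  unfolding poly_fun_def by (rule exI[of _ "monom 1 d"]) (simp add: poly_monom degree_monom_le)

lemma poly_fun_imp_poly: "poly_fun d F \<Longrightarrow> \<exists>p. \<forall>t. F t = poly p t"
  by (auto simp: poly_fun_def)

lemma poly_curve_const: "poly_curve d (\<lambda>t. c)"
  by (simp add: poly_curve_def poly_fun_const)

lemma poly_curve_add: "poly_curve d F \<Longrightarrow> poly_curve d G \<Longrightarrow> poly_curve d (\<lambda>t. F t + G t)"
  by (simp add: poly_curve_def poly_fun_add)

lemma poly_curve_minus: "poly_curve d F \<Longrightarrow> poly_curve d (\<lambda>t. - F t)"
  by (simp add: poly_curve_def poly_fun_minus)

lemma poly_curve_diff: "poly_curve d F \<Longrightarrow> poly_curve d G \<Longrightarrow> poly_curve d (\<lambda>t. F t - G t)"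
  using poly_curve_add[OF _ poly_curve_minus] by fastforce

lemma poly_curve_scale: "poly_fun d f \<Longrightarrow> poly_curve d' F \<Longrightarrow> poly_curve (d + d') (\<lambda>t. f t *s F t)"
  by (simp add: poly_curve_def poly_fun_mult)

lemma poly_curve_mono: "poly_curve d F \<Longrightarrow> d \<le> d' \<Longrightarrow> poly_curve d' F"
  unfolding poly_curve_def using poly_fun_mono by blast

lemma poly_curve_power: "poly_curve d (\<lambda>t. t ^ d *s c)"
  using poly_curve_scale[OF poly_fun_power poly_curve_const[of 0 c], of d] by simp

context cubic_jordan
begin

lemma cross_axis_expansion: "x \<bowtie> y = (\<Sum>i\<in>UNIV. \<Sum>j\<in>UNIV. (x $ i * y $ j) *s (axis i 1 \<bowtie> axis j 1))"
proof -
  have "x \<bowtie> y = (\<Sum>i\<in>UNIV. x $ i *s axis i 1) \<bowtie> (\<Sum>j\<in>UNIV. y $ j *s axis j 1)"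
    by (simp only: basis_expansion)
  also have "\<dots> = (\<Sum>i\<in>UNIV. (x $ i *s axis i 1) \<bowtie> (\<Sum>j\<in>UNIV. y $ j *s axis j 1))"
    by (rule cross_sum_left)
  also have "\<dots> = (\<Sum>i\<in>UNIV. \<Sum>j\<in>UNIV. (x $ i *s axis i 1) \<bowtie> (y $ j *s axis j 1))"
    by (simp only: cross_sum_right)
  also have "\<dots> = (\<Sum>i\<in>UNIV. \<Sum>j\<in>UNIV. (x $ i * y $ j) *s (axis i 1 \<bowtie> axis j 1))"
    by (simp add: bilinear_simps mult.commute)
  finally show ?thesis .
qed

lemma trace_axis_expansion: "T x y = (\<Sum>i\<in>UNIV. \<Sum>j\<in>UNIV. (x $ i * y $ j) * T (axis i 1) (axis j 1))"
proof -
  have "T x y = T (\<Sum>i\<in>UNIV. x $ i *s axis i 1) (\<Sum>j\<in>UNIV. y $ j *s axis j 1)"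
    by (simp only: basis_expansion)
  also have "\<dots> = (\<Sum>i\<in>UNIV. T (x $ i *s axis i 1) (\<Sum>j\<in>UNIV. y $ j *s axis j 1))"
    by (rule trace_sum_left)
  also have "\<dots> = (\<Sum>i\<in>UNIV. \<Sum>j\<in>UNIV. T (x $ i *s axis i 1) (y $ j *s axis j 1))"
    by (simp only: trace_sum_right)
  also have "\<dots> = (\<Sum>i\<in>UNIV. \<Sum>j\<in>UNIV. (x $ i * y $ j) * T (axis i 1) (axis j 1))"
    by (simp add: bilinear_simps ac_simps)
  finally show ?thesis .
qed

lemma poly_fun_trace: "poly_curve d F \<Longrightarrow> poly_curve d' G \<Longrightarrow> poly_fun (d + d') (\<lambda>t. T (F t) (G t))"
  unfolding trace_axis_expansion[of "F _"]
  by (intro poly_fun_sum poly_fun_mult_const poly_fun_mult) (auto simp: poly_curve_def)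

lemma poly_curve_cross: "poly_curve d F \<Longrightarrow> poly_curve d' G \<Longrightarrow> poly_curve (d + d') (\<lambda>t. F t \<bowtie> G t)"
  unfolding cross_axis_expansion[of "F _"] poly_curve_def sum_component vector_smult_component
  by (intro allI poly_fun_sum poly_fun_mult_const poly_fun_mult) auto

lemma poly_fun_quad: "poly_curve d F \<Longrightarrow> poly_fun (d + d) (\<lambda>t. quad (F t))"
  using poly_fun_cmult[OF poly_fun_trace, of d F d F "inverse 2"] by (simp add: quad_def field_simps)

end

definition pole_poly :: "'a::field \<Rightarrow> 'a poly" where
  "pole_poly m = [:1, 0, m:]"

lemma poly_pole_poly: "poly (pole_poly m) t = 1 + m * t^2"
  by (simp add: pole_poly_def power2_eq_square algebra_simps)

lemma pole_poly_nonzero: "pole_poly m \<noteq> 0"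
  by (simp add: pole_poly_def)

lemma degree_pole_poly: "m \<noteq> 0 \<Longrightarrow> degree (pole_poly m) = 2"
  by (simp add: pole_poly_def)

lemma pole_poly_bezout: "smult m (pole_poly k) - smult k (pole_poly m) = [:m - k:]"
  by (simp add: pole_poly_def)

lemma pole_poly_dvd_mult_cancel:
  assumes "m \<noteq> (k::'a::field)" "pole_poly m dvd pole_poly k * p" shows "pole_poly m dvd p"
proof -
  have "pole_poly m dvd smult m (pole_poly k * p) - smult k (pole_poly m * p)"
    using assms(2) by (intro dvd_diff dvd_smult) auto
  also have "smult m (pole_poly k * p) - smult k (pole_poly m * p)
      = (smult m (pole_poly k) - smult k (pole_poly m)) * p"
    by (simp add: algebra_simps)
  also have "\<dots> = smult (m - k) p" by (simp only: pole_poly_bezout) simp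
  finally show ?thesis using assms(1) by (simp add: dvd_smult_iff)
qed

lemma pole_poly_mult_dvd:
  assumes "m \<noteq> (k::'a::field)" "pole_poly m dvd p" "pole_poly k dvd p" shows "pole_poly m * pole_poly k dvd p"
proof -
  from assms(3) obtain r where r: "p = pole_poly k * r" by (auto simp: dvd_def)
  have "pole_poly m dvd r" using assms(1,2) pole_poly_dvd_mult_cancel unfolding r by blast
  then show ?thesis unfolding r by (metis mult.commute mult_dvd_mono dvd_refl)
qed

lemma pole_poly_square_dvd_mult_cancel:
  assumes "m \<noteq> (k::'a::field)" "pole_poly m * pole_poly m dvd pole_poly k * p"
  shows "pole_poly m * pole_poly m dvd p"
proof -
  have "pole_poly m dvd pole_poly k * p" using assms(2) by (meson dvd_trans dvd_triv_left)
  then obtain r where r: "p = pole_poly m * r" using pole_poly_dvd_mult_cancel[OF assms(1)] by (auto simp: dvd_def)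
  have "pole_poly m * pole_poly m dvd pole_poly m * (pole_poly k * r)"
    using assms(2) unfolding r by (simp add: ac_simps)
  then have "pole_poly m dvd pole_poly k * r" using pole_poly_nonzero[of m] by (simp add: dvd_mult_cancel_left)
  then have "pole_poly m dvd r" using pole_poly_dvd_mult_cancel[OF assms(1)] by blast
  then show ?thesis unfolding r by (simp add: mult_dvd_mono)
qed

lemma dvd_degree_le_imp_smult:
  assumes "q dvd p" "degree p \<le> degree q" "q \<noteq> (0::'a::field poly)"
  shows "\<exists>c. p = smult c q"
proof -
  from assms(1) obtain r where r: "p = q * r" by (auto simp: dvd_def)
  show ?thesis
  proof (cases "r = 0")
    case True then show ?thesis using r by (intro exI[of _ 0]) simp
  next
    case False
    then have "degree r = 0" using r assms by (simp add: degree_mult_eq)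
    then obtain c where "r = [:c:]" by (metis degree_eq_zeroE)
    then show ?thesis using r by (intro exI[of _ c]) simp
  qed
qed

lemma poly_eqI_infinite:
  assumes "infinite (UNIV :: 'a::field set)" "\<And>t. poly p t = poly q (t::'a)" shows "p = q"
proof (rule ccontr)
  assume "p \<noteq> q"
  then have "finite {t. poly (p - q) t = 0}" by (intro poly_roots_finite) simp
  then show False using assms by simp
qed

context cubic_jordan
begin

lemma poly_curve_sharp: "poly_curve d F \<Longrightarrow> poly_curve (d + d) (\<lambda>t. sharp (F t))"
  using poly_curve_scale[OF poly_fun_const[of 0] poly_curve_cross] unfolding sharp_def by fastforce

lemma poly_fun_cnorm: "poly_curve d F \<Longrightarrow> poly_fun (d + (d + d)) (\<lambda>t. cnorm (F t))"
  unfolding cnorm_def divide_inverse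
  by (intro poly_fun_mult_const poly_fun_trace poly_curve_sharp)

definition similarity :: "'a \<Rightarrow> ('a ^ 'n \<Rightarrow> 'a ^ 'n) \<Rightarrow> bool" where
  "similarity \<nu> g \<longleftrightarrow> Vector_Spaces.linear (*s) (*s) g \<and> \<nu> \<noteq> 0 \<and> (\<forall>x. cnorm (g x) = \<nu> * cnorm x)"

lemma similarityI:
  assumes "\<And>x y. g (x + y) = g x + g y" "\<And>k x. g (k *s x) = k *s g x"
    and "\<nu> \<noteq> 0" "\<And>x. cnorm (g x) = \<nu> * cnorm x"
  shows "similarity \<nu> g"
proof -
  have "Vector_Spaces.linear (*s) (*s) g" by unfold_locales (simp_all add: assms(1,2))
  then show ?thesis using assms(3,4) by (simp add: similarity_def)
qed

lemma similarityD:
  assumes "similarity \<nu> g"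
  shows "Vector_Spaces.linear (*s) (*s) g" "g (x + y) = g x + g y" "g (k *s x) = k *s g x"
    "\<nu> \<noteq> 0" "cnorm (g x) = \<nu> * cnorm x"
  using assms vec.linear_add vec.linear_scale unfolding similarity_def by blast+

lemma similarity_id: "similarity 1 (\<lambda>x. x)"
  by (rule similarityI) simp_all

lemma similarity_comp:
  assumes "similarity \<nu> g" "similarity \<nu>' h" shows "similarity (\<nu>' * \<nu>) (\<lambda>x. h (g x))"
  by (rule similarityI) (simp_all add: similarityD[OF assms(1)] similarityD[OF assms(2)])

lemma similarity_scale: "k \<noteq> 0 \<Longrightarrow> similarity (k^3) ((*s) k)"
  by (rule similarityI) (simp_all add: cnorm_scale vec.scale_right_distrib mult.commute)

lemma similarity_U_op: "cnorm x \<noteq> 0 \<Longrightarrow> similarity ((cnorm x)^2) (U_op x)"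
  by (rule similarityI) (simp_all add: U_op_linear cnorm_U_op)

lemma similarity_polarized:
  assumes linear: "Vector_Spaces.linear (*s) (*s) g"
    and norm: "\<And>x. x \<in> W \<Longrightarrow> cnorm (g x) = \<nu> * cnorm x"
    and W: "vec.subspace W" and xyz: "x \<in> W" "y \<in> W" "z \<in> W"
  shows "T (sharp (g x)) (g y) = \<nu> * T (sharp x) y" "T (g x \<bowtie> g y) (g z) = \<nu> * T (x \<bowtie> y) z"
proof -
  note g = vec.linear_add[OF linear] vec.linear_diff[OF linear]
  have difference: "2 * T (sharp x) y = cnorm (x + y) - cnorm (x - y) - 2 * cnorm y" for x y
    by (simp add: cnorm_add cnorm_diff algebra_simps)
  have quadratic: "T (sharp (g x)) (g y) = \<nu> * T (sharp x) y" if xy: "x \<in> W" "y \<in> W" for x y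
  proof (rule mult_left_cancel[THEN iffD1, OF two_nonzero])
    have "2 * T (sharp (g x)) (g y) = \<nu> * (2 * T (sharp x) y)"
      unfolding difference g[symmetric] norm[OF vec.subspace_add[OF W xy]] norm[OF vec.subspace_diff[OF W xy]]
        norm[OF xy(2)]
      by (simp add: algebra_simps)
    then show "2 * T (sharp (g x)) (g y) = 2 * (\<nu> * T (sharp x) y)" by simp
  qed
  show "T (sharp (g x)) (g y) = \<nu> * T (sharp x) y" by (rule quadratic[OF xyz(1,2)])
  have cross: "x \<bowtie> y = sharp (x + y) - sharp x - sharp y" for x y by (simp add: sharp_add)
  show "T (g x \<bowtie> g y) (g z) = \<nu> * T (x \<bowtie> y) z"
    unfolding cross[of "g x"] cross[of x] trace_diff_left g[symmetric]
      quadratic[OF vec.subspace_add[OF W xyz(1,2)] xyz(3)] quadratic[OF xyz(1,3)] quadratic[OF xyz(2,3)]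
    by (simp add: algebra_simps)
qed

text \<open>The polynomial \<open>f\<close> is a common denominator of the rational curve \<open>R\<close>.\<close>

definition rational_path :: "('a ^ 'n \<Rightarrow> 'a ^ 'n) \<Rightarrow> bool" where
  "rational_path \<rho> \<longleftrightarrow> (\<exists>R f. (\<exists>d. poly_fun d f) \<and> f 0 \<noteq> 0 \<and> f 1 \<noteq> 0
     \<and> (\<forall>x. \<exists>d. poly_curve d (\<lambda>t. f t *s R t x))
     \<and> (\<forall>t. f t \<noteq> 0 \<longrightarrow> (\<exists>\<nu>. similarity \<nu> (R t))) \<and> R 0 = (\<lambda>x. x) \<and> R 1 = \<rho>)"

inductive R_trivial :: "('a ^ 'n \<Rightarrow> 'a ^ 'n) \<Rightarrow> bool" where
  R_trivial_id: "R_trivial (\<lambda>x. x)"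
| R_trivial_step: "rational_path \<rho> \<Longrightarrow> R_trivial \<rho>' \<Longrightarrow> R_trivial (\<lambda>x. \<rho>' (\<rho> x))"

lemma rational_path_imp_R_trivial: "rational_path \<rho> \<Longrightarrow> R_trivial \<rho>"
  using R_trivial_step[OF _ R_trivial_id] by blast

lemma R_trivial_comp: "R_trivial \<rho> \<Longrightarrow> R_trivial \<rho>' \<Longrightarrow> R_trivial (\<lambda>x. \<rho>' (\<rho> x))"
proof (induction rule: R_trivial.induct)
  case (R_trivial_step \<rho>1 \<rho>2)
  show ?case using R_trivial.R_trivial_step[OF R_trivial_step(1) R_trivial_step.IH[OF R_trivial_step.prems]]
    by simp
qed simp

lemma R_trivial_imp_similarity: "R_trivial \<rho> \<Longrightarrow> \<exists>\<nu>. similarity \<nu> \<rho>"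
proof (induction rule: R_trivial.induct)
  case R_trivial_id
  then show ?case using similarity_id by blast
next
  case (R_trivial_step \<rho> \<rho>')
  then have "\<exists>\<nu>. similarity \<nu> \<rho>" unfolding rational_path_def by metis
  then show ?case using R_trivial_step.IH similarity_comp by blast
qed

lemma poly_fun_line: "poly_fun 1 (\<lambda>t. \<alpha> + t * \<beta>)"
  unfolding poly_fun_def by (rule exI[of _ "[:\<alpha>, \<beta>:]"]) simp

lemma R_trivial_scale: assumes "k \<noteq> 0" shows "R_trivial ((*s) k)"
proof (rule rational_path_imp_R_trivial)
  define f where "f t = 1 + t * (k - 1)" for t
  have f: "poly_fun 1 f" unfolding f_def by (rule poly_fun_line)
  have "poly_curve (1 + 1 + 0) (\<lambda>t. f t *s (f t *s x))" for x
    using poly_curve_scale[OF poly_fun_mult[OF f f] poly_curve_const[of 0 x]] by (simp only: vec.scale_scale)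
  moreover have "f 0 = 1" "f 1 = k" by (simp_all add: f_def)
  ultimately show "rational_path ((*s) k)"
    unfolding rational_path_def using f assms similarity_scale
    by (intro exI[of _ "\<lambda>t. (*s) (f t)"] exI[of _ f]) (auto simp: fun_eq_iff)
qed

lemma R_trivial_U_op: assumes "cnorm x \<noteq> 0" shows "R_trivial (U_op x)"
proof (rule rational_path_imp_R_trivial)
  let ?l = "\<lambda>t. e + t *s (x - e)"
  have line: "poly_curve 1 ?l"
    unfolding poly_curve_def vector_add_component vector_smult_component by (intro allI poly_fun_line)
  have norm: "poly_fun (1 + (1 + 1)) (\<lambda>t. cnorm (?l t))" by (rule poly_fun_cnorm[OF line])
  have "poly_curve (1 + (1 + 1) + (1 + 1)) (\<lambda>t. cnorm (?l t) *s U_op (?l t) y)" for y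
  proof (rule poly_curve_scale[OF norm])
    have "poly_curve (1 + 0 + 1) (\<lambda>t. T (?l t) y *s ?l t)"
      by (rule poly_curve_scale[OF poly_fun_trace[OF line poly_curve_const] line])
    moreover have "poly_curve (1 + 1 + 0) (\<lambda>t. sharp (?l t) \<bowtie> y)"
      by (rule poly_curve_cross[OF poly_curve_sharp[OF line] poly_curve_const])
    ultimately show "poly_curve (1 + 1) (\<lambda>t. U_op (?l t) y)"
      unfolding U_op_def by (intro poly_curve_diff) (simp_all only: add_0_right)
  qed
  then show "rational_path (U_op x)"
    unfolding rational_path_def using norm assms similarity_U_op
    by (intro exI[of _ "\<lambda>t. U_op (?l t)"] exI[of _ "\<lambda>t. cnorm (?l t)"]) (auto simp: U_op_unit fun_eq_iff)
qed

definition R_trivial_on :: "('a ^ 'n) set \<Rightarrow> ('a ^ 'n \<Rightarrow> 'a ^ 'n) \<Rightarrow> bool" where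
  "R_trivial_on W g \<longleftrightarrow> (\<exists>\<rho>. R_trivial \<rho> \<and> (\<forall>x\<in>W. \<rho> x = g x))"

lemma R_trivial_onI: "R_trivial \<rho> \<Longrightarrow> (\<And>x. x \<in> W \<Longrightarrow> \<rho> x = g x) \<Longrightarrow> R_trivial_on W g"
  unfolding R_trivial_on_def by blast

lemma R_trivial_on_comp:
  assumes "R_trivial_on W g" "R_trivial_on W' h" "\<And>x. x \<in> W \<Longrightarrow> g x \<in> W'"
  shows "R_trivial_on W (\<lambda>x. h (g x))"
proof -
  obtain \<rho> \<rho>' where \<rho>: "R_trivial \<rho>" "\<forall>x\<in>W. \<rho> x = g x" and \<rho>': "R_trivial \<rho>'" "\<forall>x\<in>W'. \<rho>' x = h x"
    using assms(1,2) unfolding R_trivial_on_def by blast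
  show ?thesis
    by (rule R_trivial_onI[OF R_trivial_comp[OF \<rho>(1) \<rho>'(1)]]) (simp add: \<rho>(2) \<rho>'(2) assms(3))
qed

lemma R_trivial_on_cong: "R_trivial_on W g \<Longrightarrow> (\<And>x. x \<in> W \<Longrightarrow> g x = h x) \<Longrightarrow> R_trivial_on W h"
  unfolding R_trivial_on_def by fastforce

end

section \<open>Similarities from reflections\<close>

context cubic_jordan
begin

definition reflection_curve :: "'a \<Rightarrow> 'a \<Rightarrow> 'a ^ 'n \<Rightarrow> 'a ^ 'n \<Rightarrow> ('a \<Rightarrow> 'a ^ 'n) \<Rightarrow> 'a \<Rightarrow> 'a ^ 'n" where
  "reflection_curve \<alpha> \<mu> v w y t =
     (1 + \<mu> * t^2) *s y t - (T (v + t *s w) (y t) / \<alpha>) *s (v + t *s w)"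

definition orthogonal_pair :: "'a \<Rightarrow> 'a \<Rightarrow> 'a ^ 'n \<Rightarrow> 'a ^ 'n \<Rightarrow> bool" where
  "orthogonal_pair \<alpha> \<mu> v w \<longleftrightarrow> T v w = 0 \<and> quad v = \<alpha> \<and> quad w = \<alpha> * \<mu> \<and> \<alpha> \<noteq> 0"

definition divisible_along :: "'a ^ 'n \<Rightarrow> 'a ^ 'n \<Rightarrow> 'a ^ 'n \<Rightarrow> 'a \<Rightarrow> 'a ^ 'n \<Rightarrow> 'a ^ 'n \<Rightarrow> ('a \<Rightarrow> 'a ^ 'n) \<Rightarrow> bool" where
  "divisible_along a b c \<mu> v w Y \<longleftrightarrow> (\<exists>Z d. poly_curve d Z \<and> (\<forall>t. peirce a b c (Z t))
      \<and> (\<forall>t. (v + t *s w) \<bowtie> Y t = (1 + \<mu> * t^2) *s Z t))"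

lemma quad_line: "orthogonal_pair \<alpha> \<mu> v w \<Longrightarrow> quad (v + t *s w) = \<alpha> * (1 + \<mu> * t^2)"
  using two_nonzero by (simp add: orthogonal_pair_def quad_def bilinear_simps trace_commute[of w v]
    power2_eq_square field_simps)

lemma trace_line_self: "orthogonal_pair \<alpha> \<mu> v w \<Longrightarrow> T (v + t *s w) (v + t *s w) = 2 * (\<alpha> * (1 + \<mu> * t^2))"
  using quad_line trace_self_quad by metis

lemma quad_reflection_curve:
  assumes "orthogonal_pair \<alpha> \<mu> v w"
  shows "quad (reflection_curve \<alpha> \<mu> v w y t) = (1 + \<mu> * t^2)^2 * quad (y t)"
proof -
  let ?g = "1 + \<mu> * t^2" and ?u = "v + t *s w"
  define k where "k = T ?u (y t) / \<alpha>"
  have k: "k * \<alpha> = T ?u (y t)" using assms by (simp add: orthogonal_pair_def k_def)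
  have "2 * quad (reflection_curve \<alpha> \<mu> v w y t)
      = ?g * ?g * T (y t) (y t) - 2 * (?g * k * T ?u (y t)) + k * k * T ?u ?u"
    unfolding trace_self_quad[symmetric] reflection_curve_def k_def[symmetric]
    by (simp only: trace_diff_left trace_diff_right trace_scale_left trace_scale_right trace_commute[of "y t" ?u])
        (simp add: algebra_simps)
  also have "\<dots> = 2 * (?g^2 * quad (y t))"
    unfolding trace_line_self[OF assms] trace_self_quad[of "y t"] k[symmetric]
    by (simp add: algebra_simps power2_eq_square)
  finally show ?thesis by (rule mult_left_cancel[THEN iffD1, OF two_nonzero])
qed

lemma trace_reflection_curve_line:
  assumes "orthogonal_pair \<alpha> \<mu> v w"
  shows "T (reflection_curve \<alpha> \<mu> v w y t) (v + t *s w) = - ((1 + \<mu> * t^2) * T (v + t *s w) (y t))"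
proof -
  let ?g = "1 + \<mu> * t^2" and ?u = "v + t *s w"
  define k where "k = T ?u (y t) / \<alpha>"
  have k: "k * \<alpha> = T ?u (y t)" using assms by (simp add: orthogonal_pair_def k_def)
  have "T (reflection_curve \<alpha> \<mu> v w y t) ?u = ?g * T ?u (y t) - k * T ?u ?u"
    unfolding reflection_curve_def k_def
    by (simp only: trace_diff_left trace_scale_left trace_commute[of "y t" ?u])
  then show ?thesis unfolding trace_line_self[OF assms] k[symmetric] by (simp add: algebra_simps)
qed

lemma scale_line_peirce:
  assumes frame: "frame a b c" and pair: "orthogonal_pair \<alpha> \<mu> v w"
    and v: "peirce a b c v" "peirce a b c w" and Y: "peirce b c a Y"
    and Z: "(v + t *s w) \<bowtie> Y = (1 + \<mu> * t^2) *s Z"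
  shows "(\<alpha> * (1 + \<mu> * t^2)) *s Y = (1 + \<mu> * t^2) *s ((v + t *s w) \<bowtie> Z)"
proof -
  have u: "peirce a b c (v + t *s w)" using v by (intro peirce_intros)
  show ?thesis using cross_cross_peirce[OF frame u Y]
    unfolding Z quad_line[OF pair] by (simp only: cross_scale_right)
qed

lemma poly_curve_line: "poly_curve 1 (\<lambda>t. v + t *s w)"
  using poly_curve_add[OF poly_curve_const poly_curve_power[of 1 w], of v] by simp

lemma poly_curve_reflection_curve:
  assumes y: "poly_curve 2 y" shows "poly_curve 4 (reflection_curve \<alpha> \<mu> v w y)"
proof -
  have "poly_fun 2 (\<lambda>t. 1 + \<mu> * t^2)"
    by (intro poly_fun_add poly_fun_const poly_fun_cmult poly_fun_power)
  then have scaled: "poly_curve 4 (\<lambda>t. (1 + \<mu> * t^2) *s y t)" using poly_curve_scale y by fastforce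
  have "poly_fun 3 (\<lambda>t. inverse \<alpha> * T (v + t *s w) (y t))"
    using poly_fun_cmult[OF poly_fun_trace[OF poly_curve_line y]] by (simp add: eval_nat_numeral)
  then have "poly_curve 4 (\<lambda>t. (inverse \<alpha> * T (v + t *s w) (y t)) *s (v + t *s w))"
    using poly_curve_scale[OF _ poly_curve_line] by (fastforce simp: eval_nat_numeral)
  from poly_curve_diff[OF scaled this] show ?thesis
    unfolding reflection_curve_def[abs_def] by (simp add: divide_inverse mult.commute)
qed

lemma peirce_reflection_curve:
  "peirce a b c v \<Longrightarrow> peirce a b c w \<Longrightarrow> peirce a b c (y t) \<Longrightarrow> peirce a b c (reflection_curve \<alpha> \<mu> v w y t)"
  unfolding reflection_curve_def by (intro peirce_intros)

lemma quad_divided: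
  assumes frame: "frame a b c" and pair: "orthogonal_pair \<alpha> \<mu> v w"
    and line: "peirce a b c v" "peirce a b c w" and Y: "peirce b c a Y" and Z: "peirce c a b Z"
    and divided: "(v + t *s w) \<bowtie> Y = (1 + \<mu> * t^2) *s Z"
  shows "\<alpha> * ((1 + \<mu> * t^2)^2 * quad Y) = (1 + \<mu> * t^2)^3 * quad Z"
proof (rule mult_left_cancel[THEN iffD1])
  show "\<alpha> \<noteq> 0" using pair by (simp add: orthogonal_pair_def)
  let ?g = "1 + \<mu> * t^2" and ?u = "v + t *s w"
  have u: "peirce a c b ?u" using line by (intro peirce_swap[of a b c] peirce_intros)
  have "quad (?u \<bowtie> Z) = (\<alpha> * ?g) * quad Z"
    using quad_cross[OF frame_flip[OF frame] u peirce_swap[OF Z]] quad_line[OF pair] by simp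
  moreover have "quad ((\<alpha> * ?g) *s Y) = quad (?g *s (?u \<bowtie> Z))"
    using scale_line_peirce[OF frame pair line Y divided] by simp
  ultimately have "(\<alpha> * ?g)^2 * quad Y = ?g^2 * ((\<alpha> * ?g) * quad Z)" by (simp only: quad_scale)
  then show "\<alpha> * (\<alpha> * (?g^2 * quad Y)) = \<alpha> * (?g^3 * quad Z)"
    by (simp add: power_mult_distrib power2_eq_square power3_eq_cube ac_simps)
qed

lemma pole_poly_dvd_quad:
  assumes infinite_field: "infinite (UNIV :: 'a set)" and frame: "frame a b c"
    and pair: "orthogonal_pair \<alpha> \<mu> v w" and line: "peirce a b c v" "peirce a b c w"
    and Y: "\<And>t. peirce b c a (Y t)" and divisible: "divisible_along c a b \<mu> v w Y"
    and p: "\<And>t. quad (Y t) = poly p t"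
  shows "pole_poly \<mu> dvd p"
proof -
  obtain Z d where "poly_curve d Z" and Z: "\<And>t. peirce c a b (Z t)"
    "\<And>t. (v + t *s w) \<bowtie> Y t = (1 + \<mu> * t^2) *s Z t"
    using divisible by (auto simp: divisible_along_def)
  then obtain z where z: "\<And>t. quad (Z t) = poly z t" using poly_fun_quad poly_fun_imp_poly by blast
  have "poly (smult \<alpha> (pole_poly \<mu> ^ 2 * p)) t = poly (pole_poly \<mu> ^ 3 * z) t" for t
    using quad_divided[OF frame pair line Y Z] by (simp add: poly_pole_poly z p)
  then have "smult \<alpha> (pole_poly \<mu> ^ 2 * p) = pole_poly \<mu> ^ 3 * z" by (rule poly_eqI_infinite[OF infinite_field])
  then have "pole_poly \<mu> ^ 2 * smult \<alpha> p = pole_poly \<mu> ^ 2 * (pole_poly \<mu> * z)"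
    by (simp add: power2_eq_square power3_eq_cube ac_simps)
  then have "smult \<alpha> p = pole_poly \<mu> * z"
    using pole_poly_nonzero[of \<mu>] mult_left_cancel[of "pole_poly \<mu> ^ 2"] by fastforce
  then have "pole_poly \<mu> dvd smult \<alpha> p" by simp
  then show ?thesis using pair by (simp add: dvd_smult_iff orthogonal_pair_def)
qed

lemma trilinear_divided:
  assumes frame: "frame a b c" and pair: "orthogonal_pair \<alpha> \<mu> v w"
    and line: "peirce a b c v" "peirce a b c w" and Y: "peirce b c a Y'" "peirce c a b Y''"
    and Z: "peirce c a b Z'" "peirce b c a Z''"
    and divided: "(v + t *s w) \<bowtie> Y' = (1 + \<mu> * t^2) *s Z'" "(v + t *s w) \<bowtie> Y'' = (1 + \<mu> * t^2) *s Z''"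
  shows "\<alpha> * ((1 + \<mu> * t^2)^2 * T (reflection_curve \<alpha> \<mu> v w y t) (Y' \<bowtie> Y''))
    = - ((1 + \<mu> * t^2)^4 * T (y t) (Z'' \<bowtie> Z'))"
proof (rule mult_left_cancel[THEN iffD1])
  show nonzero: "\<alpha> \<noteq> 0" using pair by (simp add: orthogonal_pair_def)
  let ?g = "1 + \<mu> * t^2" and ?u = "v + t *s w" and ?Y = "reflection_curve \<alpha> \<mu> v w y t"
  have u: "peirce a b c ?u" using line by (intro peirce_intros)
  have Y': "(\<alpha> * ?g) *s Y' = ?g *s (?u \<bowtie> Z')"
    by (rule scale_line_peirce[OF frame pair line Y(1) divided(1)])
  have Y'': "(\<alpha> * ?g) *s Y'' = ?g *s (?u \<bowtie> Z'')"
    by (rule scale_line_peirce[OF frame_flip[OF frame] pair line[THEN peirce_swap] peirce_swap[OF Y(2)] divided(2)])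
  have crosses: "(?u \<bowtie> Z') \<bowtie> (?u \<bowtie> Z'') = T ?u (Z'' \<bowtie> Z') *s ?u - (\<alpha> * ?g) *s (Z'' \<bowtie> Z')"
    using cross_of_crosses_peirce[OF frame u Z(2,1)] unfolding quad_line[OF pair] trace_cross_assoc
    by (simp add: cross_commute[of "?u \<bowtie> Z'"])
  have reflected: "T ?Y (Z'' \<bowtie> Z') = ?g * T (y t) (Z'' \<bowtie> Z') - (T ?u (y t) / \<alpha>) * T ?u (Z'' \<bowtie> Z')"
    unfolding reflection_curve_def by (simp only: trace_diff_left trace_scale_left)
  have "(\<alpha> * ?g)^2 * T ?Y (Y' \<bowtie> Y'') = T ?Y (((\<alpha> * ?g) *s Y') \<bowtie> ((\<alpha> * ?g) *s Y''))"
    by (simp only: cross_scale_left cross_scale_right trace_scale_right) (simp add: power2_eq_square mult.assoc)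
  also have "\<dots> = ?g^2 * T ?Y ((?u \<bowtie> Z') \<bowtie> (?u \<bowtie> Z''))"
    unfolding Y' Y'' by (simp only: cross_scale_left cross_scale_right trace_scale_right)
      (simp add: power2_eq_square mult.assoc)
  also have "\<dots> = ?g^2 * (T ?u (Z'' \<bowtie> Z') * T ?Y ?u - (\<alpha> * ?g) * T ?Y (Z'' \<bowtie> Z'))"
    unfolding crosses by (simp only: trace_diff_right trace_scale_right)
  also have "\<dots> = \<alpha> * (- (?g^4 * T (y t) (Z'' \<bowtie> Z')))"
    unfolding trace_reflection_curve_line[OF pair] reflected using nonzero
    by (simp add: field_simps power2_eq_square eval_nat_numeral)
  finally show "\<alpha> * (\<alpha> * (?g^2 * T ?Y (Y' \<bowtie> Y''))) = \<alpha> * (- (?g^4 * T (y t) (Z'' \<bowtie> Z')))"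
    by (simp add: power_mult_distrib power2_eq_square ac_simps)
qed

lemma pole_poly_square_dvd_trilinear:
  assumes infinite_field: "infinite (UNIV :: 'a set)" and frame: "frame a b c"
    and pair: "orthogonal_pair \<alpha> \<mu> v w" and line: "peirce a b c v" "peirce a b c w"
    and y: "poly_curve d y" and Y: "\<And>t. peirce b c a (Y' t)" "\<And>t. peirce c a b (Y'' t)"
    and divisible: "divisible_along c a b \<mu> v w Y'" "divisible_along b c a \<mu> v w Y''"
    and p: "\<And>t. T (reflection_curve \<alpha> \<mu> v w y t) (Y' t \<bowtie> Y'' t) = poly p t"
  shows "pole_poly \<mu> * pole_poly \<mu> dvd p"
proof -
  obtain Z' d' where Z'_poly: "poly_curve d' Z'" and Z': "\<And>t. peirce c a b (Z' t)"
    "\<And>t. (v + t *s w) \<bowtie> Y' t = (1 + \<mu> * t^2) *s Z' t"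
    using divisible(1) by (auto simp: divisible_along_def)
  obtain Z'' d'' where Z''_poly: "poly_curve d'' Z''" and Z'': "\<And>t. peirce b c a (Z'' t)"
    "\<And>t. (v + t *s w) \<bowtie> Y'' t = (1 + \<mu> * t^2) *s Z'' t"
    using divisible(2) by (auto simp: divisible_along_def)
  obtain z where z: "\<And>t. T (y t) (Z'' t \<bowtie> Z' t) = poly z t"
    using poly_fun_trace[OF y poly_curve_cross[OF Z''_poly Z'_poly]] poly_fun_imp_poly by blast
  have "poly (smult \<alpha> (pole_poly \<mu> ^ 2 * p)) t = poly (- (pole_poly \<mu> ^ 4 * z)) t" for t
    using trilinear_divided[OF frame pair line Y Z'(1) Z''(1) Z'(2) Z''(2), of t y]
    by (simp add: poly_pole_poly z p)
  then have "smult \<alpha> (pole_poly \<mu> ^ 2 * p) = - (pole_poly \<mu> ^ 4 * z)"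
    by (rule poly_eqI_infinite[OF infinite_field])
  then have "pole_poly \<mu> ^ 2 * smult \<alpha> p = pole_poly \<mu> ^ 2 * (- (pole_poly \<mu> * pole_poly \<mu> * z))"
    by (simp add: power2_eq_square eval_nat_numeral ac_simps)
  then have "smult \<alpha> p = - (pole_poly \<mu> * pole_poly \<mu> * z)"
    using pole_poly_nonzero[of \<mu>] mult_left_cancel[of "pole_poly \<mu> ^ 2"] by fastforce
  then have "pole_poly \<mu> * pole_poly \<mu> dvd smult \<alpha> p" by (metis dvd_minus_iff dvd_triv_left)
  then show ?thesis using pair by (simp add: dvd_smult_iff orthogonal_pair_def)
qed

end

text \<open>The reflection along \<open>v + t w\<close> has a simple pole at the zeros of \<open>1 + \<mu> t\<^sup>2\<close>; the divisibility
  conditions say that the three reflected curves lie in the lattice which compensates these poles.\<close>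

locale reflection_triple = cubic_jordan cr T e
  for cr :: "'a::field ^ 'n \<Rightarrow> 'a ^ 'n \<Rightarrow> 'a ^ 'n"  (infixl "\<bowtie>" 75)
    and T :: "'a ^ 'n \<Rightarrow> 'a ^ 'n \<Rightarrow> 'a" and e :: "'a ^ 'n" +
  fixes a b c :: "'a ^ 'n" and \<alpha> \<alpha>' \<alpha>'' \<mu> \<mu>' \<mu>'' :: 'a
    and v v' v'' w w' w'' :: "'a ^ 'n" and y y' y'' :: "'a \<Rightarrow> 'a ^ 'n"
  assumes infinite_field: "infinite (UNIV :: 'a set)" and frame_abc: "frame a b c"
    and pairs: "orthogonal_pair \<alpha> \<mu> v w" "orthogonal_pair \<alpha>' \<mu>' v' w'" "orthogonal_pair \<alpha>'' \<mu>'' v'' w''"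
    and lines: "peirce a b c v" "peirce a b c w" "peirce b c a v'" "peirce b c a w'"
      "peirce c a b v''" "peirce c a b w''"
    and distinct: "\<mu> \<noteq> \<mu>'" "\<mu>' \<noteq> \<mu>''" "\<mu>'' \<noteq> \<mu>" and nonzero: "\<mu> \<noteq> 0" "\<mu>' \<noteq> 0" "\<mu>'' \<noteq> 0"
    and degree: "poly_curve 2 y" "poly_curve 2 y'" "poly_curve 2 y''"
    and curves: "peirce a b c (y t)" "peirce b c a (y' t)" "peirce c a b (y'' t)"
    and divisible: "divisible_along c a b \<mu> v w (reflection_curve \<alpha>' \<mu>' v' w' y')"
      "divisible_along a b c \<mu>' v' w' (reflection_curve \<alpha>'' \<mu>'' v'' w'' y'')"
      "divisible_along b c a \<mu>'' v'' w'' (reflection_curve \<alpha> \<mu> v w y)"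
      "divisible_along b c a \<mu> v w (reflection_curve \<alpha>'' \<mu>'' v'' w'' y'')"
      "divisible_along c a b \<mu>' v' w' (reflection_curve \<alpha> \<mu> v w y)"
      "divisible_along a b c \<mu>'' v'' w'' (reflection_curve \<alpha>' \<mu>' v' w' y')"
begin

definition Y :: "'a \<Rightarrow> 'a ^ 'n" where "Y = reflection_curve \<alpha> \<mu> v w y"
definition g :: "'a \<Rightarrow> 'a" where "g t = 1 + \<mu> * t^2"

end

sublocale reflection_triple \<subseteq> rot: reflection_triple cr T e b c a \<alpha>' \<alpha>'' \<alpha> \<mu>' \<mu>'' \<mu> v' v'' v w' w'' w y' y'' y
  by unfold_locales
    (fact infinite_field frame_rotate[OF frame_abc] pairs lines distinct nonzero degree curves divisible)+

context reflection_triple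
begin

lemma peirce_Y: "peirce a b c (Y t)"
  unfolding Y_def by (rule peirce_reflection_curve[OF lines(1,2) curves(1)])

end

text \<open>Facts reach their rotated copies under \<open>rot\<close> only when the context is closed and reopened.\<close>

context reflection_triple
begin

lemma quad_y: "quad (y t) = quad (y 0) * (rot.g t * rot.rot.g t)"
proof -
  obtain p where degree_p: "degree p \<le> 4" and p: "\<And>t. quad (y t) = poly p t"
    using poly_fun_quad[OF degree(1)] by (auto simp: poly_fun_def)
  have quad_Y_poly: "quad (Y t) = poly (pole_poly \<mu> * (pole_poly \<mu> * p)) t" for t
    unfolding Y_def quad_reflection_curve[OF pairs(1)] by (simp add: p poly_pole_poly power2_eq_square)
  have "divisible_along c b a \<mu>' v' w' Y"
    using divisible(5) by (auto simp: divisible_along_def Y_def intro: peirce_swap)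
  then have "pole_poly \<mu>' dvd pole_poly \<mu> * (pole_poly \<mu> * p)"
    using pole_poly_dvd_quad[OF infinite_field frame_swap[OF frame_abc] pairs(2) lines(3,4)[THEN peirce_swap]
        peirce_swap[OF peirce_Y] _ quad_Y_poly] by blast
  then have dvd': "pole_poly \<mu>' dvd p" using pole_poly_dvd_mult_cancel distinct(1) by metis
  have "pole_poly \<mu>'' dvd pole_poly \<mu> * (pole_poly \<mu> * p)"
    using pole_poly_dvd_quad[OF infinite_field rot.rot.frame_abc pairs(3) lines(5,6) peirce_Y _ quad_Y_poly]
      divisible(3) by (simp add: Y_def)
  then have dvd'': "pole_poly \<mu>'' dvd p" using pole_poly_dvd_mult_cancel distinct(3) by metis
  have "pole_poly \<mu>' * pole_poly \<mu>'' dvd p" by (rule pole_poly_mult_dvd[OF distinct(2) dvd' dvd''])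
  moreover have "degree (pole_poly \<mu>' * pole_poly \<mu>'') = 4"
    using nonzero by (simp add: degree_mult_eq pole_poly_nonzero degree_pole_poly)
  ultimately obtain k where "p = smult k (pole_poly \<mu>' * pole_poly \<mu>'')"
    using dvd_degree_le_imp_smult[of "pole_poly \<mu>' * pole_poly \<mu>''" p] degree_p pole_poly_nonzero by auto
  then have "quad (y t) = k * (rot.g t * rot.rot.g t)" for t
    by (simp add: p poly_pole_poly rot.g_def rot.rot.g_def)
  from this[of t] this[of 0] show ?thesis by (simp add: rot.g_def rot.rot.g_def)
qed

lemma quad_Y: "quad (Y t) = (g t)^2 * (rot.g t * rot.rot.g t) * quad (Y 0)"
  unfolding Y_def quad_reflection_curve[OF pairs(1)] g_def using quad_y[of t] by simp

lemma trilinear_Y: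
  "T (Y t) (rot.Y t \<bowtie> rot.rot.Y t)
    = (g t * rot.g t * rot.rot.g t)^2 * T (Y 0) (rot.Y 0 \<bowtie> rot.rot.Y 0)"
proof -
  let ?f = "pole_poly \<mu> * pole_poly \<mu> * (pole_poly \<mu>' * pole_poly \<mu>') * (pole_poly \<mu>'' * pole_poly \<mu>'')"
  have curves_Y: "poly_curve 4 Y" "poly_curve 4 rot.Y" "poly_curve 4 rot.rot.Y"
    unfolding Y_def rot.Y_def rot.rot.Y_def by (intro poly_curve_reflection_curve degree)+
  obtain p where degree_p: "degree p \<le> 12" and p: "\<And>t. T (Y t) (rot.Y t \<bowtie> rot.rot.Y t) = poly p t"
    using poly_fun_trace[OF curves_Y(1) poly_curve_cross[OF curves_Y(2,3)]] by (auto simp: poly_fun_def)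
  have cyclic: "T (rot.Y t) (rot.rot.Y t \<bowtie> Y t) = poly p t" "T (rot.rot.Y t) (Y t \<bowtie> rot.Y t) = poly p t" for t
    using p[of t] by (metis trace_cross_left_commute cross_commute)+
  note Ys = Y_def rot.Y_def rot.rot.Y_def
  have dvd: "pole_poly \<mu> * pole_poly \<mu> dvd p"
    by (rule pole_poly_square_dvd_trilinear[OF infinite_field frame_abc pairs(1) lines(1,2) degree(1) rot.peirce_Y
          rot.rot.peirce_Y divisible(1)[folded Ys] divisible(4)[folded Ys] p[unfolded Y_def]])
  have dvd': "pole_poly \<mu>' * pole_poly \<mu>' dvd p"
    by (rule pole_poly_square_dvd_trilinear[OF infinite_field rot.frame_abc pairs(2) lines(3,4) degree(2)
          rot.rot.peirce_Y peirce_Y divisible(2)[folded Ys] divisible(5)[folded Ys] cyclic(1)[unfolded rot.Y_def]])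
  have dvd'': "pole_poly \<mu>'' * pole_poly \<mu>'' dvd p"
    by (rule pole_poly_square_dvd_trilinear[OF infinite_field rot.rot.frame_abc pairs(3) lines(5,6) degree(3)
          peirce_Y rot.peirce_Y divisible(3)[folded Ys] divisible(6)[folded Ys] cyclic(2)[unfolded rot.rot.Y_def]])
  obtain r where r: "p = (pole_poly \<mu> * pole_poly \<mu>) * r" using dvd by (auto simp: dvd_def)
  have "pole_poly \<mu>' * pole_poly \<mu>' dvd r"
    using dvd' pole_poly_square_dvd_mult_cancel distinct(1) unfolding r by (metis mult.assoc)
  then obtain s where s: "r = (pole_poly \<mu>' * pole_poly \<mu>') * s" by (auto simp: dvd_def)
  have "pole_poly \<mu>'' * pole_poly \<mu>'' dvd s"
    using dvd'' pole_poly_square_dvd_mult_cancel distinct(2,3) unfolding r s by (metis mult.assoc)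
  then have "?f dvd p" unfolding r s by (auto simp: mult.assoc)
  moreover have "degree ?f = 12" using nonzero by (simp add: degree_mult_eq pole_poly_nonzero degree_pole_poly)
  ultimately obtain h where "p = smult h ?f"
    using dvd_degree_le_imp_smult[of ?f p] degree_p pole_poly_nonzero by auto
  then show ?thesis
    unfolding p by (simp add: poly_pole_poly g_def rot.g_def rot.rot.g_def power2_eq_square ac_simps)
qed

end

context reflection_triple
begin

theorem similarity_of_reflections:
  assumes nonzero: "g t \<noteq> 0" "rot.g t \<noteq> 0" "rot.rot.g t \<noteq> 0"
  shows "cnorm ((g t * k) *s a + (rot.g t * l) *s b + (rot.rot.g t * m) *s c
      + (inverse (g t) *s Y t + inverse (rot.g t) *s rot.Y t + inverse (rot.rot.g t) *s rot.rot.Y t))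
    = g t * rot.g t * rot.rot.g t * cnorm (k *s a + l *s b + m *s c + (Y 0 + rot.Y 0 + rot.rot.Y 0))"
proof -
  note parts = peirce_Y rot.peirce_Y rot.rot.peirce_Y
  have "quad (inverse (g t) *s Y t) = rot.g t * rot.rot.g t * quad (Y 0)"
    "quad (inverse (rot.g t) *s rot.Y t) = rot.rot.g t * g t * quad (rot.Y 0)"
    "quad (inverse (rot.rot.g t) *s rot.rot.Y t) = g t * rot.g t * quad (rot.rot.Y 0)"
    unfolding quad_scale quad_Y[of t] rot.quad_Y[of t] rot.rot.quad_Y[of t] using nonzero
    by (simp_all add: field_simps power2_eq_square)
  moreover have "T (inverse (g t) *s Y t) ((inverse (rot.g t) *s rot.Y t) \<bowtie> (inverse (rot.rot.g t) *s rot.rot.Y t))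
      = g t * rot.g t * rot.rot.g t * T (Y 0) (rot.Y 0 \<bowtie> rot.rot.Y 0)"
    unfolding cross_scale_left cross_scale_right trace_scale_left trace_scale_right trilinear_Y[of t] using nonzero
    by (simp add: field_simps power2_eq_square)
  ultimately show ?thesis
    unfolding cnorm_frame[OF frame_abc parts(1-3)[THEN peirce_scale]] cnorm_frame[OF frame_abc parts]
    by (simp add: algebra_simps)
qed

end

context cubic_jordan
begin

lemma cross_pencil_relation:
  assumes frame: "frame a b c" and pair: "orthogonal_pair \<alpha> \<mu> v w"
    and line: "peirce a b c v" "peirce a b c w" and AB: "peirce b c a A" "peirce b c a B"
    and relation: "v \<bowtie> B + w \<bowtie> A = 0"
  shows "w \<bowtie> B = \<mu> *s (v \<bowtie> A)"
proof (rule vec.scale_left_imp_eq)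
  show "\<alpha> \<noteq> 0" using pair by (simp add: orthogonal_pair_def)
  have cross_w_w_A: "w \<bowtie> (w \<bowtie> A) = (\<alpha> * \<mu>) *s A"
    using cross_cross_peirce[OF frame line(2) AB(1)] pair by (simp add: orthogonal_pair_def)
  have "w \<bowtie> (v \<bowtie> B) + w \<bowtie> (w \<bowtie> A) = 0" using relation by (metis cross_add_right cross_zero(2))
  moreover have "v \<bowtie> (w \<bowtie> B) + w \<bowtie> (v \<bowtie> B) = 0"
    using cross_cross_peirce_polarized[OF frame line AB(2)] pair by (simp add: orthogonal_pair_def)
  ultimately have cross_v_w_B: "v \<bowtie> (w \<bowtie> B) = (\<alpha> * \<mu>) *s A"
    using cross_w_w_A by (metis add.commute add_left_cancel)
  have "v \<bowtie> (v \<bowtie> (w \<bowtie> B)) = \<alpha> *s (w \<bowtie> B)"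
    using cross_cross_peirce[OF frame_flip[OF frame] line(1)[THEN peirce_swap]
        peirce_cross[OF frame line(2) AB(2), THEN peirce_swap]] pair
    by (simp add: orthogonal_pair_def)
  then show "\<alpha> *s (w \<bowtie> B) = \<alpha> *s (\<mu> *s (v \<bowtie> A))" unfolding cross_v_w_B by (simp add: bilinear_simps)
qed

lemma line_cross_quartic:
  fixes v w Y0 Y1 Y2 Y3 Y4 :: "'a ^ 'n" and \<mu> :: 'a
  defines "Z0 \<equiv> v \<bowtie> Y0" and "Z1 \<equiv> v \<bowtie> Y1 + w \<bowtie> Y0"
  defines "Z2 \<equiv> v \<bowtie> Y2 + w \<bowtie> Y1 - \<mu> *s Z0" and "Z3 \<equiv> v \<bowtie> Y3 + w \<bowtie> Y2 - \<mu> *s Z1"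
  assumes "v \<bowtie> Y4 + w \<bowtie> Y3 = \<mu> *s Z2" and "w \<bowtie> Y4 = \<mu> *s Z3"
  shows "(v + t *s w) \<bowtie> (Y0 + t *s Y1 + t^2 *s Y2 + t^3 *s Y3 + t^4 *s Y4)
    = (1 + \<mu> * t^2) *s (Z0 + t *s Z1 + t^2 *s Z2 + t^3 *s Z3)"
proof -
  have "(v + t *s w) \<bowtie> (Y0 + t *s Y1 + t^2 *s Y2 + t^3 *s Y3 + t^4 *s Y4)
    = v \<bowtie> Y0 + t *s (v \<bowtie> Y1 + w \<bowtie> Y0) + t^2 *s (v \<bowtie> Y2 + w \<bowtie> Y1) + t^3 *s (v \<bowtie> Y3 + w \<bowtie> Y2)
      + t^4 *s (v \<bowtie> Y4 + w \<bowtie> Y3) + t^5 *s (w \<bowtie> Y4)"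
    by (simp add: bilinear_simps vec_eq_iff algebra_simps eval_nat_numeral)
  also have "\<dots> = Z0 + t *s Z1 + t^2 *s (Z2 + \<mu> *s Z0) + t^3 *s (Z3 + \<mu> *s Z1)
      + t^4 *s (\<mu> *s Z2) + t^5 *s (\<mu> *s Z3)"
    unfolding assms(5,6) by (simp add: Z0_def Z1_def Z2_def Z3_def)
  also have "\<dots> = (1 + \<mu> * t^2) *s (Z0 + t *s Z1 + t^2 *s Z2 + t^3 *s Z3)"
    by (simp add: vec_eq_iff algebra_simps eval_nat_numeral)
  finally show ?thesis .
qed

lemma divisible_alongI:
  assumes frame: "frame a b c" and pair: "orthogonal_pair \<alpha> \<mu> v w" and nonzero: "\<mu> \<noteq> 0"
    and line: "peirce b c a v" "peirce b c a w"
    and Y: "peirce c a b Y0" "peirce c a b Y1" "peirce c a b Y2" "peirce c a b Y3" "peirce c a b Y4"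
    and odd: "\<mu>^2 *s (v \<bowtie> Y1 + w \<bowtie> Y0) - \<mu> *s (v \<bowtie> Y3 + w \<bowtie> Y2) + w \<bowtie> Y4 = 0"
  shows "divisible_along a b c \<mu> v w (\<lambda>t. Y0 + t *s Y1 + t^2 *s Y2 + t^3 *s Y3 + t^4 *s Y4)"
proof -
  define Z0 Z1 where "Z0 = v \<bowtie> Y0" and "Z1 = v \<bowtie> Y1 + w \<bowtie> Y0"
  define Z2 Z3 where "Z2 = v \<bowtie> Y2 + w \<bowtie> Y1 - \<mu> *s Z0" and "Z3 = v \<bowtie> Y3 + w \<bowtie> Y2 - \<mu> *s Z1"
  note Z_defs = Z0_def Z1_def Z2_def Z3_def
  let ?Z = "\<lambda>t. Z0 + t *s Z1 + t^2 *s Z2 + t^3 *s Z3"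
  let ?A = "\<mu>^2 *s Y0 - \<mu> *s Y2 + Y4" and ?B = "\<mu>^2 *s Y1 - \<mu> *s Y3"
  have "v \<bowtie> ?B + w \<bowtie> ?A = 0"
    using odd by (simp add: bilinear_simps vec_eq_iff algebra_simps)
  then have even: "w \<bowtie> ?B = \<mu> *s (v \<bowtie> ?A)"
    by (intro cross_pencil_relation[OF frame_rotate[OF frame] pair line]) (use Y in \<open>simp_all add: peirce_intros\<close>)
  have "v \<bowtie> Y4 + w \<bowtie> Y3 = \<mu> *s Z2"
  proof (rule vec.scale_left_imp_eq[OF nonzero])
    show "\<mu> *s (v \<bowtie> Y4 + w \<bowtie> Y3) = \<mu> *s (\<mu> *s Z2)"
      using even unfolding Z_defs by (simp add: bilinear_simps vec_eq_iff algebra_simps power2_eq_square)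
  qed
  moreover have "w \<bowtie> Y4 = \<mu> *s Z3"
    using odd unfolding Z_defs by (simp add: vec_eq_iff algebra_simps power2_eq_square)
  ultimately have "(v + t *s w) \<bowtie> (Y0 + t *s Y1 + t^2 *s Y2 + t^3 *s Y3 + t^4 *s Y4) = (1 + \<mu> * t^2) *s ?Z t" for t
    unfolding Z_defs by (rule line_cross_quartic)
  moreover have "peirce a b c (?Z t)" for t
    unfolding Z_defs using line Y by (intro peirce_intros peirce_cross[OF frame_rotate[OF frame]])
  moreover have "poly_curve 3 ?Z"
  proof -
    have monomial: "poly_curve 3 (\<lambda>t. t ^ k *s z)" if "k \<le> 3" for k and z :: "'a ^ 'n"
      using poly_curve_mono[OF poly_curve_power that] .
    from monomial[of 0 Z0] monomial[of 1 Z1] monomial[of 2 Z2] monomial[of 3 Z3]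
    show ?thesis by (simp add: poly_curve_add)
  qed
  ultimately show ?thesis unfolding divisible_along_def by blast
qed

lemma trace_self_sharp_self:
  "T x x = T x e ^ 2 - 2 * T (sharp x) e"
  "T (sharp x) (sharp x) = T (sharp x) e ^ 2 - 2 * (cnorm x * T x e)"
  using trace_cross_unit[of x x] trace_cross_unit[of "sharp x" "sharp x"]
  by (simp_all add: cross_self bilinear_simps sharp_sharp power2_eq_square algebra_simps)

definition characteristic_roots :: "'a ^ 'n \<Rightarrow> 'a \<Rightarrow> 'a \<Rightarrow> 'a \<Rightarrow> bool" where
  "characteristic_roots m p q r \<longleftrightarrow>
     T m e = p + q + r \<and> T (sharp m) e = p * q + q * r + r * p \<and> cnorm m = p * q * r"

lemma characteristic_roots_rotate: "characteristic_roots m p q r \<Longrightarrow> characteristic_roots m q r p"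
  by (simp add: characteristic_roots_def ac_simps)

text \<open>In \<open>K[m]\<close> this is \<open>(m - q) (m - r)\<close>, the numerator of the Lagrange interpolation idempotent at the root \<open>p\<close>.\<close>

definition root_elem :: "'a ^ 'n \<Rightarrow> 'a \<Rightarrow> 'a \<Rightarrow> 'a \<Rightarrow> 'a ^ 'n" where
  "root_elem m p q r = sharp m + p *s m - (p * (q + r)) *s e"

definition root_idempotent :: "'a ^ 'n \<Rightarrow> 'a \<Rightarrow> 'a \<Rightarrow> 'a \<Rightarrow> 'a ^ 'n" where
  "root_idempotent m p q r = inverse ((q - p) * (r - p)) *s root_elem m p q r"

lemma cross_root_elem:
  assumes "characteristic_roots m p q r"
  shows "root_elem m p q r \<bowtie> root_elem m p q r = 0"
    and "root_elem m p q r \<bowtie> root_elem m q r p = (- ((p - q)^2)) *s root_elem m r p q"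
  using assms unfolding root_elem_def characteristic_roots_def
  by (simp_all add: bilinear_simps trace_unit_unit cross_unit_left cross_unit_right cross_self[of m]
      cross_sharp_self[of m] cross_commute[of "sharp m" m] cross_self[of "sharp m"] sharp_sharp[of m]
      vec_eq_iff algebra_simps power2_eq_square)

lemma trace_root_elem:
  assumes "characteristic_roots m p q r"
  shows "T (root_elem m p q r) (root_elem m p q r) = ((q - p) * (r - p))^2"
    and "T (root_elem m p q r) (root_elem m q r p) = 0"
  using assms unfolding root_elem_def characteristic_roots_def
  by (simp_all add: bilinear_simps trace_commute[of e m] trace_commute[of e "sharp m"] trace_sharp_self
      trace_self_sharp_self[of m] trace_unit_unit algebra_simps power2_eq_square)

lemma cross_root_idempotent:
  assumes roots: "characteristic_roots m p q r" and distinct: "p \<noteq> q" "q \<noteq> r" "r \<noteq> p"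
  shows "root_idempotent m p q r \<bowtie> root_idempotent m q r p = root_idempotent m r p q"
proof -
  have "inverse ((r - q) * (p - q)) * (inverse ((q - p) * (r - p)) * (- ((p - q)^2)))
      = inverse ((p - r) * (q - r))"
    using distinct by (simp add: divide_simps power2_eq_square) (simp add: algebra_simps)
  then show ?thesis
    unfolding root_idempotent_def
    by (simp only: cross_scale_left cross_scale_right cross_root_elem(2)[OF roots] vector_smult_assoc mult.assoc)
qed

lemma root_idempotent_expansions:
  fixes m :: "'a ^ 'n" and p q r :: 'a
  assumes distinct: "p \<noteq> q" "q \<noteq> r" "r \<noteq> p"
  defines "a \<equiv> root_idempotent m p q r" and "b \<equiv> root_idempotent m q r p" and "c \<equiv> root_idempotent m r p q"
  shows "a + b + c = e"
    and "p *s a + q *s b + r *s c = m"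
    and "(q * r) *s a + (r * p) *s b + (p * q) *s c = sharp m"
proof -
  define vandermonde where "vandermonde = (q - r) * (r - p) * (p - q)"
  have nonzero: "vandermonde \<noteq> 0" using distinct by (simp add: vandermonde_def)
  have inverses: "inverse ((q - p) * (r - p)) = - (q - r) * inverse vandermonde"
    "inverse ((r - q) * (p - q)) = - (r - p) * inverse vandermonde"
    "inverse ((p - r) * (q - r)) = - (p - q) * inverse vandermonde"
    using distinct by (simp_all add: vandermonde_def divide_simps) (simp_all add: algebra_simps)
  have combination: "k *s a + l *s b + n *s c = inverse vandermonde *s
      ((- (k * (q - r))) *s root_elem m p q r + (- (l * (r - p))) *s root_elem m q r p
        + (- (n * (p - q))) *s root_elem m r p q)" for k l n
    unfolding a_def b_def c_def root_idempotent_def inverses by (simp add: vec_eq_iff algebra_simps)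
  have cancel: "inverse vandermonde *s x = y" if "x = vandermonde *s y" for x y :: "'a ^ 'n"
    using that nonzero by simp
  have "1 *s a + 1 *s b + 1 *s c = e"
    unfolding combination
    by (rule cancel) (simp add: root_elem_def vandermonde_def vec_eq_iff algebra_simps)
  then show "a + b + c = e" by simp
  show "p *s a + q *s b + r *s c = m"
    unfolding combination
    by (rule cancel) (simp add: root_elem_def vandermonde_def vec_eq_iff algebra_simps)
  show "(q * r) *s a + (r * p) *s b + (p * q) *s c = sharp m"
    unfolding combination
    by (rule cancel) (simp add: root_elem_def vandermonde_def vec_eq_iff algebra_simps)
qed

lemma frame_root_idempotents:
  assumes roots: "characteristic_roots m p q r" and distinct: "p \<noteq> q" "q \<noteq> r" "r \<noteq> p"
  shows "frame (root_idempotent m p q r) (root_idempotent m q r p) (root_idempotent m r p q)"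
proof -
  note roots' = characteristic_roots_rotate[OF roots]
  note roots'' = characteristic_roots_rotate[OF roots']
  have squares: "root_idempotent m p q r \<bowtie> root_idempotent m p q r = 0"
    "T (root_idempotent m p q r) (root_idempotent m p q r) = 1"
    "T (root_idempotent m p q r) (root_idempotent m q r p) = 0"
    if "characteristic_roots m p q r" "p \<noteq> q" "r \<noteq> p" for p q r
    using that by (simp_all add: root_idempotent_def bilinear_simps cross_root_elem trace_root_elem
      power2_eq_square divide_simps)
  show ?thesis
    unfolding frame_def
    using squares[OF roots] squares[OF roots'] squares[OF roots''] distinct
      cross_root_idempotent[OF roots] cross_root_idempotent[OF roots'] cross_root_idempotent[OF roots'']
      root_idempotent_expansions(1)[OF distinct]
    by auto
qed

end

lemma alg_closed_cubic_roots:
  fixes t1 t2 t3 :: "'b::alg_closed_field"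
  obtains p q r where "t1 = p + q + r" "t2 = p * q + q * r + r * p" "t3 = p * q * r"
proof -
  obtain p where p: "poly [:- t3, t2, - t1, 1:] p = 0"
    using alg_closed_imp_poly_has_root[of "[:- t3, t2, - t1, 1:]"] by auto
  obtain q where q: "poly [:t2 - p * (t1 - p), - (t1 - p), 1:] q = 0"
    using alg_closed_imp_poly_has_root[of "[:t2 - p * (t1 - p), - (t1 - p), 1:]"] by auto
  define r where "r = t1 - p - q"
  have t1: "t1 = p + q + r" by (simp add: r_def)
  have t2: "t2 = p * q + q * r + r * p" using q by (simp add: r_def algebra_simps)
  have "t3 = p * q * r" using p unfolding t1 t2 by (simp add: algebra_simps)
  then show thesis using that t1 t2 by blast
qed

lemma span_three:
  "vec.span {x, y, z :: 'a::field ^ 'n} = {\<alpha> *s x + \<beta> *s y + \<gamma> *s z | \<alpha> \<beta> \<gamma>. True}"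
proof
  show "vec.span {x, y, z} \<subseteq> {\<alpha> *s x + \<beta> *s y + \<gamma> *s z | \<alpha> \<beta> \<gamma>. True}"
    by (force simp: vec.span_insert algebra_simps)
  show "{\<alpha> *s x + \<beta> *s y + \<gamma> *s z | \<alpha> \<beta> \<gamma>. True} \<subseteq> vec.span {x, y, z}"
    by (clarify, intro vec.span_add vec.span_scale vec.span_base) auto
qed

lemma dim_span_three:
  fixes x y z :: "'a::field ^ 'n"
  assumes independent: "\<And>\<alpha> \<beta> \<gamma>. \<alpha> *s x + \<beta> *s y + \<gamma> *s z = 0 \<Longrightarrow> \<alpha> = 0 \<and> \<beta> = 0 \<and> \<gamma> = 0"
  shows "vec.dim (vec.span {x, y, z}) = 3"
proof -
  have distinct: "x \<noteq> y" "x \<noteq> z" "y \<noteq> z"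
    using independent[of 1 "-1" 0] independent[of 1 0 "-1"] independent[of 0 1 "-1"] by auto
  have "vec.independent {x, y, z}"
  proof (rule vec.independent_if_scalars_zero)
    fix f v assume "(\<Sum>v\<in>{x, y, z}. f v *s v) = 0" and v: "v \<in> {x, y, z}"
    then have "f x *s x + f y *s y + f z *s z = 0" using distinct by (simp add: add.assoc)
    then show "f v = 0" using independent v by blast
  qed simp
  then have "vec.dim (vec.span {x, y, z}) = card {x, y, z}" by (rule vec.dim_span_eq_card_independent)
  then show ?thesis using distinct by simp
qed

context cubic_jordan
begin

lemma cnorm_characteristic: "cnorm (c *s e - m) = c^3 - c^2 * T m e + c * T (sharp m) e - cnorm m"
  by (simp add: cnorm_diff cnorm_scale sharp_scale bilinear_simps trace_commute[of e m]
      trace_commute[of e "sharp m"])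

lemma orthogonal_decomposition:
  assumes W: "vec.subspace W" and nondegenerate: "\<And>w. w \<in> W \<Longrightarrow> w \<noteq> 0 \<Longrightarrow> \<exists>w'\<in>W. T w w' \<noteq> 0"
  shows "\<exists>w\<in>W. \<forall>w'\<in>W. T (x - w) w' = 0"
proof -
  obtain B where B: "B \<subseteq> W" "vec.independent B" "W \<subseteq> vec.span B"
    by (rule vec.basis_exists[of W])
  have finite: "finite B" using B(2) by (rule vec.finiteI_independent)
  define F where "F y = (\<Sum>b\<in>B. T y b *s b)" for y
  have linear: "Vector_Spaces.linear (*s) (*s) F"
    by unfold_locales (simp_all add: F_def bilinear_simps vec.scale_left_distrib sum.distrib vec.scale_sum_right)
  have kernel: "T y w = 0" if "F y = 0" "w \<in> W" for y w
  proof -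
    have "T y b = 0" if "b \<in> B" for b
      using vec.independentD[OF B(2) finite subset_refl, of "T y" b] \<open>F y = 0\<close> that by (simp add: F_def)
    then have "vec.span B \<subseteq> {w. T y w = 0}"
      by (intro vec.span_minimal) (auto simp: vec.subspace_def bilinear_simps)
    then show ?thesis using B(3) that(2) by blast
  qed
  have F_in_W: "F ` W \<subseteq> W" "F x \<in> W"
    unfolding F_def using B(1) by (auto intro!: vec.subspace_sum[OF W] vec.subspace_scale[OF W])
  have "inj_on F W"
  proof (rule inj_onI)
    fix y z assume yz: "y \<in> W" "z \<in> W" "F y = F z"
    then have "F (y - z) = 0" by (simp add: vec.linear_diff[OF linear])
    moreover have "y - z \<in> W" using W yz by (simp add: vec.subspace_diff)
    ultimately show "y = z" using nondegenerate kernel by fastforce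
  qed
  then have "vec.dim (F ` W) = vec.dim W"
    using vec.dim_image_eq[OF linear] W by (simp add: vec.span_eq_iff[THEN iffD2])
  moreover have subspace: "vec.subspace (F ` W)" using linear W vec.linear_subspace_image by blast
  ultimately have "F ` W = W" using vec.subspace_dim_equal[OF subspace W F_in_W(1)] by simp
  then obtain w where w: "w \<in> W" "F x = F w" using F_in_W(2) by blast
  then have "F (x - w) = 0" by (simp add: vec.linear_diff[OF linear])
  then show ?thesis using kernel w(1) by blast
qed

end

section \<open>Extension to the algebraic closure\<close>

definition embed :: "'a::field ^ 'n \<Rightarrow> 'a alg_closure ^ 'n" where
  "embed x = (\<chi> i. to_ac (x $ i))"

lemma embed_axis: "embed (axis i 1) = axis i 1"
  by (simp add: embed_def vec_eq_iff axis_def)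

lemma embed_linear: "embed (x + y) = embed x + embed y" "embed (c *s x) = to_ac c *s embed x"
  "embed (- x) = - embed x" "embed (x - y) = embed x - embed y" "embed 0 = 0"
  by (simp_all add: embed_def vec_eq_iff)

lemma embed_sum: "embed (\<Sum>i\<in>A. f i) = (\<Sum>i\<in>A. embed (f i))"
  by (simp add: embed_def vec_eq_iff to_ac_sum)

lemma embed_eq_iff: "embed x = embed y \<longleftrightarrow> x = y"
  by (simp add: embed_def vec_eq_iff)

lemma linear_eq_on_embed:
  assumes linear: "Vector_Spaces.linear (*s) smul F" "Vector_Spaces.linear (*s) smul G"
    and eq: "\<And>x. F (embed x) = G (embed x)"
  shows "F z = G z"
proof -
  have expand: "H z = (\<Sum>i\<in>UNIV. smul (z $ i) (H (embed (axis i 1))))"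
    if "Vector_Spaces.linear (*s) smul H" for H
  proof -
    interpret Vector_Spaces.linear "(*s)" smul H by (rule that)
    have "H z = H (\<Sum>i\<in>UNIV. z $ i *s axis i 1)" by (simp only: basis_expansion)
    then show ?thesis by (simp only: sum scale embed_axis)
  qed
  show ?thesis by (simp only: linear[THEN expand] eq)
qed

definition extend_map ::
  "('a::field ^ 'n \<Rightarrow> 'a ^ 'n \<Rightarrow> 'a ^ 'n) \<Rightarrow> 'a alg_closure ^ 'n \<Rightarrow> 'a alg_closure ^ 'n \<Rightarrow> 'a alg_closure ^ 'n" where
  "extend_map f x y = (\<Sum>i\<in>UNIV. \<Sum>j\<in>UNIV. (x $ i * y $ j) *s embed (f (axis i 1) (axis j 1)))"

definition extend_form ::
  "('a::field ^ 'n \<Rightarrow> 'a ^ 'n \<Rightarrow> 'a) \<Rightarrow> 'a alg_closure ^ 'n \<Rightarrow> 'a alg_closure ^ 'n \<Rightarrow> 'a alg_closure" where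
  "extend_form B x y = (\<Sum>i\<in>UNIV. \<Sum>j\<in>UNIV. (x $ i * y $ j) * to_ac (B (axis i 1) (axis j 1)))"

lemma extend_map_bilinear:
  "extend_map f (x + x') y = extend_map f x y + extend_map f x' y"
  "extend_map f x (y + y') = extend_map f x y + extend_map f x y'"
  "extend_map f (c *s x) y = c *s extend_map f x y"
  "extend_map f x (c *s y) = c *s extend_map f x y"
  by (simp_all add: extend_map_def vec.scale_left_distrib sum.distrib vec.scale_sum_right algebra_simps)

lemma extend_form_bilinear:
  "extend_form B (x + x') y = extend_form B x y + extend_form B x' y"
  "extend_form B x (y + y') = extend_form B x y + extend_form B x y'"
  "extend_form B (c *s x) y = c * extend_form B x y"
  "extend_form B x (c *s y) = c * extend_form B x y"
  by (simp_all add: extend_form_def sum.distrib sum_distrib_left algebra_simps)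

context cubic_jordan
begin

abbreviation cross_ac :: "'a alg_closure ^ 'n \<Rightarrow> 'a alg_closure ^ 'n \<Rightarrow> 'a alg_closure ^ 'n" (infixl "\<bowtie>\<^sub>a\<^sub>c" 75) where
  "cross_ac \<equiv> extend_map (\<bowtie>)"

abbreviation trace_ac :: "'a alg_closure ^ 'n \<Rightarrow> 'a alg_closure ^ 'n \<Rightarrow> 'a alg_closure" ("T\<^sub>a\<^sub>c") where
  "trace_ac \<equiv> extend_form T"

lemma extend_map_embed: "embed x \<bowtie>\<^sub>a\<^sub>c embed y = embed (x \<bowtie> y)"
proof -
  have "embed (x \<bowtie> y) = (\<Sum>i\<in>UNIV. \<Sum>j\<in>UNIV. to_ac (x $ i * y $ j) *s embed (axis i 1 \<bowtie> axis j 1))"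
    by (subst cross_axis_expansion) (simp only: embed_sum embed_linear)
  then show ?thesis by (simp add: extend_map_def embed_def[of x] embed_def[of y])
qed

lemma extend_form_embed: "T\<^sub>a\<^sub>c (embed x) (embed y) = to_ac (T x y)"
  by (subst trace_axis_expansion) (simp add: extend_form_def embed_def to_ac_sum)

lemma sharp_sharp_polarized_ac:
  "(w \<bowtie>\<^sub>a\<^sub>c x) \<bowtie>\<^sub>a\<^sub>c (y \<bowtie>\<^sub>a\<^sub>c z) + (w \<bowtie>\<^sub>a\<^sub>c y) \<bowtie>\<^sub>a\<^sub>c (x \<bowtie>\<^sub>a\<^sub>c z) + (w \<bowtie>\<^sub>a\<^sub>c z) \<bowtie>\<^sub>a\<^sub>c (x \<bowtie>\<^sub>a\<^sub>c y)
    = T\<^sub>a\<^sub>c (x \<bowtie>\<^sub>a\<^sub>c y) z *s w + T\<^sub>a\<^sub>c (w \<bowtie>\<^sub>a\<^sub>c y) z *s x + T\<^sub>a\<^sub>c (w \<bowtie>\<^sub>a\<^sub>c x) z *s y + T\<^sub>a\<^sub>c (w \<bowtie>\<^sub>a\<^sub>c x) y *s z"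
    (is "?P w x y z = ?Q w x y z")
proof -
  note multilinear = extend_map_bilinear extend_form_bilinear vec.scale_left_distrib vec.scale_right_distrib
    ac_simps
  have on_embed: "?P (embed w) (embed x) (embed y) (embed z) = ?Q (embed w) (embed x) (embed y) (embed z)"
    for w x y z
    by (simp add: extend_map_embed extend_form_embed embed_linear(1,2)[symmetric] sharp_sharp_polarized)
  have extend1: "?P w (embed x) (embed y) (embed z) = ?Q w (embed x) (embed y) (embed z)" for w x y z
    by (rule linear_eq_on_embed[where F = "\<lambda>w. ?P w (embed x) (embed y) (embed z)"
        and G = "\<lambda>w. ?Q w (embed x) (embed y) (embed z)"], unfold_locales)
      (rule on_embed | simp add: multilinear)+
  have extend2: "?P w x (embed y) (embed z) = ?Q w x (embed y) (embed z)" for w x y z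
    by (rule linear_eq_on_embed[where F = "\<lambda>x. ?P w x (embed y) (embed z)"
        and G = "\<lambda>x. ?Q w x (embed y) (embed z)"], unfold_locales)
      (rule extend1 | simp add: multilinear)+
  have extend3: "?P w x y (embed z) = ?Q w x y (embed z)" for w x y z
    by (rule linear_eq_on_embed[where F = "\<lambda>y. ?P w x y (embed z)"
        and G = "\<lambda>y. ?Q w x y (embed z)"], unfold_locales)
      (rule extend2 | simp add: multilinear)+
  show ?thesis
    by (rule linear_eq_on_embed[where F = "\<lambda>z. ?P w x y z" and G = "\<lambda>z. ?Q w x y z"], unfold_locales)
      (rule extend3 | simp add: multilinear)+
qed

lemma trace_cross_assoc_ac: "T\<^sub>a\<^sub>c (x \<bowtie>\<^sub>a\<^sub>c y) z = T\<^sub>a\<^sub>c x (y \<bowtie>\<^sub>a\<^sub>c z)"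
proof -
  note multilinear = extend_map_bilinear extend_form_bilinear algebra_simps
  have extend1: "T\<^sub>a\<^sub>c (x \<bowtie>\<^sub>a\<^sub>c embed y) (embed z) = T\<^sub>a\<^sub>c x (embed y \<bowtie>\<^sub>a\<^sub>c embed z)" for x y z
    by (rule linear_eq_on_embed[where F = "\<lambda>x. T\<^sub>a\<^sub>c (x \<bowtie>\<^sub>a\<^sub>c embed y) (embed z)"
        and G = "\<lambda>x. T\<^sub>a\<^sub>c x (embed y \<bowtie>\<^sub>a\<^sub>c embed z)"])
      (unfold_locales, simp_all add: extend_map_embed extend_form_embed trace_cross_assoc multilinear)
  have extend2: "T\<^sub>a\<^sub>c (x \<bowtie>\<^sub>a\<^sub>c y) (embed z) = T\<^sub>a\<^sub>c x (y \<bowtie>\<^sub>a\<^sub>c embed z)" for x y z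
    by (rule linear_eq_on_embed[where F = "\<lambda>y. T\<^sub>a\<^sub>c (x \<bowtie>\<^sub>a\<^sub>c y) (embed z)"
        and G = "\<lambda>y. T\<^sub>a\<^sub>c x (y \<bowtie>\<^sub>a\<^sub>c embed z)"])
      (unfold_locales, simp_all add: extend1 multilinear)
  show ?thesis
    by (rule linear_eq_on_embed[where F = "\<lambda>z. T\<^sub>a\<^sub>c (x \<bowtie>\<^sub>a\<^sub>c y) z"
        and G = "\<lambda>z. T\<^sub>a\<^sub>c x (y \<bowtie>\<^sub>a\<^sub>c z)"])
      (unfold_locales, simp_all add: extend2 multilinear)
qed

lemma cross_commute_ac: "x \<bowtie>\<^sub>a\<^sub>c y = y \<bowtie>\<^sub>a\<^sub>c x"
proof -
  have extend1: "x \<bowtie>\<^sub>a\<^sub>c embed y = embed y \<bowtie>\<^sub>a\<^sub>c x" for x y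
    by (rule linear_eq_on_embed[where F = "\<lambda>x. x \<bowtie>\<^sub>a\<^sub>c embed y"
        and G = "\<lambda>x. embed y \<bowtie>\<^sub>a\<^sub>c x"])
      (unfold_locales, simp_all add: extend_map_embed cross_commute[of y] extend_map_bilinear)
  show ?thesis
    by (rule linear_eq_on_embed[where F = "\<lambda>y. x \<bowtie>\<^sub>a\<^sub>c y"
        and G = "\<lambda>y. y \<bowtie>\<^sub>a\<^sub>c x"])
      (unfold_locales, simp_all add: extend1 extend_map_bilinear)
qed

lemma trace_commute_ac: "T\<^sub>a\<^sub>c x y = T\<^sub>a\<^sub>c y x"
proof -
  have extend1: "T\<^sub>a\<^sub>c x (embed y) = T\<^sub>a\<^sub>c (embed y) x" for x y
    by (rule linear_eq_on_embed[where F = "\<lambda>x. T\<^sub>a\<^sub>c x (embed y)"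
        and G = "\<lambda>x. T\<^sub>a\<^sub>c (embed y) x"])
      (unfold_locales, simp_all add: extend_form_embed trace_commute[of y] extend_form_bilinear algebra_simps)
  show ?thesis
    by (rule linear_eq_on_embed[where F = "\<lambda>y. T\<^sub>a\<^sub>c x y"
        and G = "\<lambda>y. T\<^sub>a\<^sub>c y x"])
      (unfold_locales, simp_all add: extend1 extend_form_bilinear algebra_simps)
qed

lemma cubic_jordan_alg_closure: "cubic_jordan (\<bowtie>\<^sub>a\<^sub>c) T\<^sub>a\<^sub>c (embed e)"
proof
  show "(2 :: 'a alg_closure) \<noteq> 0" "(3 :: 'a alg_closure) \<noteq> 0"
    using two_nonzero three_nonzero by (metis to_ac_numeral to_ac_eq_0_iff)+
  show "embed e \<bowtie>\<^sub>a\<^sub>c x = T\<^sub>a\<^sub>c x (embed e) *s embed e - x" for x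
    by (rule linear_eq_on_embed[where F = "\<lambda>x. embed e \<bowtie>\<^sub>a\<^sub>c x"
        and G = "\<lambda>x. T\<^sub>a\<^sub>c x (embed e) *s embed e - x"], unfold_locales)
      (simp_all add: extend_map_bilinear extend_form_bilinear extend_map_embed extend_form_embed
        cross_unit_left embed_linear vec_eq_iff algebra_simps)
  show "T\<^sub>a\<^sub>c (embed e) (embed e) = 3" by (simp add: extend_form_embed trace_unit_unit)
qed (fact extend_map_bilinear extend_form_bilinear cross_commute_ac trace_commute_ac
    sharp_sharp_polarized_ac trace_cross_assoc_ac)+

end

section \<open>Cubic subfields\<close>

locale division_cubic = cubic_jordan cr T e
  for cr :: "'a::field ^ 'n \<Rightarrow> 'a ^ 'n \<Rightarrow> 'a ^ 'n"  (infixl "\<bowtie>" 75)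
    and T :: "'a ^ 'n \<Rightarrow> 'a ^ 'n \<Rightarrow> 'a" and e :: "'a ^ 'n" +
  assumes infinite_field: "infinite (UNIV :: 'a set)" and anisotropic: "cnorm x = 0 \<Longrightarrow> x = 0"
begin

definition scalars :: "('a ^ 'n) set" where "scalars = range (\<lambda>c. c *s e)"

lemma scalarsI: "c *s e \<in> scalars" by (auto simp: scalars_def)

lemma characteristic_no_root: "m \<notin> scalars \<Longrightarrow> c^3 - c^2 * T m e + c * T (sharp m) e - cnorm m \<noteq> 0"
  using anisotropic[of "c *s e - m"] cnorm_characteristic[of c m] scalarsI[of c] by auto

lemma unit_independent:
  assumes m: "m \<notin> scalars" and z: "\<alpha> *s e + \<beta> *s m = 0" shows "\<alpha> = 0 \<and> \<beta> = 0"
proof -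
  have "\<beta> = 0"
  proof (rule ccontr)
    assume b: "\<beta> \<noteq> 0"
    have "\<beta> *s m = \<beta> *s ((- (inverse \<beta> * \<alpha>)) *s e)"
      using z b by (simp add: eq_neg_iff_add_eq_0 add.commute mult.assoc[symmetric])
    then have "m = (- (inverse \<beta> * \<alpha>)) *s e" by (rule vec.scale_left_imp_eq[OF b])
    then show False using m scalarsI by metis
  qed
  then show ?thesis using z unit_nonzero by simp
qed

lemma sharp_not_in_plane:
  assumes m: "m \<notin> scalars" shows "sharp m \<noteq> x *s e + y *s m"
proof
  assume sharp: "sharp m = x *s e + y *s m"
  have trace: "T (sharp m) e = 3 * x + y * T m e"
    unfolding sharp by (simp add: bilinear_simps trace_unit_unit)
  have "cnorm m *s m = sharp (x *s e + y *s m)" by (simp only: sharp_sharp[symmetric] sharp)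
  also have "\<dots> = x^2 *s e + (x * y) *s (T m e *s e - m) + y^2 *s sharp m"
    by (simp add: sharp_add sharp_scale bilinear_simps cross_unit_left vec_eq_iff algebra_simps)
  also have "\<dots> = (x^2 + x * y * T m e + y^2 * x) *s e + (y^3 - x * y) *s m"
    unfolding sharp by (simp add: vec_eq_iff algebra_simps power2_eq_square power3_eq_cube)
  finally have "(x^2 + x * y * T m e + y^2 * x) *s e + (y^3 - x * y - cnorm m) *s m = 0"
    by (simp add: vec_eq_iff algebra_simps)
  then have norm: "x^2 + x * y * T m e + y^2 * x = 0" "cnorm m = y^3 - x * y"
    using unit_independent[OF m] by (fastforce simp: algebra_simps)+
  have "x * (x + y * T m e + y^2) = 0" using norm(1) by (simp add: algebra_simps power2_eq_square)
  then consider "x = 0" | "x + y * T m e + y^2 = 0" by auto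
  then show False
  proof cases
    case 1
    then show False
      using characteristic_no_root[OF m, of y] unfolding trace norm(2)
      by (simp add: algebra_simps power2_eq_square power3_eq_cube)
  next
    case 2
    have "x = (x + y * T m e + y^2) - y * T m e - y^2" by simp
    then have x: "x = - y * T m e - y^2" unfolding 2 by simp
    show False
      using characteristic_no_root[OF m, of "- y"] unfolding trace norm(2) x
      by (simp add: algebra_simps power2_eq_square power3_eq_cube)
  qed
qed

lemma powers_independent:
  assumes m: "m \<notin> scalars" and zero: "\<alpha> *s e + \<beta> *s m + \<gamma> *s sharp m = 0"
  shows "\<alpha> = 0 \<and> \<beta> = 0 \<and> \<gamma> = 0"
proof -
  have "\<gamma> = 0"
  proof (rule ccontr)
    assume nonzero: "\<gamma> \<noteq> 0"
    have "sharp m = inverse \<gamma> *s (\<alpha> *s e + \<beta> *s m + \<gamma> *s sharp m)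
        + (- (inverse \<gamma> * \<alpha>)) *s e + (- (inverse \<gamma> * \<beta>)) *s m"
      using nonzero by (simp add: vec_eq_iff algebra_simps)
    then have "sharp m = (- (inverse \<gamma> * \<alpha>)) *s e + (- (inverse \<gamma> * \<beta>)) *s m"
      unfolding zero by simp
    then show False using sharp_not_in_plane[OF m] by blast
  qed
  then show ?thesis using zero unit_independent[OF m, of \<alpha> \<beta>] by simp
qed

definition adjoin :: "'a ^ 'n \<Rightarrow> ('a ^ 'n) set" where
  "adjoin m = vec.span {e, m, sharp m}"

lemma adjoin_altdef: "adjoin m = {\<alpha> *s e + \<beta> *s m + \<gamma> *s sharp m | \<alpha> \<beta> \<gamma>. True}"
  unfolding adjoin_def by (rule span_three)

lemma subspace_adjoin: "vec.subspace (adjoin m)"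
  unfolding adjoin_def by (rule vec.subspace_span)

lemma adjoin_subset: "vec.subspace W \<Longrightarrow> e \<in> W \<Longrightarrow> m \<in> W \<Longrightarrow> sharp m \<in> W \<Longrightarrow> adjoin m \<subseteq> W"
  unfolding adjoin_def by (intro vec.span_minimal) auto

lemma adjoin_unit: "e \<in> adjoin m" and adjoin_self: "m \<in> adjoin m" and adjoin_sharp_self: "sharp m \<in> adjoin m"
  by (simp_all add: adjoin_def vec.span_base)

lemmas adjoin_add = vec.subspace_add[OF subspace_adjoin]
lemmas adjoin_scale = vec.subspace_scale[OF subspace_adjoin]
lemmas adjoin_diff = vec.subspace_diff[OF subspace_adjoin]
lemmas adjoin_minus = vec.subspace_neg[OF subspace_adjoin]
lemmas adjoin_zero = vec.subspace_0[OF subspace_adjoin]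
lemmas adjoin_intros = adjoin_add adjoin_scale adjoin_diff adjoin_minus adjoin_zero adjoin_unit adjoin_self
  adjoin_sharp_self

lemma adjoin_cross: assumes "x \<in> adjoin m" "y \<in> adjoin m" shows "x \<bowtie> y \<in> adjoin m"
proof -
  from assms obtain a b c a' b' c' where "x = a *s e + b *s m + c *s sharp m"
    "y = a' *s e + b' *s m + c' *s sharp m"
    by (auto simp: adjoin_altdef)
  then show ?thesis
    by (simp only: cross_add_left cross_add_right cross_scale_left cross_scale_right cross_unit_left
        cross_unit_right cross_self[of m] cross_self[of "sharp m"]
        cross_sharp_self cross_commute[of "sharp m" m] sharp_sharp) (intro adjoin_intros)
qed

lemma adjoin_sharp: "x \<in> adjoin m \<Longrightarrow> sharp x \<in> adjoin m"
  unfolding sharp_def by (intro adjoin_intros adjoin_cross)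

lemma adjoin_jordan: "x \<in> adjoin m \<Longrightarrow> y \<in> adjoin m \<Longrightarrow> jordan x y \<in> adjoin m"
  unfolding jordan_def by (intro adjoin_intros adjoin_cross)

definition perp :: "'a ^ 'n \<Rightarrow> ('a ^ 'n) set" where
  "perp m = {x. T x e = 0 \<and> T x m = 0 \<and> T x (sharp m) = 0}"

lemma trace_perp_adjoin: "x \<in> perp m \<Longrightarrow> l \<in> adjoin m \<Longrightarrow> T x l = 0"
  by (auto simp: perp_def adjoin_altdef bilinear_simps)

lemma perpI: "(\<And>l. l \<in> adjoin m \<Longrightarrow> T x l = 0) \<Longrightarrow> x \<in> perp m"
  using adjoin_unit adjoin_self adjoin_sharp_self by (auto simp: perp_def)

lemma trace_perp_unit: "x \<in> perp m \<Longrightarrow> T x e = 0"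
  by (simp add: perp_def)

lemma subspace_perp: "vec.subspace (perp m)"
  by (auto simp: vec.subspace_def perp_def bilinear_simps)

lemmas perp_add = vec.subspace_add[OF subspace_perp]
lemmas perp_scale = vec.subspace_scale[OF subspace_perp]
lemmas perp_diff = vec.subspace_diff[OF subspace_perp]
lemmas perp_minus = vec.subspace_neg[OF subspace_perp]
lemmas perp_zero = vec.subspace_0[OF subspace_perp]
lemmas perp_intros = perp_add perp_scale perp_diff perp_minus perp_zero

lemma perp_closed_cross: "l \<in> adjoin m \<Longrightarrow> x \<in> perp m \<Longrightarrow> l \<bowtie> x \<in> perp m"
  by (rule perpI) (metis trace_cross_assoc cross_commute adjoin_cross trace_perp_adjoin)

lemma trace_sharp_nonzero: "x \<noteq> 0 \<Longrightarrow> T x (sharp x) \<noteq> 0"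
  using anisotropic three_nonzero by (auto simp: trace_sharp_self)

lemma adjoin_perp_decomposition: "\<exists>l\<in>adjoin m. x - l \<in> perp m"
  using orthogonal_decomposition[OF subspace_adjoin, of m x] trace_sharp_nonzero adjoin_sharp by (metis perpI)

lemma adjoin_perp_disjoint: "x \<in> adjoin m \<Longrightarrow> x \<in> perp m \<Longrightarrow> x = 0"
  using trace_sharp_nonzero adjoin_sharp trace_perp_adjoin by metis

definition proj :: "'a ^ 'n \<Rightarrow> 'a ^ 'n \<Rightarrow> 'a ^ 'n" where
  "proj m x = (SOME l. l \<in> adjoin m \<and> x - l \<in> perp m)"

abbreviation form :: "'a ^ 'n \<Rightarrow> 'a ^ 'n \<Rightarrow> 'a ^ 'n \<Rightarrow> 'a ^ 'n" where
  "form m x y \<equiv> proj m (x \<bowtie> y)"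

lemma proj_adjoin: "proj m x \<in> adjoin m" and proj_residual: "x - proj m x \<in> perp m"
  using someI_ex[of "\<lambda>l. l \<in> adjoin m \<and> x - l \<in> perp m"] adjoin_perp_decomposition[of m x]
  unfolding proj_def by blast+

lemma trace_proj: "l \<in> adjoin m \<Longrightarrow> T (proj m x) l = T x l"
  using trace_perp_adjoin[OF proj_residual, of l m x] by (simp add: bilinear_simps)

lemma proj_eqI: assumes "l \<in> adjoin m" "x - l \<in> perp m" shows "proj m x = l"
proof -
  have "l - proj m x \<in> adjoin m" using assms proj_adjoin by (intro adjoin_intros)
  moreover have "l - proj m x = (x - proj m x) - (x - l)" by simp
  then have "l - proj m x \<in> perp m" using assms proj_residual by (metis perp_diff)
  ultimately show ?thesis using adjoin_perp_disjoint by force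
qed

lemma proj_add: "proj m (x + y) = proj m x + proj m y"
proof (rule proj_eqI)
  show "proj m x + proj m y \<in> adjoin m" using proj_adjoin by (intro adjoin_intros)
  have "x + y - (proj m x + proj m y) = (x - proj m x) + (y - proj m y)" by simp
  then show "x + y - (proj m x + proj m y) \<in> perp m" using proj_residual by (metis perp_add)
qed

lemma proj_scale: "proj m (c *s x) = c *s proj m x"
proof (rule proj_eqI)
  show "c *s proj m x \<in> adjoin m" using proj_adjoin by (intro adjoin_intros)
  have "c *s x - c *s proj m x = c *s (x - proj m x)" by (simp add: vec.scale_right_diff_distrib)
  then show "c *s x - c *s proj m x \<in> perp m" using proj_residual by (metis perp_scale)
qed

lemma proj_of_adjoin: "l \<in> adjoin m \<Longrightarrow> proj m l = l"
  by (rule proj_eqI) (simp_all add: perp_zero)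

lemma proj_of_perp: "x \<in> perp m \<Longrightarrow> proj m x = 0"
  by (rule proj_eqI) (simp_all add: adjoin_zero)

lemma proj_minus: "proj m (- x) = - proj m x"
  using proj_scale[of m "-1" x] by simp

lemma proj_diff: "proj m (x - y) = proj m x - proj m y"
  using proj_add[of m x "- y"] by (simp add: proj_minus)

end

sublocale division_cubic \<subseteq> E: cubic_jordan "(\<bowtie>\<^sub>a\<^sub>c)" "T\<^sub>a\<^sub>c" "embed e"
  by (rule cubic_jordan_alg_closure)

context division_cubic
begin

lemma infinite_alg_closure: "infinite (UNIV :: 'a alg_closure set)"
  using infinite_field inj_to_ac finite_imageD[of to_ac UNIV] by (auto dest: finite_subset[OF subset_UNIV])

lemma embed_sharp: "embed (sharp x) = E.sharp (embed x)"
  by (simp add: sharp_def E.sharp_def embed_linear extend_map_embed)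

lemma cnorm_embed: "E.cnorm (embed x) = to_ac (cnorm x)"
  by (simp add: cnorm_def E.cnorm_def embed_sharp[symmetric] extend_form_embed)

definition coord :: "'a alg_closure ^ 'n \<Rightarrow> 'a ^ 'n \<Rightarrow> 'a alg_closure" where
  "coord a l = T\<^sub>a\<^sub>c (embed l) a"

definition part :: "'a alg_closure ^ 'n \<Rightarrow> 'a ^ 'n \<Rightarrow> 'a alg_closure ^ 'n" where
  "part a x = - (a \<bowtie>\<^sub>a\<^sub>c embed x)"

lemma coord_linear: "coord a (x + y) = coord a x + coord a y" "coord a (k *s x) = to_ac k * coord a x"
  "coord a (- x) = - coord a x" "coord a (x - y) = coord a x - coord a y" "coord a 0 = 0"
  by (simp_all add: coord_def embed_linear E.bilinear_simps)

lemma part_linear: "part a (x + y) = part a x + part a y" "part a (k *s x) = to_ac k *s part a x"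
  "part a (- x) = - part a x" "part a (x - y) = part a x - part a y" "part a 0 = 0"
  by (simp_all add: part_def embed_linear E.bilinear_simps)

definition cross_perp :: "'a ^ 'n \<Rightarrow> 'a ^ 'n \<Rightarrow> 'a ^ 'n \<Rightarrow> 'a ^ 'n" where
  "cross_perp m x y = x \<bowtie> y - form m x y"

lemma act_perp: "l \<in> adjoin m \<Longrightarrow> x \<in> perp m \<Longrightarrow> act l x \<in> perp m"
  unfolding act_def by (intro perp_minus perp_closed_cross)

lemma act_unit_perp: "x \<in> perp m \<Longrightarrow> act e x = x"
  by (simp add: act_unit perp_def)

lemma jinverse_adjoin: "l \<in> adjoin m \<Longrightarrow> jinverse l \<in> adjoin m"
  unfolding jinverse_def by (intro adjoin_scale adjoin_sharp)

lemma cross_perp_perp: "cross_perp m x y \<in> perp m"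
  unfolding cross_perp_def by (rule proj_residual)

lemma cross_perp_linear:
  "cross_perp m x (y + z) = cross_perp m x y + cross_perp m x z"
  "cross_perp m x (k *s y) = k *s cross_perp m x y"
  by (simp_all add: cross_perp_def bilinear_simps proj_add proj_scale vec.scale_right_diff_distrib)

end

locale cubic_field = division_cubic cr T e
  for cr :: "'a::field ^ 'n \<Rightarrow> 'a ^ 'n \<Rightarrow> 'a ^ 'n"  (infixl "\<bowtie>" 75)
    and T :: "'a ^ 'n \<Rightarrow> 'a ^ 'n \<Rightarrow> 'a" and e :: "'a ^ 'n" +
  fixes m :: "'a ^ 'n"
  assumes not_scalar: "m \<notin> scalars"

locale split_field = cubic_field cr T e m
  for cr :: "'a::field ^ 'n \<Rightarrow> 'a ^ 'n \<Rightarrow> 'a ^ 'n"  (infixl "\<bowtie>" 75)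
    and T :: "'a ^ 'n \<Rightarrow> 'a ^ 'n \<Rightarrow> 'a" and e m :: "'a ^ 'n" +
  fixes p q r :: "'a alg_closure"
  assumes roots: "E.characteristic_roots (embed m) p q r"
begin

definition a :: "'a alg_closure ^ 'n" where "a = E.root_idempotent (embed m) p q r"

end

sublocale split_field \<subseteq> rot: split_field cr T e m q r p
  by unfold_locales (rule E.characteristic_roots_rotate[OF roots])

lemma (in cubic_field) split_fieldE:
  obtains p q r where "split_field cr T e m p q r"
proof -
  obtain p q r where "E.characteristic_roots (embed m) p q r"
    unfolding E.characteristic_roots_def by (metis alg_closed_cubic_roots)
  then have "split_field cr T e m p q r" by unfold_locales
  then show thesis by (rule that)
qed

context split_field
begin

abbreviation b :: "'a alg_closure ^ 'n" where "b \<equiv> rot.a"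
abbreviation c :: "'a alg_closure ^ 'n" where "c \<equiv> rot.rot.a"

lemma to_ac_roots: "to_ac (T m e) = p + q + r" "to_ac (T (sharp m) e) = p * q + q * r + r * p"
  "to_ac (cnorm m) = p * q * r"
  using roots by (simp_all add: E.characteristic_roots_def embed_sharp[symmetric] cnorm_embed extend_form_embed)

lemma root_not_rational: "p \<noteq> to_ac k"
proof
  assume "p = to_ac k"
  then have "to_ac (k^3 - k^2 * T m e + k * T (sharp m) e - cnorm m)
      = p^3 - p^2 * (p + q + r) + p * (p * q + q * r + r * p) - p * q * r"
    by (simp add: to_ac_roots)
  also have "\<dots> = 0" by (simp add: algebra_simps power2_eq_square power3_eq_cube)
  finally have "k^3 - k^2 * T m e + k * T (sharp m) e - cnorm m = 0" by (rule to_ac_eq_0_iff[THEN iffD1])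
  then show False using characteristic_no_root[OF not_scalar] by blast
qed

lemma root_nonzero: "p \<noteq> 0"
  using root_not_rational[of 0] by simp

text \<open>A double root would be a rational function of the coefficients, since \<open>2\<close> and \<open>3\<close> are invertible.\<close>

lemma roots_distinct: "p \<noteq> q"
proof
  assume double: "p = q"
  let ?d = "T m e ^ 2 - 3 * T (sharp m) e"
  have discriminant: "to_ac ?d = (p - r)^2"
    by (simp add: to_ac_roots double algebra_simps power2_eq_square)
  show False
  proof (cases "p = r")
    case True
    then have "p * 3 = to_ac (T m e)" using to_ac_roots(1) double by simp
    then have "p = to_ac (T m e / 3)" using E.three_nonzero by (simp add: eq_divide_eq)
    then show False using root_not_rational by blast
  next
    case False
    have "to_ac (T (sharp m) e * T m e - 9 * cnorm m) = 2 * p * (p - r)^2"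
      by (simp add: to_ac_roots double algebra_simps power2_eq_square)
    then have "p * to_ac (2 * ?d) = to_ac (T (sharp m) e * T m e - 9 * cnorm m)"
      by (simp only: to_ac_mult[of 2] discriminant to_ac_numeral) (simp only: mult.left_commute mult.assoc)
    moreover have "to_ac (2 * ?d) \<noteq> 0"
      unfolding to_ac_mult[of 2] discriminant using False E.two_nonzero by simp
    ultimately have "p = to_ac ((T (sharp m) e * T m e - 9 * cnorm m) / (2 * ?d))"
      unfolding to_ac_divide by (simp only: eq_divide_eq if_True simp_thms if_False)
    then show False using root_not_rational by blast
  qed
qed

end

context split_field
begin

lemma frame_abc: "E.frame a b c"
  unfolding a_def rot.a_def rot.rot.a_def
  by (rule E.frame_root_idempotents[OF roots roots_distinct rot.roots_distinct rot.rot.roots_distinct])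

lemma embed_unit: "embed e = a + b + c"
  and embed_generator: "embed m = p *s a + q *s b + r *s c"
  and embed_sharp_generator: "embed (sharp m) = (q * r) *s a + (r * p) *s b + (p * q) *s c"
  using E.root_idempotent_expansions[OF roots_distinct rot.roots_distinct rot.rot.roots_distinct]
  by (simp_all add: a_def rot.a_def rot.rot.a_def embed_sharp)

lemma idempotent_in_span: "\<exists>k k' k''. a = k *s embed e + k' *s embed m + k'' *s embed (sharp m)"
  unfolding a_def E.root_idempotent_def E.root_elem_def embed_sharp
  by (rule exI[of _ "- (inverse ((q - p) * (r - p)) * (p * (q + r)))"], rule
      exI[of _ "inverse ((q - p) * (r - p)) * p"],
      rule exI[of _ "inverse ((q - p) * (r - p))"]) (simp add: vec_eq_iff algebra_simps)

lemma coord_unit: "coord a e = 1"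
  unfolding coord_def embed_unit by (simp add: E.bilinear_simps E.frameD[OF frame_abc])

lemma coord_generator: "coord a m = p"
  unfolding coord_def embed_generator by (simp add: E.bilinear_simps E.frameD[OF frame_abc])

lemma embed_adjoin:
  assumes "l \<in> adjoin m" shows "embed l = coord a l *s a + coord b l *s b + coord c l *s c"
proof -
  obtain x y z where l: "l = x *s e + y *s m + z *s sharp m" using assms by (auto simp: adjoin_altdef)
  have expansion: "embed l = (to_ac x + to_ac y * p + to_ac z * (q * r)) *s a
      + (to_ac x + to_ac y * q + to_ac z * (r * p)) *s b + (to_ac x + to_ac y * r + to_ac z * (p * q)) *s c"
    unfolding l embed_linear embed_unit embed_generator embed_sharp_generator
    by (simp add: vec_eq_iff algebra_simps)
  show ?thesis unfolding coord_def unfolding expansion by (simp add: E.bilinear_simps E.frameD[OF frame_abc])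
qed

lemma to_ac_cnorm: "l \<in> adjoin m \<Longrightarrow> to_ac (cnorm l) = coord a l * coord b l * coord c l"
  using E.sharp_cnorm_diagonal(2)[OF frame_abc, of "coord a l" "coord b l" "coord c l"] embed_adjoin[of l]
  by (simp add: cnorm_embed[symmetric])

lemma coord_eq_0_imp: "l \<in> adjoin m \<Longrightarrow> coord a l = 0 \<Longrightarrow> l = 0"
  using to_ac_cnorm[of l] anisotropic by simp

lemma coord_eqI: "l \<in> adjoin m \<Longrightarrow> k \<in> adjoin m \<Longrightarrow> coord a l = coord a k \<Longrightarrow> l = k"
  using coord_eq_0_imp[of "l - k"] adjoin_diff[of l m k] by (simp add: coord_linear)

lemma coord_cross:
  assumes "l \<in> adjoin m" "k \<in> adjoin m" shows "coord a (l \<bowtie> k) = coord b l * coord c k + coord c l * coord b k"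
proof -
  have "embed (l \<bowtie> k) = (coord b l * coord c k + coord c l * coord b k) *s a
     + (coord c l * coord a k + coord a l * coord c k) *s b + (coord a l * coord b k + coord b l * coord a k) *s c"
    unfolding extend_map_embed[symmetric] embed_adjoin[OF assms(1)] embed_adjoin[OF assms(2)]
    by (simp only: E.cross_add_left E.cross_add_right E.cross_scale_left E.cross_scale_right
        E.frameD[OF frame_abc])
      (simp add: vec_eq_iff algebra_simps)
  then show ?thesis unfolding coord_def by (simp add: E.bilinear_simps E.frameD[OF frame_abc])
qed

lemma coord_sharp: "l \<in> adjoin m \<Longrightarrow> coord a (sharp l) = coord b l * coord c l"
  unfolding sharp_def using E.two_nonzero by (simp add: coord_linear coord_cross)

lemma to_ac_trace_unit: "l \<in> adjoin m \<Longrightarrow> to_ac (T l e) = coord a l + coord b l + coord c l"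
  by (simp only: extend_form_embed[symmetric] embed_unit) (simp add: E.bilinear_simps coord_def)

lemma trace_embed_perp:
  assumes "x \<in> perp m" shows "T\<^sub>a\<^sub>c (embed x) a = 0"
proof -
  obtain k k' k'' where a: "a = k *s embed e + k' *s embed m + k'' *s embed (sharp m)"
    using idempotent_in_span by blast
  show ?thesis using assms by (subst a) (simp add: E.bilinear_simps extend_form_embed perp_def)
qed

end

context split_field
begin

lemma coord_jordan:
  assumes l: "l \<in> adjoin m" and k: "k \<in> adjoin m" shows "coord a (jordan l k) = coord a l * coord a k"
proof (rule mult_left_cancel[THEN iffD1, OF E.two_nonzero])
  have "to_ac (T (l \<bowtie> k) e) = (coord b l * coord c k + coord c l * coord b k)
      + (coord c l * coord a k + coord a l * coord c k) + (coord a l * coord b k + coord b l * coord a k)"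
    using to_ac_trace_unit[OF adjoin_cross[OF l k]]
    unfolding coord_cross[OF l k] rot.coord_cross[OF l k] rot.rot.coord_cross[OF l k] .
  then show "2 * coord a (jordan l k) = 2 * (coord a l * coord a k)"
    unfolding jordan_def using E.two_nonzero
    by (simp add: coord_linear coord_cross[OF l k] coord_unit to_ac_trace_unit l k algebra_simps)
qed

lemma coord_jinverse: assumes l: "l \<in> adjoin m" "l \<noteq> 0" shows "coord a (jinverse l) = inverse (coord a l)"
proof -
  have "coord a l \<noteq> 0" "coord b l \<noteq> 0" "coord c l \<noteq> 0"
    using coord_eq_0_imp rot.coord_eq_0_imp rot.rot.coord_eq_0_imp l by blast+
  then show ?thesis
    unfolding jinverse_def coord_linear to_ac_inverse to_ac_cnorm[OF l(1)] coord_sharp[OF l(1)]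
    by (simp add: field_simps)
qed

lemma frame_orthogonal_embed: "x \<in> perp m \<Longrightarrow> E.frame_orthogonal a b c (embed x)"
  by (simp add: E.frame_orthogonal_def trace_embed_perp rot.trace_embed_perp rot.rot.trace_embed_perp)

lemma peirce_part: "x \<in> perp m \<Longrightarrow> E.peirce a b c (part a x)"
  unfolding part_def by (rule E.peirce_cross_idempotent[OF frame_abc frame_orthogonal_embed])

lemma embed_perp: "x \<in> perp m \<Longrightarrow> embed x = part a x + part b x + part c x"
  unfolding part_def using E.peirce_decomposition[OF frame_abc frame_orthogonal_embed] by simp

lemma part_eqI:
  "x \<in> perp m \<Longrightarrow> y \<in> perp m \<Longrightarrow> part a x = part a y \<Longrightarrow> part b x = part b y \<Longrightarrow> part c x = part c y \<Longrightarrow> x = y"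
  using embed_perp embed_eq_iff by metis

lemma peirce_sum_part:
  assumes "E.peirce a b c x" "E.peirce b c a y" "E.peirce c a b z"
  shows "- (a \<bowtie>\<^sub>a\<^sub>c (x + y + z)) = x"
  using assms by (simp add: E.peirce_def E.bilinear_simps)

end

context split_field
begin

lemmas peirce_parts = peirce_part rot.peirce_part rot.rot.peirce_part

lemma part_act:
  assumes l: "l \<in> adjoin m" and x: "x \<in> perp m" shows "part a (act l x) = coord a l *s part a x"
proof -
  have "embed (act l x) = coord a l *s part a x + coord b l *s part b x + coord c l *s part c x"
    unfolding act_def embed_linear extend_map_embed[symmetric] embed_adjoin[OF l] embed_perp[OF x]
    using peirce_parts[OF x] by (simp add: E.bilinear_simps E.peirce_def)
  then show ?thesis
    unfolding part_def[of a "act l x"] using peirce_sum_part peirce_parts[OF x] E.peirce_scale by metis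
qed

lemma embed_cross_perp:
  assumes x: "x \<in> perp m" and y: "y \<in> perp m"
  shows "embed (x \<bowtie> y)
     = - (T\<^sub>a\<^sub>c (part a x) (part a y) *s a) - T\<^sub>a\<^sub>c (part b x) (part b y) *s b - T\<^sub>a\<^sub>c (part c x) (part c y) *s c
     + (part b x \<bowtie>\<^sub>a\<^sub>c part c y + part c x \<bowtie>\<^sub>a\<^sub>c part b y)
     + (part c x \<bowtie>\<^sub>a\<^sub>c part a y + part a x \<bowtie>\<^sub>a\<^sub>c part c y)
     + (part a x \<bowtie>\<^sub>a\<^sub>c part b y + part b x \<bowtie>\<^sub>a\<^sub>c part a y)"
  unfolding extend_map_embed[symmetric] embed_perp[OF x] embed_perp[OF y]
  by (simp add: E.cross_add_left E.cross_add_right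
      E.cross_same_peirce[OF frame_abc peirce_parts(1)[OF x] peirce_parts(1)[OF y]]
      E.cross_same_peirce[OF rot.frame_abc peirce_parts(2)[OF x] peirce_parts(2)[OF y]]
      E.cross_same_peirce[OF rot.rot.frame_abc peirce_parts(3)[OF x] peirce_parts(3)[OF y]])

lemma peirce_part_cross:
  assumes x: "x \<in> perp m" and y: "y \<in> perp m"
  shows "E.peirce a b c (part b x \<bowtie>\<^sub>a\<^sub>c part c y + part c x \<bowtie>\<^sub>a\<^sub>c part b y)"
  using E.peirce_cross[OF rot.frame_abc peirce_parts(2)[OF x] peirce_parts(3)[OF y]]
   E.peirce_cross[OF rot.frame_abc peirce_parts(2)[OF y] peirce_parts(3)[OF x]]
  by (simp add: E.cross_commute[of "part c x"] E.peirce_add)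

end

context split_field
begin

lemma coord_form:
  assumes x: "x \<in> perp m" and y: "y \<in> perp m"
  shows "coord a (form m x y) = - T\<^sub>a\<^sub>c (part a x) (part a y)"
proof -
  have "coord a (x \<bowtie> y - form m x y) = 0" unfolding coord_def using trace_embed_perp proj_residual by blast
  then have "coord a (form m x y) = T\<^sub>a\<^sub>c (embed (x \<bowtie> y)) a" by (simp add: coord_linear coord_def[symmetric])
  also have "\<dots> = - T\<^sub>a\<^sub>c (part a x) (part a y)"
    unfolding embed_cross_perp[OF x y]
    using peirce_part_cross[OF x y] rot.peirce_part_cross[OF x y] rot.rot.peirce_part_cross[OF x y]
    by (simp only: E.trace_add_left E.trace_diff_left E.peirce_def) (simp add: E.bilinear_simps
        E.frameD[OF frame_abc])
  finally show ?thesis .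
qed

end

context split_field
begin

lemma part_cross_perp:
  assumes x: "x \<in> perp m" and y: "y \<in> perp m"
  shows "part a (cross_perp m x y) = part b x \<bowtie>\<^sub>a\<^sub>c part c y + part c x \<bowtie>\<^sub>a\<^sub>c part b y"
proof -
  have "embed (form m x y)
      = - (T\<^sub>a\<^sub>c (part a x) (part a y) *s a) - T\<^sub>a\<^sub>c (part b x) (part b y) *s b - T\<^sub>a\<^sub>c (part c x) (part c y) *s c"
    using embed_adjoin[OF proj_adjoin, of "x \<bowtie> y"]
    unfolding coord_form[OF x y] rot.coord_form[OF x y] rot.rot.coord_form[OF x y] by simp
  then have "embed (cross_perp m x y) = (part b x \<bowtie>\<^sub>a\<^sub>c part c y + part c x \<bowtie>\<^sub>a\<^sub>c part b y)
     + (part c x \<bowtie>\<^sub>a\<^sub>c part a y + part a x \<bowtie>\<^sub>a\<^sub>c part c y)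
     + (part a x \<bowtie>\<^sub>a\<^sub>c part b y + part b x \<bowtie>\<^sub>a\<^sub>c part a y)"
    unfolding cross_perp_def embed_linear embed_cross_perp[OF x y] by simp
  then show ?thesis
    unfolding part_def[of a "cross_perp m x y"]
    using peirce_sum_part[OF peirce_part_cross[OF x y] rot.peirce_part_cross[OF x y] rot.rot.peirce_part_cross[OF x y]]
    by simp
qed

end

context division_cubic
begin

lemma adjoin_U_op: "x \<in> adjoin m \<Longrightarrow> y \<in> adjoin m \<Longrightarrow> U_op x y \<in> adjoin m"
  unfolding U_op_def by (intro adjoin_intros adjoin_cross adjoin_sharp)

lemma perp_eq: assumes "adjoin m' = adjoin m" shows "perp m' = perp m"
  using assms trace_perp_adjoin perpI by (metis subsetI subset_antisym)

lemma perp_if_linearized_characteristic_zero: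
  assumes "m \<notin> scalars"
    and "2 *s jordan (jordan m m) x + U_op m x - T m e *s (2 *s jordan m x) + T (sharp m) e *s x = 0"
  shows "x \<in> perp m"
proof -
  have "(T (sharp m) x - T (sharp m) e * T x e) *s e + T m x *s m + T x e *s sharp m = 0"
    using assms(2) unfolding linearized_characteristic by (simp add: algebra_simps)
  from powers_independent[OF assms(1) this] show ?thesis by (simp add: perp_def trace_commute[of x])
qed

end

context cubic_field
begin

lemma dim_adjoin: "vec.dim (adjoin m) = 3"
  unfolding adjoin_def by (rule dim_span_three[OF powers_independent[OF not_scalar]])

lemma adjoin_eq: assumes "m' \<in> adjoin m" "m' \<notin> scalars" shows "adjoin m' = adjoin m"
proof -
  interpret m': cubic_field cr T e m' by unfold_locales (rule assms(2))
  have "adjoin m' \<subseteq> adjoin m"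
    using assms(1) by (intro adjoin_subset subspace_adjoin adjoin_unit adjoin_sharp)
  then show ?thesis
    using vec.subspace_dim_equal[OF subspace_adjoin subspace_adjoin] dim_adjoin m'.dim_adjoin by simp
qed

lemma act_act:
  assumes "l \<in> adjoin m" "k \<in> adjoin m" "x \<in> perp m" shows "act l (act k x) = act (jordan l k) x"
proof -
  obtain p q r where "split_field cr T e m p q r" by (rule split_fieldE)
  then interpret split_field cr T e m p q r .
  show ?thesis
    by (rule part_eqI)
      (simp_all add: assms act_perp adjoin_jordan part_act rot.part_act rot.rot.part_act
        coord_jordan rot.coord_jordan rot.rot.coord_jordan)
qed

lemma jordan_assoc:
  assumes "k \<in> adjoin m" "l \<in> adjoin m" "l' \<in> adjoin m"
  shows "jordan (jordan k l) l' = jordan k (jordan l l')"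
proof -
  obtain p q r where "split_field cr T e m p q r" by (rule split_fieldE)
  then interpret split_field cr T e m p q r .
  show ?thesis by (rule coord_eqI) (simp_all add: assms adjoin_jordan coord_jordan)
qed

lemma jordan_jinverse:
  assumes l: "l \<in> adjoin m" "l \<noteq> 0" shows "jordan (jinverse l) l = e"
proof -
  obtain p q r where "split_field cr T e m p q r" by (rule split_fieldE)
  then interpret split_field cr T e m p q r .
  have "coord a l \<noteq> 0" using coord_eq_0_imp l by blast
  then show ?thesis
    by (intro coord_eqI) (simp_all add: adjoin_jordan l coord_jordan jinverse_adjoin adjoin_unit coord_jinverse
        coord_unit)
qed

lemma cnorm_jordan:
  assumes "k \<in> adjoin m" "l \<in> adjoin m" shows "cnorm (jordan k l) = cnorm k * cnorm l"
proof -
  obtain p q r where "split_field cr T e m p q r" by (rule split_fieldE)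
  then interpret split_field cr T e m p q r .
  have "to_ac (cnorm (jordan k l)) = to_ac (cnorm k * cnorm l)"
    by (simp only: to_ac_mult to_ac_cnorm assms adjoin_jordan coord_jordan rot.coord_jordan rot.rot.coord_jordan)
      (simp add: ac_simps)
  then show ?thesis by (simp only: to_ac_eq_iff)
qed

lemma form_act_right:
  assumes "l \<in> adjoin m" "x \<in> perp m" "y \<in> perp m"
  shows "form m x (act l y) = jordan l (form m x y)"
proof -
  obtain p q r where "split_field cr T e m p q r" by (rule split_fieldE)
  then interpret split_field cr T e m p q r .
  show ?thesis
    by (rule coord_eqI)
      (simp_all add: assms proj_adjoin adjoin_jordan coord_jordan coord_form act_perp part_act E.bilinear_simps)
qed

lemma form_act_left:
  assumes "l \<in> adjoin m" "x \<in> perp m" "y \<in> perp m"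
  shows "form m (act l x) y = jordan l (form m x y)"
  using form_act_right[OF assms(1,3,2)] by (simp add: cross_commute[of y])

lemma jinverse_nonzero: "l \<noteq> 0 \<Longrightarrow> jinverse l \<noteq> 0"
proof
  assume "l \<noteq> 0" "jinverse l = 0"
  then have "cnorm l \<noteq> 0" "sharp l = 0" using anisotropic unfolding jinverse_def by auto
  then show False using sharp_sharp[of l] \<open>l \<noteq> 0\<close> by simp
qed

lemma jordan_jinverse_left:
  assumes "l \<in> adjoin m" "l \<noteq> 0" "k \<in> adjoin m" shows "jordan (jinverse l) (jordan l k) = k"
  using jordan_assoc[OF jinverse_adjoin[OF assms(1)] assms(1,3)] jordan_jinverse[OF assms(1,2)]
  by (simp add: jordan_unit)

lemma jordan_jinverse_right:
  assumes "l \<in> adjoin m" "l \<noteq> 0" "k \<in> adjoin m" shows "jordan l (jordan (jinverse l) k) = k"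
  using jordan_assoc[OF assms(1) jinverse_adjoin[OF assms(1)] assms(3)] jordan_jinverse[OF assms(1,2)]
  by (simp add: jordan_commute[of l "jinverse l"] jordan_unit)

lemma jordan_left_commute:
  assumes "k \<in> adjoin m" "l \<in> adjoin m" "j \<in> adjoin m" shows "jordan k (jordan l j) = jordan l (jordan k j)"
  using jordan_assoc[OF assms] jordan_assoc[OF assms(2,1,3)] by (simp add: jordan_commute[of k l])

lemmas adjoin_jordan_ac = jordan_assoc jordan_commute jordan_left_commute

lemma jordan_nonzero:
  assumes "k \<in> adjoin m" "k \<noteq> 0" "l \<in> adjoin m" "l \<noteq> 0" shows "jordan k l \<noteq> 0"
  using jordan_jinverse_left[OF assms(1-3)] assms(4) jordan_zero(1) by metis

lemma U_op_adjoin: "k \<in> adjoin m \<Longrightarrow> l \<in> adjoin m \<Longrightarrow> U_op k l = jordan k (jordan k l)"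
  by (simp add: U_op_jordan jordan_assoc[of k k l] vec_eq_iff)

lemma jinverse_not_scalar: "jinverse m \<notin> scalars"
proof
  assume "jinverse m \<in> scalars"
  then obtain k where "jinverse m = k *s e" by (auto simp: scalars_def)
  moreover have "m \<noteq> 0" using not_scalar scalarsI[of 0] by auto
  ultimately have "k *s m = e"
    using jordan_jinverse[OF adjoin_self] by (simp add: jordan_linear_left jordan_unit)
  then have "m = inverse k *s e" using unit_nonzero by (cases "k = 0") auto
  then show False using not_scalar scalarsI by metis
qed

lemma scaled_square_not_scalar: "k \<noteq> 0 \<Longrightarrow> k *s jordan m m \<notin> scalars"
proof
  assume "k \<noteq> 0" "k *s jordan m m \<in> scalars"
  moreover from this(2) obtain j where "k *s jordan m m = j *s e" by (auto simp: scalars_def)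
  then have "(- k * T (sharp m) e - j) *s e + (k * T m e) *s m + k *s sharp m = 0"
    unfolding jordan_self by (simp add: vec_eq_iff algebra_simps)
  ultimately show False using powers_independent[OF not_scalar] by fastforce
qed

lemma adjoin_scaled_square: "k \<noteq> 0 \<Longrightarrow> adjoin (k *s jordan m m) = adjoin m"
  by (intro adjoin_eq scaled_square_not_scalar adjoin_scale adjoin_jordan adjoin_self)

end

section \<open>Rational curves of similarities\<close>

lemma inj_imp_surj_pair:
  fixes F G :: "'a::field ^ 'n \<Rightarrow> 'a ^ 'n \<Rightarrow> 'a ^ 'n"
  assumes add: "\<And>x x' y y'. F (x + x') (y + y') = F x y + F x' y'"
    "\<And>x x' y y'. G (x + x') (y + y') = G x y + G x' y'"
    and scale: "\<And>c x y. F (c *s x) (c *s y) = c *s F x y" "\<And>c x y. G (c *s x) (c *s y) = c *s G x y"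
    and kernel: "\<And>x y. F x y = 0 \<Longrightarrow> G x y = 0 \<Longrightarrow> x = 0 \<and> y = 0"
  shows "\<exists>x y. F x y = u \<and> G x y = w"
proof -
  define left right :: "'a ^ ('n + 'n) \<Rightarrow> 'a ^ 'n"
    where "left z = (\<chi> i. z $ Inl i)" and "right z = (\<chi> i. z $ Inr i)" for z
  define join :: "'a ^ 'n \<Rightarrow> 'a ^ 'n \<Rightarrow> 'a ^ ('n + 'n)"
    where "join x y = (\<chi> i. case i of Inl k \<Rightarrow> x $ k | Inr k \<Rightarrow> y $ k)" for x y
  have components: "left (join x y) = x" "right (join x y) = y" "join (left z) (right z) = z" for x y z
    by (simp_all add: left_def right_def join_def vec_eq_iff split: sum.split)
  have linear_components: "left (z + z') = left z + left z'" "right (z + z') = right z + right z'"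
    "left (c *s z) = c *s left z" "right (c *s z) = c *s right z" for z z' c
    by (simp_all add: left_def right_def vec_eq_iff)
  have linear_join: "join (x + x') (y + y') = join x y + join x' y'" "join (c *s x) (c *s y) = c *s join x y"
    for x x' y y' c
    by (simp_all add: join_def vec_eq_iff split: sum.split)
  define H where "H z = join (F (left z) (right z)) (G (left z) (right z))" for z
  have linear: "Vector_Spaces.linear (*s) (*s) H"
    by unfold_locales (simp_all add: H_def linear_components add scale linear_join)
  have "z = 0" if "H z = 0" for z
  proof -
    have "join 0 0 = (0 :: 'a ^ ('n + 'n))" by (simp add: join_def vec_eq_iff split: sum.split)
    then have "F (left z) (right z) = 0" "G (left z) (right z) = 0" using that components unfolding H_def by metis+
    then have "left z = 0" "right z = 0" using kernel by blast+
    then show ?thesis using components(3)[of z] \<open>join 0 0 = 0\<close> by simp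
  qed
  then have "inj H" using vec.linear_inj_iff_eq_0[OF linear] by blast
  then have "surj H" by (rule vec.linear_inj_imp_surj[OF linear])
  then obtain z where "H z = join u w" by (metis surjD)
  then have "F (left z) (right z) = u" "G (left z) (right z) = w" using components unfolding H_def by metis+
  then show ?thesis by blast
qed

locale reflection_data = split_field cr T e m p q r
  for cr :: "'a::field ^ 'n \<Rightarrow> 'a ^ 'n \<Rightarrow> 'a ^ 'n"  (infixl "\<bowtie>" 75)
    and T :: "'a ^ 'n \<Rightarrow> 'a ^ 'n \<Rightarrow> 'a" and e m :: "'a ^ 'n" and p q r :: "'a alg_closure" +
  fixes v w :: "'a ^ 'n"
  assumes v: "v \<in> perp m" and w: "w \<in> perp m" and orthogonal: "form m v w = 0"
    and ratio: "jordan m (form m v v) = form m w w" and form_nonzero: "form m v v \<noteq> 0"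
begin

definition form_inverse :: "'a ^ 'n" where
  "form_inverse = jinverse ((- inverse 2) *s form m v v)"

definition form_triple :: "'a ^ 'n \<Rightarrow> 'a ^ 'n \<Rightarrow> 'a ^ 'n \<Rightarrow> 'a ^ 'n" where
  "form_triple x y z = act form_inverse (act (- form m x y) z)"

text \<open>The coefficients of \<open>(1 + m t\<^sup>2) y\<^sub>t - q(v)\<^sup>-\<^sup>1 \<langle>v + t w, y\<^sub>t\<rangle> (v + t w)\<close> for \<open>y\<^sub>t = y0 + t y1 + t\<^sup>2 y2\<close>.\<close>

definition refl0 :: "'a ^ 'n \<Rightarrow> 'a ^ 'n" where
  "refl0 y0 = y0 - form_triple v y0 v"

definition refl1 :: "'a ^ 'n \<Rightarrow> 'a ^ 'n \<Rightarrow> 'a ^ 'n" where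
  "refl1 y0 y1 = y1 - form_triple v y1 v - form_triple w y0 v - form_triple v y0 w"

definition refl2 :: "'a ^ 'n \<Rightarrow> 'a ^ 'n \<Rightarrow> 'a ^ 'n \<Rightarrow> 'a ^ 'n" where
  "refl2 y0 y1 y2
   = y2 + act m y0 - form_triple v y2 v - form_triple w y1 v - form_triple v y1 w - form_triple w y0 w"

definition refl3 :: "'a ^ 'n \<Rightarrow> 'a ^ 'n \<Rightarrow> 'a ^ 'n" where
  "refl3 y1 y2 = act m y1 - form_triple w y2 v - form_triple v y2 w - form_triple w y1 w"

definition refl4 :: "'a ^ 'n \<Rightarrow> 'a ^ 'n" where
  "refl4 y2 = act m y2 - form_triple w y2 w"

lemmas refl_defs = refl0_def refl1_def refl2_def refl3_def refl4_def

definition refl_poly :: "'a ^ 'n \<Rightarrow> 'a ^ 'n \<Rightarrow> 'a ^ 'n \<Rightarrow> 'a \<Rightarrow> 'a ^ 'n" where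
  "refl_poly y0 y1 y2 t =
     refl0 y0 + t *s refl1 y0 y1 + t^2 *s refl2 y0 y1 y2 + t^3 *s refl3 y1 y2 + t^4 *s refl4 y2"

text \<open>Over the algebraic closure, \<open>lattice_eq v w\<close> and \<open>lattice_eq (act m v) (act m w)\<close> separate the conditions
  at the three roots of the characteristic polynomial of \<open>m\<close>.\<close>

definition lattice_eq :: "'a ^ 'n \<Rightarrow> 'a ^ 'n \<Rightarrow> 'a ^ 'n \<Rightarrow> 'a ^ 'n \<Rightarrow> 'a ^ 'n \<Rightarrow> 'a ^ 'n" where
  "lattice_eq u u' y0 y1 y2 =
     cross_perp m (act m (act m u)) (refl1 y0 y1) + cross_perp m (act m (act m u')) (refl0 y0)
     - cross_perp m (act m u) (refl3 y1 y2) - cross_perp m (act m u') (refl2 y0 y1 y2) + cross_perp m u' (refl4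
       y2)"

definition lattice_sol :: "'a ^ 'n \<Rightarrow> 'a ^ 'n \<Rightarrow> 'a ^ 'n \<Rightarrow> bool" where
  "lattice_sol y0 y1 y2 \<longleftrightarrow> y0 \<in> perp m \<and> y1 \<in> perp m \<and> y2 \<in> perp m
     \<and> lattice_eq v w y0 y1 y2 = 0 \<and> lattice_eq (act m v) (act m w) y0 y1 y2 = 0"

definition multiplier :: "'a \<Rightarrow> 'a ^ 'n" where "multiplier t = e + t^2 *s m"

end

sublocale reflection_data \<subseteq> rot: reflection_data cr T e m q r p v w
  by unfold_locales (fact v w orthogonal ratio form_nonzero)+

context reflection_data
begin

lemma quad_part_v: "E.quad (part a v) = coord a ((- inverse 2) *s form m v v)"
  unfolding coord_linear coord_form[OF v v] E.quad_def by simp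

lemma quad_part_v_nonzero: "E.quad (part a v) \<noteq> 0"
proof
  assume "E.quad (part a v) = 0"
  then have "(- inverse 2) *s form m v v = 0"
    using coord_eq_0_imp[OF adjoin_scale[OF proj_adjoin]] quad_part_v by metis
  then show False using form_nonzero two_nonzero by simp
qed

lemma orthogonal_pair_part: "E.orthogonal_pair (E.quad (part a v)) p (part a v) (part a w)"
proof -
  have "- T\<^sub>a\<^sub>c (part a v) (part a w) = 0"
    unfolding coord_form[OF v w, symmetric] orthogonal by (rule coord_linear(5))
  moreover have "- T\<^sub>a\<^sub>c (part a w) (part a w) = p * - T\<^sub>a\<^sub>c (part a v) (part a v)"
    unfolding coord_form[OF v v, symmetric] coord_form[OF w w, symmetric] ratio[symmetric]
      coord_jordan[OF adjoin_self proj_adjoin] coord_generator ..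
  then have "E.quad (part a w) = E.quad (part a v) * p" by (simp add: E.quad_def)
  ultimately show ?thesis unfolding E.orthogonal_pair_def using quad_part_v_nonzero by simp
qed

lemma form_inverse_adjoin: "form_inverse \<in> adjoin m"
  unfolding form_inverse_def by (intro jinverse_adjoin adjoin_scale proj_adjoin)

lemma coord_form_inverse: "coord a form_inverse = inverse (E.quad (part a v))"
  unfolding form_inverse_def quad_part_v
  by (rule coord_jinverse[OF adjoin_scale[OF proj_adjoin]]) (use form_nonzero two_nonzero in simp)

lemma form_triple_perp: "z \<in> perp m \<Longrightarrow> form_triple x y z \<in> perp m"
  unfolding form_triple_def by (intro act_perp form_inverse_adjoin adjoin_minus proj_adjoin)

lemma form_triple_linear:
  "form_triple x (y + y') z = form_triple x y z + form_triple x y' z"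
    "form_triple x (k *s y) z = k *s form_triple x y z"
  by (simp_all add: form_triple_def bilinear_simps proj_add proj_scale act_linear)

lemma part_form_triple:
  assumes "x \<in> perp m" "y \<in> perp m" "z \<in> perp m"
  shows "part a (form_triple x y z) = (T\<^sub>a\<^sub>c (part a x) (part a y) * inverse (E.quad (part a v))) *s part a z"
proof -
  have form: "- form m x y \<in> adjoin m" by (intro adjoin_minus proj_adjoin)
  show ?thesis
    unfolding form_triple_def part_act[OF form_inverse_adjoin act_perp[OF form assms(3)]]
      part_act[OF form assms(3)] coord_form_inverse
    by (simp add: coord_linear coord_form[OF assms(1,2)] mult.commute)
qed

lemma refl_perp:
  assumes "y0 \<in> perp m" "y1 \<in> perp m" "y2 \<in> perp m"
  shows "refl0 y0 \<in> perp m" "refl1 y0 y1 \<in> perp m" "refl2 y0 y1 y2 \<in> perp m" "refl3 y1 y2 \<in> perp m"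
    "refl4 y2 \<in> perp m"
  unfolding refl_defs using assms v w by (simp_all add: perp_intros form_triple_perp act_perp adjoin_self)

lemma refl0_perp: "z \<in> perp m \<Longrightarrow> refl0 z \<in> perp m"
  using refl_perp(1) perp_zero by blast

lemma refl_poly_perp: "y0 \<in> perp m \<Longrightarrow> y1 \<in> perp m \<Longrightarrow> y2 \<in> perp m \<Longrightarrow> refl_poly y0 y1 y2 t \<in> perp m"
  unfolding refl_poly_def by (intro perp_intros refl_perp)

definition part_curve
  :: "'a alg_closure ^ 'n \<Rightarrow> 'a ^ 'n \<Rightarrow> 'a ^ 'n \<Rightarrow> 'a ^ 'n \<Rightarrow> 'a alg_closure \<Rightarrow> 'a alg_closure ^ 'n" where
  "part_curve d y0 y1 y2 t = part d y0 + t *s part d y1 + t^2 *s part d y2"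

definition part_refl
  :: "'a alg_closure ^ 'n \<Rightarrow> 'a ^ 'n \<Rightarrow> 'a ^ 'n \<Rightarrow> 'a ^ 'n \<Rightarrow> 'a alg_closure \<Rightarrow> 'a alg_closure ^ 'n" where
  "part_refl d y0 y1 y2 t = part d (refl0 y0) + t *s part d (refl1 y0 y1) + t^2 *s part d (refl2 y0 y1 y2)
     + t^3 *s part d (refl3 y1 y2) + t^4 *s part d (refl4 y2)"

lemma part_refl_poly: "part d (refl_poly y0 y1 y2 t) = part_refl d y0 y1 y2 (to_ac t)"
  by (simp add: refl_poly_def part_refl_def part_linear)

lemma part_refl_zero: "part_refl d y0 y1 y2 0 = part d (refl0 y0)"
  by (simp add: part_refl_def)

lemma poly_curve_part_curve: "poly_curve 2 (part_curve d y0 y1 y2)"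
proof -
  have monomial: "poly_curve 2 (\<lambda>t. t ^ k *s z)" if "k \<le> 2" for k and z :: "'a alg_closure ^ 'n"
    using poly_curve_mono[OF poly_curve_power that] .
  from monomial[of 0 "part d y0"] monomial[of 1 "part d y1"] monomial[of 2 "part d y2"]
  show ?thesis unfolding part_curve_def[abs_def] by (simp add: poly_curve_add)
qed

lemma peirce_part_curve:
  "y0 \<in> perp m \<Longrightarrow> y1 \<in> perp m \<Longrightarrow> y2 \<in> perp m \<Longrightarrow> E.peirce a b c (part_curve a y0 y1 y2 t)"
  unfolding part_curve_def by (intro E.peirce_intros peirce_part)

lemma reflection_curve_part:
  assumes y: "y0 \<in> perp m" "y1 \<in> perp m" "y2 \<in> perp m"
  shows "E.reflection_curve (E.quad (part a v)) p (part a v) (part a w) (part_curve a y0 y1 y2)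
      = part_refl a y0 y1 y2"
proof
  fix t
  define k where "k = inverse (E.quad (part a v))"
  have "part a (act m x) = p *s part a x" if "x \<in> perp m" for x
    using part_act[OF adjoin_self that] by (simp add: coord_generator)
  then show "E.reflection_curve (E.quad (part a v)) p (part a v) (part a w) (part_curve a y0 y1 y2) t
      = part_refl a y0 y1 y2 t"
    unfolding E.reflection_curve_def part_curve_def part_refl_def refl_defs divide_inverse k_def[symmetric]
      using y v w
    by (simp add: part_linear part_form_triple k_def[symmetric] E.bilinear_simps)
      (simp add: vec_eq_iff algebra_simps eval_nat_numeral)
qed

text \<open>The obstruction to divisibility along \<open>u + t u'\<close> in the component at \<open>d\<close>, with \<open>k = q(u') / q(u)\<close>.\<close>

definition defect ::
  "'a alg_closure \<Rightarrow> 'a alg_closure ^ 'n \<Rightarrow> 'a alg_closure ^ 'n \<Rightarrow> 'a alg_closure ^ 'n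
    \<Rightarrow> 'a ^ 'n \<Rightarrow> 'a ^ 'n \<Rightarrow> 'a ^ 'n \<Rightarrow> 'a alg_closure ^ 'n" where
  "defect k u u' d y0 y1 y2 = k^2 *s (u \<bowtie>\<^sub>a\<^sub>c part d (refl1 y0 y1) + u' \<bowtie>\<^sub>a\<^sub>c part d (refl0 y0))
     - k *s (u \<bowtie>\<^sub>a\<^sub>c part d (refl3 y1 y2) + u' \<bowtie>\<^sub>a\<^sub>c part d (refl2 y0 y1 y2)) + u' \<bowtie>\<^sub>a\<^sub>c part d (refl4 y2)"

end

context reflection_data
begin

lemma part_lattice_eq:
  assumes y: "y0 \<in> perp m" "y1 \<in> perp m" "y2 \<in> perp m" and u: "u \<in> perp m" "u' \<in> perp m"
  shows "part a (lattice_eq u u' y0 y1 y2)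
    = defect q (part b u) (part b u') c y0 y1 y2 + defect r (part c u) (part c u') b y0 y1 y2"
  unfolding lattice_eq_def defect_def part_linear
  by (simp add: part_cross_perp act_perp adjoin_self u refl_perp[OF y] rot.part_act rot.rot.part_act
      rot.coord_generator rot.rot.coord_generator E.bilinear_simps)
    (simp add: vec_eq_iff algebra_simps power2_eq_square)

lemma defect_zero:
  assumes sol: "lattice_sol y0 y1 y2"
  shows "defect q (part b v) (part b w) c y0 y1 y2 = 0" "defect r (part c v) (part c w) b y0 y1 y2 = 0"
proof -
  let ?F = "defect q (part b v) (part b w) c y0 y1 y2" and ?G = "defect r (part c v) (part c w) b y0 y1 y2"
  have y: "y0 \<in> perp m" "y1 \<in> perp m" "y2 \<in> perp m" using sol by (simp_all add: lattice_sol_def)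
  note parts = part_lattice_eq[OF y, symmetric]
  have opposite: "?F = - ?G"
    using parts[OF v w] sol by (simp add: lattice_sol_def part_linear add_eq_0_iff2)
  have "defect q (part b (act m v)) (part b (act m w)) c y0 y1 y2 = q *s ?F"
    "defect r (part c (act m v)) (part c (act m w)) b y0 y1 y2 = r *s ?G"
    by (simp_all add: defect_def rot.part_act rot.rot.part_act adjoin_self v w rot.coord_generator
        rot.rot.coord_generator E.bilinear_simps vec_eq_iff algebra_simps)
  then have "q *s ?F + r *s ?G = 0"
    using parts[OF act_perp[OF adjoin_self v] act_perp[OF adjoin_self w]] sol
    by (simp add: lattice_sol_def part_linear)
  then have "(r - q) *s ?G = 0" unfolding opposite by (simp add: vec.scale_left_diff_distrib)
  then show "?G = 0" using rot.roots_distinct by simp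
  then show "?F = 0" using opposite by simp
qed

lemma lattice_sol_divisible:
  assumes sol: "lattice_sol y0 y1 y2"
  shows "E.divisible_along a b c q (part b v) (part b w) (part_refl c y0 y1 y2)"
    and "E.divisible_along a b c r (part c v) (part c w) (part_refl b y0 y1 y2)"
proof -
  have y: "y0 \<in> perp m" "y1 \<in> perp m" "y2 \<in> perp m" using sol by (simp_all add: lattice_sol_def)
  note swap = E.peirce_swap
  show "E.divisible_along a b c q (part b v) (part b w) (part_refl c y0 y1 y2)"
    unfolding part_refl_def[abs_def]
    by (rule E.divisible_alongI[OF frame_abc rot.orthogonal_pair_part rot.root_nonzero])
      (use peirce_parts v w refl_perp[OF y] defect_zero(1)[OF sol] in \<open>simp_all add: defect_def\<close>)
  have "E.divisible_along a c b r (part c v) (part c w) (part_refl b y0 y1 y2)"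
    unfolding part_refl_def[abs_def]
    by (rule E.divisible_alongI[OF E.frame_flip[OF frame_abc] rot.rot.orthogonal_pair_part rot.rot.root_nonzero])
      (use peirce_parts[THEN swap] v w refl_perp[OF y] defect_zero(2)[OF sol] in \<open>simp_all add: defect_def\<close>)
  then show "E.divisible_along a b c r (part c v) (part c w) (part_refl b y0 y1 y2)"
    unfolding E.divisible_along_def using swap by blast
qed

lemma multiplier_adjoin: "multiplier t \<in> adjoin m"
  unfolding multiplier_def by (intro adjoin_intros)

lemma multiplier_nonzero: "multiplier t \<noteq> 0"
  using unit_independent[OF not_scalar, of 1 "t^2"] by (auto simp: multiplier_def)

lemma coord_multiplier: "coord a (multiplier t) = 1 + p * (to_ac t)^2"
  by (simp add: multiplier_def coord_linear coord_unit coord_generator mult.commute)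

lemma coord_multiplier_nonzero: "coord a (multiplier t) \<noteq> 0"
  using coord_eq_0_imp[OF multiplier_adjoin] multiplier_nonzero by blast

end

context reflection_data
begin

lemma reflection_triple_parts:
  assumes sol: "lattice_sol y0 y1 y2"
  shows "reflection_triple (\<bowtie>\<^sub>a\<^sub>c) T\<^sub>a\<^sub>c (embed e) a b c
    (E.quad (part a v)) (E.quad (part b v)) (E.quad (part c v)) p q r
    (part a v) (part b v) (part c v) (part a w) (part b w) (part c w)
    (part_curve a y0 y1 y2) (part_curve b y0 y1 y2) (part_curve c y0 y1 y2)"
proof -
  have y: "y0 \<in> perp m" "y1 \<in> perp m" "y2 \<in> perp m" using sol by (simp_all add: lattice_sol_def)
  note curves = reflection_curve_part[OF y] rot.reflection_curve_part[OF y] rot.rot.reflection_curve_part[OF y]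
  show ?thesis
    by unfold_locales
      (use peirce_parts v w y roots_distinct rot.roots_distinct rot.rot.roots_distinct in
        \<open>simp_all add: infinite_alg_closure frame_abc root_nonzero rot.root_nonzero rot.rot.root_nonzero
          orthogonal_pair_part rot.orthogonal_pair_part rot.rot.orthogonal_pair_part poly_curve_part_curve
          peirce_part_curve rot.peirce_part_curve rot.rot.peirce_part_curve curves
          lattice_sol_divisible[OF sol] rot.lattice_sol_divisible[OF sol] rot.rot.lattice_sol_divisible[OF sol]\<close>)
qed

lemma embed_refl_curve:
  assumes y: "y0 \<in> perp m" "y1 \<in> perp m" "y2 \<in> perp m" and l: "l \<in> adjoin m"
  shows "embed (jordan (multiplier t) l + act (jinverse (multiplier t)) (refl_poly y0 y1 y2 t))
    = (coord a (multiplier t) * coord a l) *s a + (coord b (multiplier t) * coord b l) *s b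
      + (coord c (multiplier t) * coord c l) *s c
      + (inverse (coord a (multiplier t)) *s part_refl a y0 y1 y2 (to_ac t)
        + inverse (coord b (multiplier t)) *s part_refl b y0 y1 y2 (to_ac t)
        + inverse (coord c (multiplier t)) *s part_refl c y0 y1 y2 (to_ac t))"
proof -
  note refl = refl_poly_perp[OF y] and inverse = jinverse_adjoin[OF multiplier_adjoin]
  note nonzero = multiplier_adjoin multiplier_nonzero
  show ?thesis
    unfolding embed_linear(1) embed_adjoin[OF adjoin_jordan[OF multiplier_adjoin l]]
      embed_perp[OF act_perp[OF inverse refl]] coord_jordan[OF multiplier_adjoin l]
      rot.coord_jordan[OF multiplier_adjoin l] rot.rot.coord_jordan[OF multiplier_adjoin l]
      part_act[OF inverse refl] rot.part_act[OF inverse refl] rot.rot.part_act[OF inverse refl]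
        coord_jinverse[OF nonzero] rot.coord_jinverse[OF nonzero] rot.rot.coord_jinverse[OF nonzero]
      part_refl_poly ..
qed

lemma cnorm_refl_poly:
  assumes sol: "lattice_sol y0 y1 y2" and l: "l \<in> adjoin m"
  shows "cnorm (jordan (multiplier t) l + act (jinverse (multiplier t)) (refl_poly y0 y1 y2 t))
    = cnorm (multiplier t) * cnorm (l + refl0 y0)"
proof -
  have y: "y0 \<in> perp m" "y1 \<in> perp m" "y2 \<in> perp m" using sol by (simp_all add: lattice_sol_def)
  interpret R: reflection_triple "(\<bowtie>\<^sub>a\<^sub>c)" "T\<^sub>a\<^sub>c" "embed e" a b c
    "E.quad (part a v)" "E.quad (part b v)" "E.quad (part c v)" p q r
    "part a v" "part b v" "part c v" "part a w" "part b w" "part c w"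
    "part_curve a y0 y1 y2" "part_curve b y0 y1 y2" "part_curve c y0 y1 y2"
    by (rule reflection_triple_parts[OF sol])
  have g: "R.g (to_ac t) = coord a (multiplier t)" "R.rot.g (to_ac t) = coord b (multiplier t)"
    "R.rot.rot.g (to_ac t) = coord c (multiplier t)"
    by (simp_all add: R.g_def R.rot.g_def R.rot.rot.g_def coord_multiplier rot.coord_multiplier
        rot.rot.coord_multiplier)
  have Y: "R.Y = part_refl a y0 y1 y2" "R.rot.Y = part_refl b y0 y1 y2" "R.rot.rot.Y = part_refl c y0 y1 y2"
    unfolding R.Y_def R.rot.Y_def R.rot.rot.Y_def
    by (rule reflection_curve_part[OF y] rot.reflection_curve_part[OF y] rot.rot.reflection_curve_part[OF y])+
  have start: "embed (l + refl0 y0) = coord a l *s a + coord b l *s b + coord c l *s c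
      + (part_refl a y0 y1 y2 0 + part_refl b y0 y1 y2 0 + part_refl c y0 y1 y2 0)"
    unfolding embed_linear(1) embed_adjoin[OF l] embed_perp[OF refl_perp(1)[OF y]] part_refl_zero ..
  note nonzero = coord_multiplier_nonzero rot.coord_multiplier_nonzero rot.rot.coord_multiplier_nonzero
  have "to_ac (cnorm (jordan (multiplier t) l + act (jinverse (multiplier t)) (refl_poly y0 y1 y2 t)))
    = coord a (multiplier t) * coord b (multiplier t) * coord c (multiplier t) * E.cnorm (embed (l + refl0 y0))"
    unfolding cnorm_embed[of "jordan _ _ + _", symmetric] embed_refl_curve[OF y l] start
    by (rule R.similarity_of_reflections[of "to_ac t", unfolded g Y, OF nonzero])
  also have "\<dots> = to_ac (cnorm (multiplier t) * cnorm (l + refl0 y0))"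
    unfolding to_ac_mult to_ac_cnorm[OF multiplier_adjoin] cnorm_embed ..
  finally show ?thesis by (simp only: to_ac_eq_iff)
qed

lemma refl_poly_eq_0_imp:
  assumes y: "y0 \<in> perp m" "y1 \<in> perp m" "y2 \<in> perp m" and zero: "refl_poly y0 y1 y2 t = 0"
  shows "part a (y0 + t *s y1 + t^2 *s y2) = 0"
proof -
  let ?y = "part_curve a y0 y1 y2 (to_ac t)" and ?u = "part a v + to_ac t *s part a w"
  let ?r = "E.reflection_curve (E.quad (part a v)) p (part a v) (part a w) (part_curve a y0 y1 y2) (to_ac t)"
  have nonzero: "1 + p * (to_ac t)^2 \<noteq> 0" using coord_multiplier_nonzero[of t] by (simp add: coord_multiplier)
  have reflection_zero: "?r = 0"
    using part_refl_poly[of a y0 y1 y2 t] by (simp add: reflection_curve_part[OF y] zero part_linear)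
  have "T\<^sub>a\<^sub>c ?r ?u = - ((1 + p * (to_ac t)^2) * T\<^sub>a\<^sub>c ?u ?y)"
    by (rule E.trace_reflection_curve_line[OF orthogonal_pair_part])
  then have "T\<^sub>a\<^sub>c ?u ?y = 0" using nonzero unfolding reflection_zero by simp
  then have "(1 + p * (to_ac t)^2) *s ?y = 0" using reflection_zero unfolding E.reflection_curve_def by simp
  then have "?y = 0" using nonzero by (metis vector_mul_eq_0)
  then show ?thesis by (simp add: part_curve_def part_linear)
qed

end

context reflection_data
begin

lemma refl0_zero: "refl0 0 = 0"
  using form_triple_linear(2)[of v 0 0 v] by (simp add: refl0_def)

lemma refl_poly_zero_imp:
  assumes y: "y1 \<in> perp m" "y2 \<in> perp m" and zero: "refl_poly 0 y1 y2 t = 0"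
  shows "t *s y1 + t^2 *s y2 = 0"
proof -
  note zeros = refl_poly_eq_0_imp[OF perp_zero y zero] rot.refl_poly_eq_0_imp[OF perp_zero y zero]
    rot.rot.refl_poly_eq_0_imp[OF perp_zero y zero]
  show ?thesis
    by (rule part_eqI) (use y zeros in \<open>auto simp: part_linear intro!: perp_intros\<close>)
qed

text \<open>Anisotropy of the norm makes the linear system of the lattice conditions nonsingular.\<close>

lemma lattice_sol_zero_unique:
  assumes sol: "lattice_sol 0 y1 y2" shows "y1 = 0 \<and> y2 = 0"
proof -
  have y: "y1 \<in> perp m" "y2 \<in> perp m" using sol by (simp_all add: lattice_sol_def)
  have curve_zero: "t *s y1 + t^2 *s y2 = 0" for t
  proof -
    have refl: "refl_poly 0 y1 y2 t \<in> perp m" by (intro refl_poly_perp perp_zero y)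
    have "cnorm (act (jinverse (multiplier t)) (refl_poly 0 y1 y2 t)) = 0"
      using cnorm_refl_poly[OF sol adjoin_zero] by (simp add: refl0_zero jordan_zero)
    then have "act (jinverse (multiplier t)) (refl_poly 0 y1 y2 t) = 0" by (rule anisotropic)
    then have "act (multiplier t) (act (jinverse (multiplier t)) (refl_poly 0 y1 y2 t)) = 0"
      by (simp add: act_linear)
    then have "refl_poly 0 y1 y2 t = 0"
      using refl by (simp add: act_act multiplier_adjoin jinverse_adjoin jordan_commute[of "multiplier t"]
          jordan_jinverse multiplier_nonzero act_unit_perp)
    then show ?thesis by (rule refl_poly_zero_imp[OF y])
  qed
  have "y1 + y2 = 0" "y2 = y1" using curve_zero[of 1] curve_zero[of "-1"] by simp_all
  then have "2 *s y1 = 0" by (simp add: vec_eq_iff)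
  then show ?thesis using two_nonzero \<open>y2 = y1\<close> by simp
qed

lemma refl_add:
  "refl0 (x0 + y0) = refl0 x0 + refl0 y0" "refl1 (x0 + y0) (x1 + y1) = refl1 x0 x1 + refl1 y0 y1"
  "refl2 (x0 + y0) (x1 + y1) (x2 + y2) = refl2 x0 x1 x2 + refl2 y0 y1 y2"
  "refl3 (x1 + y1) (x2 + y2) = refl3 x1 x2 + refl3 y1 y2" "refl4 (x2 + y2) = refl4 x2 + refl4 y2"
  by (simp_all add: refl_defs form_triple_linear act_linear)

lemma refl_scale:
  "refl0 (k *s y0) = k *s refl0 y0" "refl1 (k *s y0) (k *s y1) = k *s refl1 y0 y1"
  "refl2 (k *s y0) (k *s y1) (k *s y2) = k *s refl2 y0 y1 y2"
  "refl3 (k *s y1) (k *s y2) = k *s refl3 y1 y2" "refl4 (k *s y2) = k *s refl4 y2"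
  by (simp_all add: refl_defs form_triple_linear act_linear vec.scale_right_distrib vec.scale_right_diff_distrib)

lemma refl_poly_add: "refl_poly (x0 + y0) (x1 + y1) (x2 + y2) t = refl_poly x0 x1 x2 t + refl_poly y0 y1 y2 t"
  by (simp add: refl_poly_def refl_add vec.scale_right_distrib)

lemma refl_poly_scale: "refl_poly (k *s y0) (k *s y1) (k *s y2) t = k *s refl_poly y0 y1 y2 t"
  by (simp add: refl_poly_def refl_scale vec.scale_right_distrib mult.commute)

lemma lattice_eq_add:
  "lattice_eq u u' (x0 + y0) (x1 + y1) (x2 + y2) = lattice_eq u u' x0 x1 x2
    + lattice_eq u u' y0 y1 y2"
  by (simp add: lattice_eq_def refl_add cross_perp_linear)

lemma lattice_eq_scale: "lattice_eq u u' (k *s y0) (k *s y1) (k *s y2) = k *s lattice_eq u u' y0 y1 y2"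
  by (simp add: lattice_eq_def refl_scale cross_perp_linear vec.scale_right_distrib vec.scale_right_diff_distrib)

lemma lattice_eq_perp: "lattice_eq u u' y0 y1 y2 \<in> perp m"
  unfolding lattice_eq_def by (intro perp_intros cross_perp_perp)

lemma lattice_sol_add: "lattice_sol x0 x1 x2 \<Longrightarrow> lattice_sol y0 y1 y2 \<Longrightarrow> lattice_sol (x0 + y0) (x1 + y1) (x2 + y2)"
  unfolding lattice_sol_def by (simp add: lattice_eq_add perp_add)

lemma lattice_sol_scale: "lattice_sol y0 y1 y2 \<Longrightarrow> lattice_sol (k *s y0) (k *s y1) (k *s y2)"
  unfolding lattice_sol_def by (simp add: lattice_eq_scale perp_scale)

lemma lattice_sol_unique:
  assumes "lattice_sol y0 y1 y2" "lattice_sol y0 z1 z2" shows "z1 = y1 \<and> z2 = y2"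
proof -
  have "lattice_sol (y0 + (-1) *s y0) (z1 + (-1) *s y1) (z2 + (-1) *s y2)"
    by (rule lattice_sol_add[OF assms(2) lattice_sol_scale[OF assms(1)]])
  then have "lattice_sol 0 (z1 - y1) (z2 - y2)" by simp
  then show ?thesis using lattice_sol_zero_unique by force
qed

lemma perp_adjoin_sum_eq_0:
  assumes "u \<in> perp m" "l \<in> adjoin m" "u + l = 0" shows "u = 0 \<and> l = 0"
proof -
  have "u = - l" using assms(3) by (simp add: eq_neg_iff_add_eq_0)
  then have "u \<in> adjoin m" using assms(2) adjoin_minus by simp
  then have "u = 0" using adjoin_perp_disjoint assms(1) by blast
  then show ?thesis using assms(3) by simp
qed

lemma lattice_sol_exists:
  assumes y0: "y0 \<in> perp m" shows "\<exists>y1 y2. lattice_sol y0 y1 y2"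
proof -
  define P where "P x = x - proj m x" for x
  have P: "P (x + y) = P x + P y" "P (k *s x) = k *s P x" "P x \<in> perp m" for x y k
    using proj_residual by (simp_all add: P_def proj_add proj_scale vec.scale_right_diff_distrib)
  let ?m = "act m"
  let ?F = "\<lambda>x y. lattice_eq v w 0 (P x) (P y) + proj m x"
    and ?G = "\<lambda>x y. lattice_eq (?m v) (?m w) 0 (P x) (P y) + proj m y"
  have linear: "lattice_eq u u' 0 (x + x') (y + y') = lattice_eq u u' 0 x y + lattice_eq u u' 0 x' y'"
    "lattice_eq u u' 0 (k *s x) (k *s y) = k *s lattice_eq u u' 0 x y" for u u' x x' y y' k
    using lattice_eq_add[of u u' 0 0] lattice_eq_scale[of u u' k 0] by simp_all
  have "\<exists>x y. ?F x y = - lattice_eq v w y0 0 0 \<and> ?G x y = - lattice_eq (?m v) (?m w) y0 0 0"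
  proof (rule inj_imp_surj_pair)
    fix x y assume "?F x y = 0" "?G x y = 0"
    then have zero: "lattice_eq v w 0 (P x) (P y) = 0 \<and> proj m x = 0"
      "lattice_eq (?m v) (?m w) 0 (P x) (P y) = 0 \<and> proj m y = 0"
      using perp_adjoin_sum_eq_0[OF lattice_eq_perp proj_adjoin] by blast+
    then have "lattice_sol 0 (P x) (P y)" using P(3) by (simp add: lattice_sol_def perp_zero)
    then have "P x = 0 \<and> P y = 0" by (rule lattice_sol_zero_unique)
    then show "x = 0 \<and> y = 0" using zero by (simp add: P_def)
  qed (simp_all add: P linear proj_add proj_scale vec.scale_right_distrib)
  then obtain x y where xy: "?F x y = - lattice_eq v w y0 0 0" "?G x y = - lattice_eq (?m v) (?m w) y0 0 0"
    by blast
  have "lattice_eq u u' y0 (P x) (P y) = 0"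
    if "lattice_eq u u' 0 (P x) (P y) + proj m z = - lattice_eq u u' y0 0 0" for u u' z
  proof -
    have "lattice_eq u u' y0 (P x) (P y) + proj m z = 0"
      using that lattice_eq_add[of u u' y0 0 0 "P x" 0 "P y"]
      by (simp add: add.commute eq_neg_iff_add_eq_0 add.left_commute)
    then show ?thesis using perp_adjoin_sum_eq_0[OF lattice_eq_perp proj_adjoin] by blast
  qed
  then have "lattice_sol y0 (P x) (P y)" using xy P(3) y0 unfolding lattice_sol_def by blast
  then show ?thesis by blast
qed

lemma part_refl0:
  "z \<in> perp m \<Longrightarrow> part a (refl0 z) = part a z - (T\<^sub>a\<^sub>c (part a v) (part a z) / E.quad (part a v)) *s part a v"
  unfolding refl0_def part_linear by (simp add: part_form_triple v divide_inverse)

lemma part_refl0_involution: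
  assumes z: "z \<in> perp m" shows "part a (refl0 (refl0 z)) = part a z"
proof -
  define k where "k = T\<^sub>a\<^sub>c (part a v) (part a z) / E.quad (part a v)"
  have "T\<^sub>a\<^sub>c (part a v) (part a (refl0 z)) / E.quad (part a v) = - k"
    unfolding part_refl0[OF z] k_def[symmetric] E.trace_diff_right E.trace_scale_right E.trace_self_quad
    using quad_part_v_nonzero by (simp add: k_def field_simps)
  then show ?thesis unfolding part_refl0[OF refl0_perp[OF z]] unfolding part_refl0[OF z] k_def[symmetric] by simp
qed

end

context reflection_data
begin

lemma refl0_involution: "z \<in> perp m \<Longrightarrow> refl0 (refl0 z) = z"
  by (rule part_eqI) (simp_all add: refl0_perp part_refl0_involution rot.part_refl0_involution
      rot.rot.part_refl0_involution)

definition sol1 :: "'a ^ 'n \<Rightarrow> 'a ^ 'n" where "sol1 y0 = (SOME y1. \<exists>y2. lattice_sol y0 y1 y2)"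
definition sol2 :: "'a ^ 'n \<Rightarrow> 'a ^ 'n" where "sol2 y0 = (SOME y2. lattice_sol y0 (sol1 y0) y2)"

lemma lattice_sol_sol12: "y0 \<in> perp m \<Longrightarrow> lattice_sol y0 (sol1 y0) (sol2 y0)"
  using someI_ex[OF lattice_sol_exists] unfolding sol1_def sol2_def by (rule someI_ex)

lemma sol12_eq: "lattice_sol y0 y1 y2 \<Longrightarrow> sol1 y0 = y1 \<and> sol2 y0 = y2"
  using lattice_sol_unique lattice_sol_sol12 lattice_sol_def by metis

lemma sol12_add: "x \<in> perp m \<Longrightarrow> y \<in> perp m \<Longrightarrow> sol1 (x + y) = sol1 x + sol1 y \<and> sol2 (x + y) = sol2 x + sol2 y"
  by (intro sol12_eq lattice_sol_add lattice_sol_sol12)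

lemma sol12_scale: "x \<in> perp m \<Longrightarrow> sol1 (k *s x) = k *s sol1 x \<and> sol2 (k *s x) = k *s sol2 x"
  by (intro sol12_eq lattice_sol_scale lattice_sol_sol12)

definition sim_curve_perp :: "'a \<Rightarrow> 'a ^ 'n \<Rightarrow> 'a ^ 'n" where
  "sim_curve_perp t z = act (jinverse (multiplier t)) (refl_poly (refl0 z) (sol1 (refl0 z)) (sol2 (refl0 z)) t)"

definition sim_curve :: "'a \<Rightarrow> 'a ^ 'n \<Rightarrow> 'a ^ 'n" where
  "sim_curve t x = jordan (multiplier t) (proj m x) + sim_curve_perp t (x - proj m x)"

lemma sim_curve_perp_add:
  "x \<in> perp m \<Longrightarrow> y \<in> perp m \<Longrightarrow> sim_curve_perp t (x + y) = sim_curve_perp t x + sim_curve_perp t y"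
  unfolding sim_curve_perp_def refl_add by (simp add: sol12_add refl0_perp refl_poly_add act_linear)

lemma sim_curve_perp_scale: "x \<in> perp m \<Longrightarrow> sim_curve_perp t (k *s x) = k *s sim_curve_perp t x"
  unfolding sim_curve_perp_def refl_scale by (simp add: sol12_scale refl0_perp refl_poly_scale act_linear)

lemma sim_curve_add: "sim_curve t (x + y) = sim_curve t x + sim_curve t y"
proof -
  have "x + y - proj m (x + y) = (x - proj m x) + (y - proj m y)" by (simp add: proj_add)
  then show ?thesis
    unfolding sim_curve_def
    by (simp only: sim_curve_perp_add proj_residual) (simp add: proj_add jordan_linear_right)
qed

lemma sim_curve_scale: "sim_curve t (k *s x) = k *s sim_curve t x"
proof -
  have "k *s x - proj m (k *s x) = k *s (x - proj m x)" by (simp add: proj_scale vec.scale_right_diff_distrib)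
  then show ?thesis
    unfolding sim_curve_def
    by (simp only: sim_curve_perp_scale proj_residual)
      (simp add: proj_scale jordan_linear_right vec.scale_right_distrib)
qed

lemma similarity_sim_curve: "similarity (cnorm (multiplier t)) (sim_curve t)"
proof (rule similarityI)
  show "cnorm (sim_curve t x) = cnorm (multiplier t) * cnorm x" for x
    unfolding sim_curve_def sim_curve_perp_def
    using cnorm_refl_poly[OF lattice_sol_sol12[OF refl0_perp[OF proj_residual[of x m]]] proj_adjoin[of m x], of t]
    by (simp add: refl0_involution[OF proj_residual])
  show "cnorm (multiplier t) \<noteq> 0" using multiplier_nonzero anisotropic by blast
qed (rule sim_curve_add sim_curve_scale)+

lemma sim_curve_zero: "sim_curve 0 x = x"
proof -
  have "jinverse (multiplier 0) = e" by (simp add: jinverse_def multiplier_def)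
  then show ?thesis
    unfolding sim_curve_def sim_curve_perp_def
    by (simp add: multiplier_def jordan_unit refl_poly_def refl0_involution[OF proj_residual]
        act_unit_perp[OF proj_residual])
qed

lemma sim_curve_adjoin: "l \<in> adjoin m \<Longrightarrow> sim_curve t l = jordan (multiplier t) l"
  using sim_curve_perp_scale[OF perp_zero, of t 0] by (simp add: sim_curve_def proj_of_adjoin)

lemma sim_curve_refl0:
  assumes sol: "lattice_sol y0 y1 y2"
  shows "sim_curve t (refl0 y0) = act (jinverse (multiplier t)) (refl_poly y0 y1 y2 t)"
proof -
  have y0: "y0 \<in> perp m" using sol by (simp add: lattice_sol_def)
  have "proj m (refl0 y0) = 0" by (rule proj_of_perp[OF refl0_perp[OF y0]])
  then show ?thesis
    unfolding sim_curve_def sim_curve_perp_def by (simp add: refl0_involution[OF y0] jordan_zero sol12_eq[OF sol])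
qed

lemma poly_curve_multiplier: "poly_curve 2 multiplier"
  unfolding multiplier_def[abs_def] by (intro poly_curve_add poly_curve_const poly_curve_power)

lemma poly_curve_refl_poly: "poly_curve 4 (refl_poly y0 y1 y2)"
proof -
  have monomial: "poly_curve 4 (\<lambda>t. t ^ k *s z)" if "k \<le> 4" for k and z :: "'a ^ 'n"
    using poly_curve_mono[OF poly_curve_power that] .
  have linear: "poly_curve 4 (\<lambda>t. t *s z)" for z :: "'a ^ 'n" using monomial[of 1] by simp
  show ?thesis unfolding refl_poly_def[abs_def] by (intro poly_curve_add poly_curve_const monomial linear) auto
qed

lemma poly_curve_jordan_multiplier: "poly_curve 2 (\<lambda>t. jordan (multiplier t) l)"
proof -
  note const = poly_curve_const[of 0] and gt = poly_curve_multiplier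
  have cross: "poly_curve 2 (\<lambda>t. multiplier t \<bowtie> l)" using poly_curve_cross[OF gt const] by simp
  have "poly_curve 2 (\<lambda>t. T (multiplier t) e *s l)" "poly_curve 2 (\<lambda>t. T (multiplier t \<bowtie> l) e *s e)"
    using poly_curve_scale[OF poly_fun_trace[OF gt const] const]
      poly_curve_scale[OF poly_fun_trace[OF cross const] const]
    by simp_all
  moreover have "poly_curve 2 (\<lambda>t. T l e *s multiplier t)"
    using poly_curve_scale[OF poly_fun_const[of 0 "T l e"] gt] by (simp only: add_0)
  ultimately have "poly_curve (0 + 2)
      (\<lambda>t. inverse 2 *s (multiplier t \<bowtie> l + T (multiplier t) e *s l + T l e *s multiplier t
        - T (multiplier t \<bowtie> l) e *s e))"
    by (intro poly_curve_scale[OF poly_fun_const] poly_curve_diff poly_curve_add cross)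
  then show ?thesis unfolding jordan_def by (simp only: add_0)
qed

lemma poly_curve_sim_curve: "\<exists>d. poly_curve d (\<lambda>t. cnorm (multiplier t) *s sim_curve t x)"
proof -
  let ?z = "refl0 (x - proj m x)"
  let ?refl = "refl_poly ?z (sol1 ?z) (sol2 ?z)"
  have "cnorm (multiplier t) \<noteq> 0" for t using multiplier_nonzero anisotropic by blast
  then have eq: "cnorm (multiplier t) *s sim_curve t x
      = cnorm (multiplier t) *s jordan (multiplier t) (proj m x) - sharp (multiplier t) \<bowtie> ?refl t" for t
    unfolding sim_curve_def sim_curve_perp_def act_def jinverse_def
    by (simp add: bilinear_simps vec.scale_right_distrib vec.scale_minus_right)
  have "poly_curve 8 (\<lambda>t. cnorm (multiplier t) *s jordan (multiplier t) (proj m x))"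
    using poly_curve_scale[OF poly_fun_cnorm[OF poly_curve_multiplier] poly_curve_jordan_multiplier] by simp
  moreover have "poly_curve 8 (\<lambda>t. sharp (multiplier t) \<bowtie> ?refl t)"
    using poly_curve_cross[OF poly_curve_sharp[OF poly_curve_multiplier] poly_curve_refl_poly] by simp
  ultimately show ?thesis unfolding eq using poly_curve_diff by blast
qed

lemma R_trivial_sim_curve: "R_trivial (sim_curve 1)"
proof (rule rational_path_imp_R_trivial)
  have "cnorm (multiplier t) \<noteq> 0" for t using multiplier_nonzero anisotropic by blast
  moreover have "\<exists>d. poly_fun d (\<lambda>t. cnorm (multiplier t))" using poly_fun_cnorm[OF poly_curve_multiplier] by blast
  ultimately show "rational_path (sim_curve 1)"
    unfolding rational_path_def using poly_curve_sim_curve similarity_sim_curve sim_curve_zero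
    by (intro exI[of _ sim_curve] exI[of _ "\<lambda>t. cnorm (multiplier t)"]) auto
qed

end

locale subalgebra = division_cubic cr T e
  for cr :: "'a :: field ^ 'n \<Rightarrow> 'a ^ 'n \<Rightarrow> 'a ^ 'n" (infixl "\<bowtie>" 75)
    and T :: "'a ^ 'n \<Rightarrow> 'a ^ 'n \<Rightarrow> 'a" and e :: "'a ^ 'n" +
  fixes S :: "('a ^ 'n) set"
  assumes subspace_S: "vec.subspace S" and S_unit: "e \<in> S" and S_cross: "s \<in> S \<Longrightarrow> t \<in> S \<Longrightarrow> s \<bowtie> t \<in> S"
begin

definition S_perp :: "('a ^ 'n) set" where "S_perp = {y. \<forall>s\<in>S. T y s = 0}"

lemma S_perpD: "y \<in> S_perp \<Longrightarrow> s \<in> S \<Longrightarrow> T y s = 0"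
  by (simp add: S_perp_def)

lemma subspace_S_perp: "vec.subspace S_perp"
  by (auto simp: vec.subspace_def S_perp_def bilinear_simps)

lemmas S_add = vec.subspace_add[OF subspace_S]
lemmas S_scale = vec.subspace_scale[OF subspace_S]
lemmas S_diff = vec.subspace_diff[OF subspace_S]
lemmas S_minus = vec.subspace_neg[OF subspace_S]
lemmas S_zero = vec.subspace_0[OF subspace_S]
lemmas S_perp_add = vec.subspace_add[OF subspace_S_perp]
lemmas S_perp_scale = vec.subspace_scale[OF subspace_S_perp]
lemmas S_perp_diff = vec.subspace_diff[OF subspace_S_perp]

lemma S_sharp: "s \<in> S \<Longrightarrow> sharp s \<in> S"
  unfolding sharp_def by (intro S_scale S_cross)

lemma S_jordan: "s \<in> S \<Longrightarrow> t \<in> S \<Longrightarrow> jordan s t \<in> S"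
  unfolding jordan_def by (intro S_scale S_add S_diff S_cross S_unit)

lemma S_U_op: "s \<in> S \<Longrightarrow> t \<in> S \<Longrightarrow> U_op s t \<in> S"
  unfolding U_op_def by (intro S_scale S_diff S_cross S_sharp)

lemma S_jinverse: "s \<in> S \<Longrightarrow> jinverse s \<in> S"
  unfolding jinverse_def by (intro S_scale S_sharp)

lemma S_act: "s \<in> S \<Longrightarrow> t \<in> S \<Longrightarrow> act s t \<in> S"
  unfolding act_def by (intro S_minus S_cross)

lemma adjoin_S: "m \<in> S \<Longrightarrow> adjoin m \<subseteq> S"
  by (intro adjoin_subset subspace_S S_unit S_sharp)

lemma S_perp_subset_perp: "m \<in> S \<Longrightarrow> y \<in> S_perp \<Longrightarrow> y \<in> perp m"
  using perpI adjoin_S S_perpD by blast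

lemma act_S_perp: "s \<in> S \<Longrightarrow> y \<in> S_perp \<Longrightarrow> act s y \<in> S_perp"
  unfolding S_perp_def by (simp add: trace_act S_act)

lemma act_unit_S_perp: "y \<in> S_perp \<Longrightarrow> act e y = y"
  by (rule act_unit) (rule S_perpD[OF _ S_unit])

lemma act_jordan:
  assumes s: "s \<in> S" and t: "t \<in> S" and y: "y \<in> S_perp"
  shows "act s (act t y) + act t (act s y) = act (2 *s jordan s t) y"
proof -
  have orthogonal: "T y e = 0" "T e y = 0" "T s y = 0" "T t y = 0" "T (s \<bowtie> t) y = 0"
    using S_perpD[OF y S_unit] S_perpD[OF y S_cross[OF s t]] S_perpD[OF y s] S_perpD[OF y t]
    by (simp_all add: trace_commute)
  show ?thesis
    unfolding act_def two_jordan
    using sharp_sharp_polarized[of e s t y]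
    by (simp add: orthogonal cross_unit_left bilinear_simps trace_cross_unit trace_commute[of e t])
       (simp add: orthogonal cross_commute[of y] vec_eq_iff algebra_simps)
qed

lemma act_square:
  assumes s: "s \<in> S" and y: "y \<in> S_perp"
  shows "act s (act s y) = act (jordan s s) y"
proof (rule vec.scale_left_imp_eq[OF two_nonzero])
  have "2 *s act s (act s y) = act s (act s y) + act s (act s y)" by (simp add: vec_eq_iff)
  then show "2 *s act s (act s y) = 2 *s act (jordan s s) y" using act_jordan[OF s s y] by (simp only: act_linear)
qed

lemma act_U_op:
  assumes s: "s \<in> S" and t: "t \<in> S" and y: "y \<in> S_perp"
  shows "act (U_op s t) y = act s (act t (act s y))"
proof (rule vec.scale_left_imp_eq[OF two_nonzero])
  have st: "2 *s jordan s t \<in> S" and ss: "jordan s s \<in> S" by (intro S_scale S_jordan s t)+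
  have "act (2 *s jordan (2 *s jordan s t) s) y = act (2 *s jordan s t) (act s y)
      + act s (act (2 *s jordan s t) y)"
    by (rule act_jordan[OF st s y, symmetric])
  then have nested: "act (2 *s jordan (2 *s jordan s t) s) y
      = (act s (act t (act s y)) + act t (act s (act s y))) + act s (act s (act t y) + act t (act s y))"
    by (simp only: act_jordan[OF s t act_S_perp[OF s y]] act_jordan[OF s t y])
  have "act (2 *s jordan (jordan s s) t) y = act (jordan s s) (act t y) + act t (act (jordan s s) y)"
    by (rule act_jordan[OF ss t y, symmetric])
  then have squared: "act (2 *s jordan (jordan s s) t) y = act s (act s (act t y)) + act t (act s (act s y))"
    by (simp only: act_square[OF s y] act_square[OF s act_S_perp[OF t y]])
  have "2 *s act s (act t (act s y))
      = act (2 *s jordan (2 *s jordan s t) s) y - act (2 *s jordan (jordan s s) t) y"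
    unfolding nested squared act_linear(1) by (simp add: vec_eq_iff)
  also have "\<dots> = act (2 *s U_op s t) y"
    unfolding U_op_jordan jordan_commute[of "2 *s jordan s t" s] jordan_linear_right act_linear
      vec.scale_right_diff_distrib ..
  finally show "2 *s act (U_op s t) y = 2 *s act s (act t (act s y))" by (simp only: act_linear)
qed

lemma act_sharp:
  assumes s: "s \<in> S" and y: "y \<in> S_perp"
  shows "act (sharp s) y = act s (act s y) - T s e *s act s y + T (sharp s) e *s y"
  using y by (simp add: act_square[OF s] jordan_self act_linear act_unit_S_perp)

lemma act_sharp_act:
  assumes s: "s \<in> S" and y: "y \<in> S_perp"
  shows "act (sharp s) (act s y) = cnorm s *s y"
  using sharp_cross_cross[of s y] S_perpD[OF y S_sharp[OF s]]
  by (simp add: act_def bilinear_simps trace_commute[of "sharp s"])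

lemma act_act_sharp:
  assumes s: "s \<in> S" and y: "y \<in> S_perp"
  shows "act s (act (sharp s) y) = cnorm s *s y"
  using act_sharp_act[OF s y] unfolding act_sharp[OF s y] act_sharp[OF s act_S_perp[OF s y]]
  by (simp add: act_linear)

lemma act_cubed:
  assumes s: "s \<in> S" and y: "y \<in> S_perp"
  shows "act s (act s (act s y)) = T s e *s act s (act s y) - T (sharp s) e *s act s y + cnorm s *s y"
  using act_sharp_act[OF s y] unfolding act_sharp[OF s act_S_perp[OF s y]] by (simp add: algebra_simps)

lemma act_linearized_characteristic:
  assumes s: "s \<in> S" and t: "t \<in> S" and y: "y \<in> S_perp"
  shows "act (2 *s jordan (jordan s s) t + U_op s t - T s e *s (2 *s jordan s t) + T (sharp s) e *s t) y
    = act s (act s (act t y)) + act s (act t (act s y)) + act t (act s (act s y))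
      - T s e *s (act s (act t y) + act t (act s y)) + T (sharp s) e *s act t y"
proof -
  have square: "act (2 *s jordan (jordan s s) t) y = act s (act s (act t y)) + act t (act s (act s y))"
    by (simp only: act_jordan[OF S_jordan[OF s s] t y, symmetric] act_square[OF s act_S_perp[OF t y]]
        act_square[OF s y])
  have product: "act (2 *s jordan s t) y = act s (act t y) + act t (act s y)"
    by (rule act_jordan[OF s t y, symmetric])
  show ?thesis
    unfolding act_linear(6,7) act_linear(8)[of "T s e"] act_linear(8)[of "T (sharp s) e"] square product
      act_U_op[OF s t y]
    by (simp add: vec_eq_iff)
qed

lemma act_jinverse:
  assumes s: "s \<in> S" "s \<noteq> 0" and y: "y \<in> S_perp"
  shows "act (jinverse s) (act s y) = y" "act s (act (jinverse s) y) = y"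
proof -
  have "cnorm s \<noteq> 0" using s anisotropic by blast
  then show "act (jinverse s) (act s y) = y" "act s (act (jinverse s) y) = y"
    using act_sharp_act[OF s(1) y] act_act_sharp[OF s(1) y] by (simp_all add: jinverse_def act_linear)
qed

lemma act_inj:
  assumes "s \<in> S" "t \<in> S" "y \<in> S_perp" "y \<noteq> 0" "act s y = act t y" shows "s = t"
proof (rule ccontr)
  assume "s \<noteq> t"
  then have "act (jinverse (s - t)) (act (s - t) y) = y"
    using assms by (intro act_jinverse S_diff) auto
  moreover have "act (s - t) y = 0" using assms(5) by (simp add: act_linear)
  ultimately show False using assms(4) by (simp add: act_linear)
qed

lemma S_perp_decomposition: "\<exists>s\<in>S. x - s \<in> S_perp"
proof -
  have "\<exists>s\<in>S. \<forall>t\<in>S. T (x - s) t = 0"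
    by (rule orthogonal_decomposition[OF subspace_S]) (use trace_sharp_nonzero S_sharp in blast)
  then show ?thesis by (simp add: S_perp_def)
qed

lemma S_perp_anisotropic:
  assumes y: "y \<in> S_perp" "y \<noteq> 0" shows "\<exists>v\<in>S_perp. form m v v \<noteq> 0"
proof (rule ccontr)
  assume "\<not> ?thesis"
  then have isotropic: "form m v v = 0" if "v \<in> S_perp" for v using that by blast
  have totally_isotropic: "T u w = 0" if uw: "u \<in> S_perp" "w \<in> S_perp" for u w
  proof -
    have "(u + w) \<bowtie> (u + w) = u \<bowtie> u + w \<bowtie> w + 2 *s (u \<bowtie> w)"
      by (simp add: bilinear_simps cross_commute[of w u] vec_eq_iff)
    then have "2 *s form m u w = 0"
      using isotropic[OF S_perp_add[OF uw]] isotropic[OF uw(1)] isotropic[OF uw(2)]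
      by (simp add: proj_add proj_scale)
    then have "form m u w = 0" using two_nonzero by simp
    then have "T (u \<bowtie> w) e = 0" using proj_residual[of "u \<bowtie> w" m] trace_perp_unit by simp
    then show ?thesis using S_perpD[OF uw(1) S_unit] by (simp add: trace_cross_unit)
  qed
  obtain s where "s \<in> S" "sharp y - s \<in> S_perp" using S_perp_decomposition by blast
  then have "T y (sharp y) = 0"
    using totally_isotropic y(1) S_perpD[OF y(1), of s] by (metis trace_diff_right diff_zero)
  then show False using trace_sharp_nonzero[OF y(2)] by blast
qed

lemma S_perp_nonzero_exists:
  assumes "vec.dim S < CARD('n)" shows "\<exists>y\<in>S_perp. y \<noteq> 0"
proof -
  have "S \<noteq> UNIV" using assms by (auto simp: vec.dim_UNIV card_cart_basis)
  then obtain y where "y \<notin> S" by blast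
  moreover obtain s where "s \<in> S" "y - s \<in> S_perp" using S_perp_decomposition by blast
  ultimately show ?thesis by (intro bexI[of _ "y - s"]) auto
qed

end

section \<open>Cyclic automorphisms of a cubic subfield\<close>

locale perp_element = split_field cr T e m p q r
  for cr :: "'a::field ^ 'n \<Rightarrow> 'a ^ 'n \<Rightarrow> 'a ^ 'n"  (infixl "\<bowtie>" 75)
    and T :: "'a ^ 'n \<Rightarrow> 'a ^ 'n \<Rightarrow> 'a" and e m :: "'a ^ 'n" and p q r :: "'a alg_closure" +
  fixes x :: "'a ^ 'n"
  assumes x: "x \<in> perp m"

sublocale perp_element \<subseteq> rot: perp_element cr T e m q r p x
  by unfold_locales (rule x)

context perp_element
begin

definition quad_x :: "'a ^ 'n" where "quad_x = - proj m (sharp x)"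
definition sharp_x :: "'a ^ 'n" where "sharp_x = sharp x - proj m (sharp x)"

lemma quad_x_adjoin: "quad_x \<in> adjoin m"
  unfolding quad_x_def by (intro adjoin_minus proj_adjoin)

lemma sharp_x: "sharp_x \<in> perp m"
  unfolding sharp_x_def by (rule proj_residual)

lemma coord_quad_x: "coord a quad_x = E.quad (part a x)"
  unfolding quad_x_def sharp_def proj_scale coord_linear coord_form[OF x x] E.quad_def by simp

lemma part_sharp_x: "part a sharp_x = part b x \<bowtie>\<^sub>a\<^sub>c part c x"
proof -
  have "sharp_x = inverse 2 *s cross_perp m x x"
    by (simp add: sharp_x_def cross_perp_def sharp_def proj_scale vec.scale_right_diff_distrib)
  then have "part a sharp_x = to_ac (inverse 2) *s (part b x \<bowtie>\<^sub>a\<^sub>c part c x + part b x \<bowtie>\<^sub>a\<^sub>c part c x)"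
    by (simp only: part_linear part_cross_perp[OF x x] E.cross_commute[of "part c x" "part b x"])
  then show ?thesis using E.two_nonzero by (simp add: vec_eq_iff)
qed

lemma to_ac_cnorm_x: "to_ac (cnorm x) = T\<^sub>a\<^sub>c (part a x) (part b x \<bowtie>\<^sub>a\<^sub>c part c x)"
  using E.cnorm_frame[OF frame_abc peirce_parts[OF x], of 0 0 0]
  by (simp add: cnorm_embed[symmetric] embed_perp[OF x])

definition alg_x :: "('a ^ 'n) set" where
  "alg_x = {l + act l' x + act l'' sharp_x | l l' l''. l \<in> adjoin m \<and> l' \<in> adjoin m \<and> l'' \<in> adjoin m}"

lemma alg_xI: "l \<in> adjoin m \<Longrightarrow> l' \<in> adjoin m \<Longrightarrow> l'' \<in> adjoin m \<Longrightarrow> l + act l' x + act l'' sharp_x \<in> alg_x"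
  by (auto simp: alg_x_def)

lemma alg_xE:
  assumes "s \<in> alg_x"
  obtains l l' l'' where "s = l + act l' x + act l'' sharp_x" "l \<in> adjoin m" "l' \<in> adjoin m" "l'' \<in> adjoin m"
  using assms by (auto simp: alg_x_def)

lemma subspace_alg_x: "vec.subspace alg_x"
proof (rule vec.subspaceI)
  show "0 \<in> alg_x" using alg_xI[of 0 0 0] by (simp add: adjoin_zero act_linear)
  fix s k assume "s \<in> alg_x"
  then obtain l l' l'' where s: "s = l + act l' x + act l'' sharp_x" "l \<in> adjoin m" "l' \<in> adjoin m"
    "l'' \<in> adjoin m"
    by (rule alg_xE)
  show "k *s s \<in> alg_x"
    using alg_xI[of "k *s l" "k *s l'" "k *s l''"] s by (simp add: adjoin_scale act_linear vec.scale_right_distrib)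
  fix t assume "t \<in> alg_x"
  then obtain j j' j'' where t: "t = j + act j' x + act j'' sharp_x" "j \<in> adjoin m" "j' \<in> adjoin m"
    "j'' \<in> adjoin m"
    by (rule alg_xE)
  show "s + t \<in> alg_x"
    using alg_xI[of "l + j" "l' + j'" "l'' + j''"] s t by (simp add: adjoin_add act_linear add_ac)
qed

lemmas alg_x_add = vec.subspace_add[OF subspace_alg_x]
lemmas alg_x_diff = vec.subspace_diff[OF subspace_alg_x]
lemmas alg_x_minus = vec.subspace_neg[OF subspace_alg_x]
lemmas alg_x_scale = vec.subspace_scale[OF subspace_alg_x]

lemma alg_x_adjoin: "l \<in> adjoin m \<Longrightarrow> l \<in> alg_x"
  using alg_xI[of l 0 0] by (simp add: adjoin_zero act_linear)

lemma alg_x_act_x: "l \<in> adjoin m \<Longrightarrow> act l x \<in> alg_x"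
  using alg_xI[of 0 l 0] by (simp add: adjoin_zero act_linear)

lemma alg_x_act_sharp_x: "l \<in> adjoin m \<Longrightarrow> act l sharp_x \<in> alg_x"
  using alg_xI[of 0 0 l] by (simp add: adjoin_zero act_linear)

lemma dim_alg_x: "vec.dim alg_x \<le> 9"
proof -
  let ?B = "[e, m, sharp m, act e x, act m x, act (sharp m) x, act e sharp_x, act m sharp_x, act (sharp m) sharp_x]"
  have act_span: "act l y \<in> vec.span {act e y, act m y, act (sharp m) y}" if "l \<in> adjoin m" for l y
    using that unfolding adjoin_altdef
    by (clarify, unfold act_linear, intro vec.span_add vec.span_scale vec.span_base) auto
  have "adjoin m \<subseteq> vec.span (set ?B)" unfolding adjoin_def by (rule vec.span_mono) auto
  moreover have "act l x \<in> vec.span (set ?B)" "act l sharp_x \<in> vec.span (set ?B)" if "l \<in> adjoin m" for l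
    by (rule subsetD[OF vec.span_mono act_span[OF that]]; auto)+
  ultimately have "alg_x \<subseteq> vec.span (set ?B)" by (blast elim: alg_xE intro: vec.span_add)
  then have "vec.dim alg_x \<le> card (set ?B)" by (rule vec.dim_le_card) simp
  also have "\<dots> \<le> length ?B" by (rule card_length)
  finally show ?thesis by simp
qed

end

context perp_element
begin

lemma cross_cross_part:
  assumes "y \<in> perp m"
  shows "part b x \<bowtie>\<^sub>a\<^sub>c (part b x \<bowtie>\<^sub>a\<^sub>c part a y) = E.quad (part b x) *s part a y"
    and "part c x \<bowtie>\<^sub>a\<^sub>c (part c x \<bowtie>\<^sub>a\<^sub>c part a y) = E.quad (part c x) *s part a y"
  using E.cross_cross_peirce[OF E.frame_flip[OF rot.frame_abc] E.peirce_swap[OF peirce_parts(2)[OF x]]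
      E.peirce_swap[OF peirce_parts(1)[OF assms]]]
    E.cross_cross_peirce[OF rot.rot.frame_abc peirce_parts(3)[OF x] peirce_parts(1)[OF assms]] .

lemma part_cross_perp_act_x:
  assumes "l \<in> adjoin m" "k \<in> adjoin m"
  shows "part a (cross_perp m (act l x) (act k x)) = part a (act (l \<bowtie> k) sharp_x)"
  using assms
  by (simp add: part_cross_perp act_perp x sharp_x part_act rot.part_act rot.rot.part_act adjoin_cross coord_cross
      part_sharp_x E.bilinear_simps)
    (simp add: E.cross_commute[of "part c x" "part b x"] vec_eq_iff algebra_simps)

lemma part_cross_perp_act_x_sharp_x:
  assumes "l \<in> adjoin m" "k \<in> adjoin m"
  shows "part a (cross_perp m (act l x) (act k sharp_x)) = part a (act (jordan quad_x l \<bowtie> k) x)"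
  using assms
  by (simp add: part_cross_perp act_perp x sharp_x part_act rot.part_act rot.rot.part_act adjoin_cross
      adjoin_jordan quad_x_adjoin coord_cross rot.part_sharp_x rot.rot.part_sharp_x rot.coord_jordan
      rot.rot.coord_jordan rot.coord_quad_x rot.rot.coord_quad_x E.bilinear_simps)
    (simp add: cross_cross_part[OF x] cross_cross_part(1)[OF x, unfolded E.cross_commute[of "part b x" "part a x"]]
      vec_eq_iff algebra_simps)

lemma part_cross_perp_act_sharp_x:
  assumes "l \<in> adjoin m" "k \<in> adjoin m"
  shows "part a (cross_perp m (act l sharp_x) (act k sharp_x))
    = part a (cnorm x *s act (l \<bowtie> k) x - act (jordan (l \<bowtie> k) quad_x) sharp_x)"
proof -
  have cross_of_parts: "(part a x \<bowtie>\<^sub>a\<^sub>c part b x) \<bowtie>\<^sub>a\<^sub>c (part a x \<bowtie>\<^sub>a\<^sub>c part c x)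
     = to_ac (cnorm x) *s part a x - E.quad (part a x) *s (part b x \<bowtie>\<^sub>a\<^sub>c part c x)"
    using E.cross_of_crosses_peirce[OF frame_abc peirce_parts[OF x]]
    by (simp add: to_ac_cnorm_x E.trace_cross_assoc)
  show ?thesis
    using assms
    by (simp add: part_cross_perp act_perp x sharp_x part_act rot.part_act rot.rot.part_act adjoin_cross
        adjoin_jordan quad_x_adjoin coord_cross coord_jordan part_sharp_x rot.part_sharp_x rot.rot.part_sharp_x
        part_linear coord_quad_x E.bilinear_simps)
      (simp add: cross_of_parts cross_of_parts[unfolded E.cross_commute[of "part a x \<bowtie>\<^sub>a\<^sub>c part b x"]]
        E.cross_commute[of "part c x" "part a x"] vec_eq_iff algebra_simps)
qed

lemma cross_eqI:
  assumes "part a (cross_perp m u w) = part a z" "part b (cross_perp m u w) = part b z"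
    "part c (cross_perp m u w) = part c z" "z \<in> perp m"
  shows "u \<bowtie> w = form m u w + z"
proof -
  have "cross_perp m u w = z" by (rule part_eqI[OF cross_perp_perp assms(4) assms(1-3)])
  then show ?thesis by (simp add: cross_perp_def algebra_simps)
qed

end

context perp_element
begin

lemma alg_x_cross_adjoin:
  assumes "l \<in> adjoin m" "k \<in> adjoin m" shows "l \<bowtie> act k x \<in> alg_x" "l \<bowtie> act k sharp_x \<in> alg_x"
proof -
  have "l \<bowtie> act k x = - act (jordan l k) x" "l \<bowtie> act k sharp_x = - act (jordan l k) sharp_x"
    using assms by (simp_all add: act_act[symmetric] x sharp_x act_def[of l])
  then show "l \<bowtie> act k x \<in> alg_x" "l \<bowtie> act k sharp_x \<in> alg_x"
    using assms by (simp_all add: alg_x_minus alg_x_act_x alg_x_act_sharp_x adjoin_jordan)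
qed

lemma alg_x_cross_act:
  assumes l: "l \<in> adjoin m" and k: "k \<in> adjoin m"
  shows "act l x \<bowtie> act k x \<in> alg_x" and "act l x \<bowtie> act k sharp_x \<in> alg_x"
    and "act l sharp_x \<bowtie> act k sharp_x \<in> alg_x"
proof -
  note cross_intros = alg_x_add alg_x_diff alg_x_scale alg_x_act_x alg_x_act_sharp_x alg_x_adjoin[OF proj_adjoin]
    adjoin_cross adjoin_jordan quad_x_adjoin l k perp_diff perp_scale act_perp x sharp_x
  have eq: "act l x \<bowtie> act k x = form m (act l x) (act k x) + act (l \<bowtie> k) sharp_x"
    using assms by (intro cross_eqI part_cross_perp_act_x rot.part_cross_perp_act_x rot.rot.part_cross_perp_act_x
      cross_intros)
  show "act l x \<bowtie> act k x \<in> alg_x" by (subst eq) (intro cross_intros)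
  have eq: "act l x \<bowtie> act k sharp_x = form m (act l x) (act k sharp_x) + act (jordan quad_x l \<bowtie> k) x"
    using assms by (intro cross_eqI part_cross_perp_act_x_sharp_x rot.part_cross_perp_act_x_sharp_x
        rot.rot.part_cross_perp_act_x_sharp_x cross_intros)
  show "act l x \<bowtie> act k sharp_x \<in> alg_x" by (subst eq) (intro cross_intros)
  have eq: "act l sharp_x \<bowtie> act k sharp_x = form m (act l sharp_x) (act k sharp_x)
      + (cnorm x *s act (l \<bowtie> k) x - act (jordan (l \<bowtie> k) quad_x) sharp_x)"
    using assms by (intro cross_eqI part_cross_perp_act_sharp_x rot.part_cross_perp_act_sharp_x
        rot.rot.part_cross_perp_act_sharp_x cross_intros)
  show "act l sharp_x \<bowtie> act k sharp_x \<in> alg_x" by (subst eq) (intro cross_intros)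
qed

lemma alg_x_cross: assumes "s \<in> alg_x" "t \<in> alg_x" shows "s \<bowtie> t \<in> alg_x"
proof -
  obtain l l' l'' where s: "s = l + act l' x + act l'' sharp_x" "l \<in> adjoin m" "l' \<in> adjoin m" "l'' \<in> adjoin m"
    using assms(1) by (rule alg_xE)
  obtain k k' k'' where t: "t = k + act k' x + act k'' sharp_x" "k \<in> adjoin m" "k' \<in> adjoin m" "k'' \<in> adjoin m"
    using assms(2) by (rule alg_xE)
  show ?thesis
    unfolding s(1) t(1) cross_add_left cross_add_right
    using alg_x_cross_adjoin alg_x_cross_act alg_x_adjoin[OF adjoin_cross] s(2-4) t(2-4) cross_commute
    by (intro alg_x_add) metis+
qed

lemma subalgebra_alg_x: "subalgebra cr T e alg_x"
  by unfold_locales (simp_all add: subspace_alg_x alg_x_adjoin adjoin_unit alg_x_cross)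

end

locale cyclic_element = perp_element cr T e m p q r x
  for cr :: "'a::field ^ 'n \<Rightarrow> 'a ^ 'n \<Rightarrow> 'a ^ 'n"  (infixl "\<bowtie>" 75)
    and T :: "'a ^ 'n \<Rightarrow> 'a ^ 'n \<Rightarrow> 'a" and e m :: "'a ^ 'n" and p q r :: "'a alg_closure" and x :: "'a ^ 'n" +
  fixes \<tau> :: "'a ^ 'n \<Rightarrow> 'a ^ 'n"
  assumes form_x_nonzero: "form m x x \<noteq> 0"
    and tau_adjoin: "l \<in> adjoin m \<Longrightarrow> \<tau> l \<in> adjoin m"
    and coord_tau: "l \<in> adjoin m \<Longrightarrow> coord a (\<tau> l) = coord c l"
      "l \<in> adjoin m \<Longrightarrow> coord b (\<tau> l) = coord a l" "l \<in> adjoin m \<Longrightarrow> coord c (\<tau> l) = coord b l"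

sublocale cyclic_element \<subseteq> subalgebra cr T e alg_x
  by (rule subalgebra_alg_x)

sublocale cyclic_element \<subseteq> rot: cyclic_element cr T e m q r p x \<tau>
  by unfold_locales (simp_all add: form_x_nonzero tau_adjoin coord_tau)

context cyclic_element
begin

lemma tau_cubed: "l \<in> adjoin m \<Longrightarrow> \<tau> (\<tau> (\<tau> l)) = l"
  by (rule coord_eqI) (simp_all add: tau_adjoin coord_tau)

lemma tau_jordan: "l \<in> adjoin m \<Longrightarrow> k \<in> adjoin m \<Longrightarrow> \<tau> (jordan l k) = jordan (\<tau> l) (\<tau> k)"
  by (rule coord_eqI) (simp_all add: tau_adjoin coord_tau adjoin_jordan coord_jordan rot.rot.coord_jordan)

lemma tau_unit: "\<tau> e = e"
  by (rule coord_eqI) (simp_all add: tau_adjoin adjoin_unit coord_tau coord_unit rot.rot.coord_unit)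

lemma tau_nonzero: "l \<in> adjoin m \<Longrightarrow> l \<noteq> 0 \<Longrightarrow> \<tau> l \<noteq> 0"
  using coord_tau(2)[of l] coord_eq_0_imp[of l] coord_linear(5)[of b] by auto

lemma tau_tau_minus_tau:
  "\<tau> (\<tau> m) - \<tau> m \<in> adjoin m" "coord a (\<tau> (\<tau> m) - \<tau> m) = q - r" "\<tau> (\<tau> m) - \<tau> m \<noteq> 0"
proof -
  show "\<tau> (\<tau> m) - \<tau> m \<in> adjoin m" by (intro adjoin_diff tau_adjoin adjoin_self)
  show coord: "coord a (\<tau> (\<tau> m) - \<tau> m) = q - r"
    by (simp add: coord_linear coord_tau tau_adjoin adjoin_self rot.coord_generator rot.rot.coord_generator)
  show "\<tau> (\<tau> m) - \<tau> m \<noteq> 0" using coord rot.roots_distinct coord_linear(5)[of a] by auto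
qed

definition zeta :: "'a ^ 'n \<Rightarrow> 'a ^ 'n" where
  "zeta y = act (jinverse (\<tau> (\<tau> m) - \<tau> m)) (act (act m x) y - act (\<tau> m) (act x y))"

definition zeta_star :: "'a ^ 'n \<Rightarrow> 'a ^ 'n" where
  "zeta_star y = act x y - zeta y"

lemma generator_alg_x: "m \<in> alg_x"
  by (rule alg_x_adjoin[OF adjoin_self])

lemma x_alg_x: "x \<in> alg_x"
  using alg_x_act_x[OF adjoin_unit] act_unit_perp[OF x] by simp

lemma sharp_x_alg_x: "sharp_x \<in> alg_x"
  using alg_x_act_sharp_x[OF adjoin_unit] act_unit_perp[OF sharp_x] by simp

lemma S_perp_perp: "y \<in> S_perp \<Longrightarrow> y \<in> perp m"
  by (rule S_perp_subset_perp[OF generator_alg_x])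

lemma act_adjoin_S_perp: "l \<in> adjoin m \<Longrightarrow> y \<in> S_perp \<Longrightarrow> act l y \<in> S_perp"
  using act_S_perp alg_x_adjoin by blast

lemma form_S_perp: "s \<in> alg_x \<Longrightarrow> y \<in> S_perp \<Longrightarrow> form m s y = 0"
  using proj_of_perp[OF perp_minus[OF S_perp_perp[OF act_S_perp]]] by (simp add: act_def)

lemma act_cross_perp: "s \<in> alg_x \<Longrightarrow> y \<in> S_perp \<Longrightarrow> act s y = - cross_perp m s y"
  by (simp add: form_S_perp cross_perp_def act_def)

lemma part_act_S_perp:
  "s \<in> alg_x \<Longrightarrow> s \<in> perp m \<Longrightarrow> y \<in> S_perp
    \<Longrightarrow> part a (act s y) = - (part b s \<bowtie>\<^sub>a\<^sub>c part c y) - part c s \<bowtie>\<^sub>a\<^sub>c part b y"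
  by (simp add: act_cross_perp part_linear part_cross_perp S_perp_perp)

lemma trace_part_S_perp: "s \<in> alg_x \<Longrightarrow> s \<in> perp m \<Longrightarrow> y \<in> S_perp \<Longrightarrow> T\<^sub>a\<^sub>c (part a s) (part a y) = 0"
  using coord_form[of s y] form_S_perp[of s y] S_perp_perp[of y] coord_linear(5)[of a] by simp

lemma zeta_S_perp: "y \<in> S_perp \<Longrightarrow> zeta y \<in> S_perp"
  unfolding zeta_def
  by (intro S_perp_diff act_adjoin_S_perp act_S_perp alg_x_act_x x_alg_x jinverse_adjoin adjoin_diff tau_adjoin
      adjoin_self)

lemma zeta_star_S_perp: "y \<in> S_perp \<Longrightarrow> zeta_star y \<in> S_perp"
  unfolding zeta_star_def by (intro S_perp_diff act_S_perp x_alg_x zeta_S_perp)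

lemma part_zeta:
  assumes y: "y \<in> S_perp" shows "part a (zeta y) = - (part b x \<bowtie>\<^sub>a\<^sub>c part c y)"
proof -
  have perp: "act (act m x) y \<in> perp m" "act (\<tau> m) (act x y) \<in> perp m" "act x y \<in> perp m"
    using y by (auto intro!: S_perp_perp act_S_perp alg_x_adjoin alg_x_act_x x_alg_x tau_adjoin adjoin_self)
  have act_m_x: "part a (act (act m x) y) = - (q *s (part b x \<bowtie>\<^sub>a\<^sub>c part c y)) - r *s (part c x \<bowtie>\<^sub>a\<^sub>c part b y)"
    by (simp add: part_act_S_perp alg_x_act_x adjoin_self y act_perp x rot.part_act rot.rot.part_act
        rot.coord_generator rot.rot.coord_generator E.bilinear_simps)
  have act_tau: "part a (act (\<tau> m) (act x y)) = r *s (- (part b x \<bowtie>\<^sub>a\<^sub>c part c y) - part c x \<bowtie>\<^sub>a\<^sub>c part b y)"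
    by (simp add: part_act tau_adjoin adjoin_self perp coord_tau rot.rot.coord_generator part_act_S_perp x_alg_x x
        y)
  have difference: "part a (act (act m x) y) - part a (act (\<tau> m) (act x y))
      = (q - r) *s (- (part b x \<bowtie>\<^sub>a\<^sub>c part c y))"
    unfolding act_m_x act_tau by (simp add: vec_eq_iff algebra_simps)
  have "part a (zeta y) = inverse (q - r) *s (part a (act (act m x) y) - part a (act (\<tau> m) (act x y)))"
    unfolding zeta_def using tau_tau_minus_tau perp
    by (simp add: part_act jinverse_adjoin perp_diff coord_jinverse part_linear)
  then show ?thesis unfolding difference using rot.roots_distinct by (simp only: vec.scale_scale) simp
qed

lemma part_zeta_star: "y \<in> S_perp \<Longrightarrow> part a (zeta_star y) = - (part c x \<bowtie>\<^sub>a\<^sub>c part b y)"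
  unfolding zeta_star_def part_linear part_zeta by (simp add: part_act_S_perp x_alg_x x)

lemma S_perp_eqI:
  "y \<in> S_perp \<Longrightarrow> y' \<in> S_perp \<Longrightarrow> part a y = part a y' \<Longrightarrow> part b y = part b y' \<Longrightarrow> part c y = part c y' \<Longrightarrow> y = y'"
  by (rule part_eqI[OF S_perp_perp S_perp_perp])

lemma zeta_linear:
  "zeta (y + y') = zeta y + zeta y'" "zeta (k *s y) = k *s zeta y" "zeta (y - y') = zeta y - zeta y'"
  "zeta_star (y + y') = zeta_star y + zeta_star y'" "zeta_star (k *s y) = k *s zeta_star y"
  "zeta_star (y - y') = zeta_star y - zeta_star y'"
  by (simp_all add: zeta_def zeta_star_def act_linear vec.scale_right_diff_distrib)

end

context cyclic_element
begin

lemmas S_perp_intros = S_perp_add S_perp_scale S_perp_diff zeta_S_perp zeta_star_S_perp act_adjoin_S_perp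

lemmas part_S_perp =
  part_zeta rot.part_zeta rot.rot.part_zeta part_zeta_star rot.part_zeta_star rot.rot.part_zeta_star
  part_act[OF _ S_perp_perp] rot.part_act[OF _ S_perp_perp] rot.rot.part_act[OF _ S_perp_perp]

lemmas cross_cross_parts = cross_cross_part rot.cross_cross_part rot.rot.cross_cross_part

lemma zeta_act: "l \<in> adjoin m \<Longrightarrow> y \<in> S_perp \<Longrightarrow> zeta (act l y) = act (\<tau> l) (zeta y)"
  by (rule S_perp_eqI) (simp_all add: S_perp_intros tau_adjoin part_S_perp coord_tau E.bilinear_simps)

lemma zeta_star_act: "l \<in> adjoin m \<Longrightarrow> y \<in> S_perp \<Longrightarrow> zeta_star (act (\<tau> l) y) = act l (zeta_star y)"
  by (rule S_perp_eqI) (simp_all add: S_perp_intros tau_adjoin part_S_perp coord_tau E.bilinear_simps)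

lemma zeta_zeta_star: "y \<in> S_perp \<Longrightarrow> zeta (zeta_star y) = act (\<tau> (\<tau> quad_x)) y"
  by (rule S_perp_eqI)
    (simp_all add: S_perp_intros tau_adjoin quad_x_adjoin part_S_perp coord_tau E.bilinear_simps cross_cross_parts
      S_perp_perp coord_quad_x rot.coord_quad_x rot.rot.coord_quad_x)

lemma part_act_act_x:
  "l \<in> adjoin m \<Longrightarrow> y \<in> S_perp
    \<Longrightarrow> part a (act (act l x) y) = part a (act (\<tau> (\<tau> l)) (zeta y) + zeta_star (act (\<tau> (\<tau> l)) y))"
  by (simp add: part_act_S_perp alg_x_act_x act_perp x rot.part_act rot.rot.part_act
     E.bilinear_simps part_linear S_perp_intros tau_adjoin part_S_perp coord_tau)

lemma cross_part_sharp_x: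
  assumes y: "y \<in> S_perp"
  shows "part b sharp_x \<bowtie>\<^sub>a\<^sub>c part c y = - (part c x \<bowtie>\<^sub>a\<^sub>c (part a x \<bowtie>\<^sub>a\<^sub>c part c y))"
    and "part c sharp_x \<bowtie>\<^sub>a\<^sub>c part b y = - (part b x \<bowtie>\<^sub>a\<^sub>c (part a x \<bowtie>\<^sub>a\<^sub>c part b y))"
proof -
  note parts_x = peirce_parts[OF x] and parts_y = peirce_parts[OF S_perp_perp[OF y]]
  have traces: "T\<^sub>a\<^sub>c (part b x) (part b y) = 0" "T\<^sub>a\<^sub>c (part c x) (part c y) = 0"
    using rot.trace_part_S_perp[OF x_alg_x x y] rot.rot.trace_part_S_perp[OF x_alg_x x y] by auto
  have "part c x \<bowtie>\<^sub>a\<^sub>c (part c y \<bowtie>\<^sub>a\<^sub>c part a x) + part c y \<bowtie>\<^sub>a\<^sub>c (part c x \<bowtie>\<^sub>a\<^sub>c part a x) = 0"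
    using E.cross_cross_peirce_polarized[OF rot.rot.frame_abc parts_x(3) parts_y(3) parts_x(1)] traces by simp
  then show "part b sharp_x \<bowtie>\<^sub>a\<^sub>c part c y = - (part c x \<bowtie>\<^sub>a\<^sub>c (part a x \<bowtie>\<^sub>a\<^sub>c part c y))"
    unfolding rot.part_sharp_x by (simp add: E.cross_commute[of "part c y"] eq_neg_iff_add_eq_0 add.commute)
  have "part b x \<bowtie>\<^sub>a\<^sub>c (part b y \<bowtie>\<^sub>a\<^sub>c part a x) + part b y \<bowtie>\<^sub>a\<^sub>c (part b x \<bowtie>\<^sub>a\<^sub>c part a x) = 0"
    using E.cross_cross_peirce_polarized'[OF rot.frame_abc parts_x(2) parts_y(2) parts_x(1)] traces by simp
  then show "part c sharp_x \<bowtie>\<^sub>a\<^sub>c part b y = - (part b x \<bowtie>\<^sub>a\<^sub>c (part a x \<bowtie>\<^sub>a\<^sub>c part b y))"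
    unfolding rot.rot.part_sharp_x
    by (simp add: E.cross_commute[of "part b y"] E.cross_commute[of "part b x" "part a x"] eq_neg_iff_add_eq_0
        add.commute)
qed

lemma part_act_act_sharp_x:
  "l \<in> adjoin m \<Longrightarrow> y \<in> S_perp
    \<Longrightarrow> part a (act (act l sharp_x) y)
      = part a (act (\<tau> l) (zeta (zeta y)) + zeta_star (zeta_star (act (\<tau> l) y)))"
  by (simp add: part_act_S_perp alg_x_act_sharp_x act_perp sharp_x rot.part_act rot.rot.part_act
     E.bilinear_simps part_linear S_perp_intros tau_adjoin part_S_perp coord_tau cross_part_sharp_x)

end

context cyclic_element
begin

lemma act_act_x:
  "l \<in> adjoin m \<Longrightarrow> y \<in> S_perp
    \<Longrightarrow> act (act l x) y = act (\<tau> (\<tau> l)) (zeta y) + zeta_star (act (\<tau> (\<tau> l)) y)"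
  by (rule S_perp_eqI[OF _ _ part_act_act_x rot.part_act_act_x rot.rot.part_act_act_x])
    (simp_all add: act_S_perp alg_x_act_x S_perp_intros tau_adjoin)

lemma act_act_sharp_x:
  "l \<in> adjoin m \<Longrightarrow> y \<in> S_perp
    \<Longrightarrow> act (act l sharp_x) y = act (\<tau> l) (zeta (zeta y)) + zeta_star (zeta_star (act (\<tau> l) y))"
  by (rule S_perp_eqI[OF _ _ part_act_act_sharp_x rot.part_act_act_sharp_x rot.rot.part_act_act_sharp_x])
    (simp_all add: act_S_perp alg_x_act_sharp_x S_perp_intros tau_adjoin)

lemma cross_part_sharp_x_cross_part:
  assumes y: "y \<in> S_perp"
  shows "part b sharp_x \<bowtie>\<^sub>a\<^sub>c (part b x \<bowtie>\<^sub>a\<^sub>c part a y) + part c sharp_x \<bowtie>\<^sub>a\<^sub>c (part c x \<bowtie>\<^sub>a\<^sub>c part a y)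
    = to_ac (cnorm x) *s part a y"
proof -
  note parts_x = peirce_parts[OF x] and parts_y = peirce_parts[OF S_perp_perp[OF y]]
  have "T\<^sub>a\<^sub>c (part a x) (part a y) = 0" by (rule trace_part_S_perp[OF x_alg_x x y])
  then have cross: "part a x \<bowtie>\<^sub>a\<^sub>c part a y = 0"
    using E.cross_same_peirce[OF frame_abc parts_x(1) parts_y(1)] by simp
  have "T\<^sub>a\<^sub>c (part a sharp_x) (part a y) = 0" by (rule trace_part_S_perp[OF sharp_x_alg_x sharp_x y])
  then have triple: "T\<^sub>a\<^sub>c (part a y \<bowtie>\<^sub>a\<^sub>c part b x) (part c x) = 0"
    unfolding part_sharp_x by (metis E.trace_cross_assoc E.trace_commute)
  have "T\<^sub>a\<^sub>c (part a x \<bowtie>\<^sub>a\<^sub>c part b x) (part c x) = to_ac (cnorm x)"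
    by (simp add: to_ac_cnorm_x E.trace_cross_assoc)
  then have "(part a x \<bowtie>\<^sub>a\<^sub>c part b x) \<bowtie>\<^sub>a\<^sub>c (part a y \<bowtie>\<^sub>a\<^sub>c part c x)
      + (part a x \<bowtie>\<^sub>a\<^sub>c part c x) \<bowtie>\<^sub>a\<^sub>c (part a y \<bowtie>\<^sub>a\<^sub>c part b x) = to_ac (cnorm x) *s part a y"
    using E.sharp_sharp_polarized[of "part a x" "part a y" "part b x" "part c x"] by (simp add: cross triple)
  then show ?thesis
    unfolding rot.part_sharp_x rot.rot.part_sharp_x
    by (simp only: E.cross_commute[of "part c x" "part a x"] E.cross_commute[of "part a y"] add.commute)
qed

end

context cyclic_element
begin

lemma part_zeta_cubes:
  assumes y: "y \<in> S_perp"
  shows "part a (zeta (zeta (zeta y)) + zeta_star (zeta_star (zeta_star y))) = part a (cnorm x *s y)"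
proof -
  note parts_x = peirce_parts[OF x] and parts_y = peirce_parts[OF S_perp_perp[OF y]]
    and parts_sharp_x = peirce_parts[OF sharp_x]
  have zeta_cube: "part a (zeta (zeta (zeta y))) = part b x \<bowtie>\<^sub>a\<^sub>c (part b sharp_x \<bowtie>\<^sub>a\<^sub>c part a y)"
    unfolding rot.rot.cross_part_sharp_x(2)[OF y] by (simp add: part_S_perp S_perp_intros y E.bilinear_simps)
  have zeta_star_cube:
    "part a (zeta_star (zeta_star (zeta_star y))) = part c x \<bowtie>\<^sub>a\<^sub>c (part c sharp_x \<bowtie>\<^sub>a\<^sub>c part a y)"
    unfolding rot.cross_part_sharp_x(1)[OF y] by (simp add: part_S_perp S_perp_intros y E.bilinear_simps)
  have "T\<^sub>a\<^sub>c (part b x) (part b sharp_x) = to_ac (cnorm x)" "T\<^sub>a\<^sub>c (part c x) (part c sharp_x) = to_ac (cnorm x)"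
    unfolding rot.part_sharp_x rot.rot.part_sharp_x
    by (rule rot.to_ac_cnorm_x[symmetric] rot.rot.to_ac_cnorm_x[symmetric])+
  then have
    "part b x \<bowtie>\<^sub>a\<^sub>c (part b sharp_x \<bowtie>\<^sub>a\<^sub>c part a y) + part b sharp_x \<bowtie>\<^sub>a\<^sub>c (part b x \<bowtie>\<^sub>a\<^sub>c part a y)
        = to_ac (cnorm x) *s part a y"
    "part c x \<bowtie>\<^sub>a\<^sub>c (part c sharp_x \<bowtie>\<^sub>a\<^sub>c part a y) + part c sharp_x \<bowtie>\<^sub>a\<^sub>c (part c x \<bowtie>\<^sub>a\<^sub>c part a y)
        = to_ac (cnorm x) *s part a y"
    using E.cross_cross_peirce_polarized'[OF rot.frame_abc parts_x(2) parts_sharp_x(2) parts_y(1)]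
      E.cross_cross_peirce_polarized[OF rot.rot.frame_abc parts_x(3) parts_sharp_x(3) parts_y(1)] by simp_all
  then have "part b x \<bowtie>\<^sub>a\<^sub>c (part b sharp_x \<bowtie>\<^sub>a\<^sub>c part a y) + part c x \<bowtie>\<^sub>a\<^sub>c (part c sharp_x \<bowtie>\<^sub>a\<^sub>c part a y)
      = to_ac (cnorm x) *s part a y"
    using cross_part_sharp_x_cross_part[OF y] by (metis add.commute add_right_imp_eq)
  then show ?thesis unfolding part_linear zeta_cube zeta_star_cube .
qed

end

context cyclic_element
begin

lemma zeta_cubes: "y \<in> S_perp \<Longrightarrow> zeta (zeta (zeta y)) + zeta_star (zeta_star (zeta_star y)) = cnorm x *s y"
  by (rule S_perp_eqI[OF _ _ part_zeta_cubes rot.part_zeta_cubes rot.rot.part_zeta_cubes])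
    (simp_all add: S_perp_intros)

end

context cyclic_element
begin

definition half_norm :: 'a where "half_norm = cnorm x / 2"
definition disc :: 'a where "disc = half_norm^2 - cnorm quad_x"

text \<open>
  The maps \<open>\<zeta>\<^sup>3\<close> and \<open>\<zeta>\<^sub>*\<^sup>3\<close> have sum \<open>N(x)\<close> and product \<open>N(quad_x)\<close>, so
  \<open>\<delta>\<close> is half their difference and squares to a quarter of the discriminant.
\<close>
definition delta :: "'a ^ 'n \<Rightarrow> 'a ^ 'n" where
  "delta y = zeta (zeta (zeta y)) - half_norm *s y"

lemma cnorm_half_norm: "cnorm x = half_norm + half_norm"
  unfolding half_norm_def using two_nonzero by (simp add: field_simps)

lemma delta_S_perp: "y \<in> S_perp \<Longrightarrow> delta y \<in> S_perp"
  unfolding delta_def by (intro S_perp_diff S_perp_scale zeta_S_perp)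

lemma delta_linear:
  "delta (y + y') = delta y + delta y'" "delta (y - y') = delta y - delta y'"
  "delta (k *s y) = k *s delta y" "delta 0 = 0"
proof -
  show scale: "delta (k *s y) = k *s delta y" for k y by (simp add: delta_def zeta_linear vec_eq_iff algebra_simps)
  show "delta 0 = 0" using scale[of 0 0] by simp
qed (simp_all add: delta_def zeta_linear vec_eq_iff algebra_simps)

lemma delta_zeta_star: "y \<in> S_perp \<Longrightarrow> delta y = half_norm *s y - zeta_star (zeta_star (zeta_star y))"
  using zeta_cubes[of y] unfolding delta_def cnorm_half_norm vec.scale_left_distrib by (simp add: algebra_simps)

lemma delta_act_adjoin: "l \<in> adjoin m \<Longrightarrow> y \<in> S_perp \<Longrightarrow> delta (act l y) = act l (delta y)"
  unfolding delta_def by (simp add: zeta_act zeta_S_perp tau_adjoin tau_cubed act_linear)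

lemma delta_commute_zeta: "delta (zeta y) = zeta (delta y)"
  by (simp add: delta_def zeta_linear)

lemma delta_commute_zeta_star: "y \<in> S_perp \<Longrightarrow> delta (zeta_star y) = zeta_star (delta y)"
  by (simp add: delta_zeta_star zeta_star_S_perp zeta_linear)

lemma delta_act:
  assumes s: "s \<in> alg_x" and y: "y \<in> S_perp" shows "delta (act s y) = act s (delta y)"
proof -
  obtain l l' l'' where s: "s = l + act l' x + act l'' sharp_x" "l \<in> adjoin m" "l' \<in> adjoin m" "l'' \<in> adjoin m"
    using s by (rule alg_xE)
  show ?thesis
    unfolding s(1) act_linear delta_linear
    using s(2-4) y
    by (simp add: act_act_x act_act_sharp_x delta_linear delta_act_adjoin delta_commute_zeta
        delta_commute_zeta_star S_perp_intros tau_adjoin delta_S_perp)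
qed

lemma jordan_tau_quad_x: "jordan (\<tau> quad_x) (jordan quad_x (\<tau> (\<tau> quad_x))) = cnorm quad_x *s e"
  by (rule coord_eqI)
    (simp_all add: adjoin_jordan tau_adjoin quad_x_adjoin adjoin_scale adjoin_unit coord_jordan coord_tau
      coord_linear coord_unit to_ac_cnorm)

lemma zeta_cube_zeta_star_cube:
  assumes y: "y \<in> S_perp"
  shows "zeta (zeta (zeta (zeta_star (zeta_star (zeta_star y))))) = cnorm quad_x *s y"
proof -
  have "zeta (zeta (zeta (zeta_star (zeta_star (zeta_star y)))))
      = act (\<tau> quad_x) (act quad_x (act (\<tau> (\<tau> quad_x)) y))"
    using y by (simp add: zeta_zeta_star S_perp_intros zeta_act tau_adjoin quad_x_adjoin tau_cubed)
  also have "\<dots> = act (jordan (\<tau> quad_x) (jordan quad_x (\<tau> (\<tau> quad_x)))) y"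
    using y by (simp add: act_act tau_adjoin quad_x_adjoin adjoin_jordan S_perp_perp)
  finally show ?thesis unfolding jordan_tau_quad_x using y by (simp add: act_linear act_unit_S_perp)
qed

lemma delta_delta: assumes y: "y \<in> S_perp" shows "delta (delta y) = disc *s y"
proof -
  let ?z = "zeta_star (zeta_star (zeta_star y))"
  have zeta_cube: "zeta (zeta (zeta y)) = cnorm x *s y - ?z" using zeta_cubes[OF y] by (simp add: algebra_simps)
  have "delta (delta y) = zeta (zeta (zeta (half_norm *s y - ?z))) - half_norm *s (half_norm *s y - ?z)"
    unfolding delta_zeta_star[OF y] by (simp add: delta_def)
  also have "\<dots> = half_norm *s (cnorm x *s y - ?z) - cnorm quad_x *s y - half_norm *s (half_norm *s y - ?z)"
    by (simp add: zeta_linear zeta_cube_zeta_star_cube[OF y] zeta_cube)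
  also have "\<dots> = disc *s y"
    unfolding cnorm_half_norm by (simp add: disc_def vec_eq_iff algebra_simps power2_eq_square)
  finally show ?thesis .
qed

lemma trace_zeta:
  assumes y: "y \<in> S_perp" "y' \<in> S_perp" shows "T (zeta y) y' = T y (zeta_star y')"
proof -
  let ?k = "\<tau> (\<tau> m) - \<tau> m" and ?u = "act (jinverse (\<tau> (\<tau> m) - \<tau> m)) y'"
  have u: "?u \<in> S_perp" using y by (intro act_adjoin_S_perp jinverse_adjoin tau_tau_minus_tau(1))
  have "act (act m x) ?u - act x (act (\<tau> m) ?u) = zeta_star (act (\<tau> (\<tau> m)) ?u) - zeta_star (act (\<tau> m) ?u)"
    using u act_act_x[OF adjoin_self u]
      act_act_x[OF adjoin_unit act_adjoin_S_perp[OF tau_adjoin[OF adjoin_self] u]]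
    by (simp add: act_unit_perp[OF x] tau_unit zeta_act tau_adjoin adjoin_self act_adjoin_S_perp act_unit_S_perp
        zeta_S_perp)
  also have "\<dots> = zeta_star (act ?k ?u)" by (simp add: act_linear zeta_linear)
  also have "act ?k ?u = y'" using y(2) tau_tau_minus_tau by (intro act_jinverse alg_x_adjoin) auto
  finally show ?thesis unfolding zeta_def by (simp add: trace_act trace_diff_left trace_diff_right[symmetric])
qed

lemma trace_delta:
  assumes y: "y \<in> S_perp" "y' \<in> S_perp" shows "T (delta y) y' = - T y (delta y')"
  unfolding delta_zeta_star[OF y(2)] using y
  by (simp add: delta_def bilinear_simps trace_zeta zeta_S_perp zeta_star_S_perp)

lemma zeta_star_act_adjoin: "k \<in> adjoin m \<Longrightarrow> y \<in> S_perp \<Longrightarrow> zeta_star (act k y) = act (\<tau> (\<tau> k)) (zeta_star y)"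
  using zeta_star_act[of "\<tau> (\<tau> k)" y] by (simp add: tau_adjoin tau_cubed)

lemma zeta_act_zeta_star:
  assumes l: "l \<in> adjoin m" and y: "y \<in> S_perp"
  shows "zeta (act l (zeta_star y)) = act (jordan (\<tau> l) (\<tau> (\<tau> quad_x))) y"
    and "zeta (act (act l x) (zeta_star y)) = act (act (\<tau> (jordan l quad_x)) x) y"
    and "zeta (act (act l sharp_x) (zeta_star y)) = act (act (jordan (\<tau> l) quad_x) sharp_x) y"
proof -
  note zeta_rules = S_perp_intros S_perp_perp zeta_linear zeta_act zeta_star_act_adjoin zeta_zeta_star
    tau_adjoin tau_cubed tau_jordan adjoin_jordan quad_x_adjoin
  show "zeta (act l (zeta_star y)) = act (jordan (\<tau> l) (\<tau> (\<tau> quad_x))) y"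
    using assms by (simp add: act_act zeta_rules)
  show "zeta (act (act l x) (zeta_star y)) = act (act (\<tau> (jordan l quad_x)) x) y"
    using assms by (simp add: act_act_x act_act zeta_rules jordan_commute[of "\<tau> (\<tau> quad_x)" "\<tau> (\<tau> l)"])
  show "zeta (act (act l sharp_x) (zeta_star y)) = act (act (jordan (\<tau> l) quad_x) sharp_x) y"
    using assms by (simp add: act_act_sharp_x act_act zeta_rules jordan_commute[of l "\<tau> (\<tau> quad_x)"])
qed

lemma zeta_conjugate_exists:
  assumes s: "s \<in> alg_x" shows "\<exists>t\<in>alg_x. \<forall>y\<in>S_perp. act t y = zeta (act s (zeta_star y))"
proof -
  obtain l l' l'' where s: "s = l + act l' x + act l'' sharp_x" "l \<in> adjoin m" "l' \<in> adjoin m" "l'' \<in> adjoin m"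
    using s by (rule alg_xE)
  let ?t = "jordan (\<tau> l) (\<tau> (\<tau> quad_x)) + act (\<tau> (jordan l' quad_x)) x + act (jordan (\<tau> l'') quad_x) sharp_x"
  have "?t \<in> alg_x" using s(2-4) by (intro alg_xI adjoin_jordan tau_adjoin quad_x_adjoin)
  moreover have "act ?t y = zeta (act s (zeta_star y))" if "y \<in> S_perp" for y
    unfolding s(1) act_linear zeta_linear using s(2-4) that by (simp add: zeta_act_zeta_star)
  ultimately show ?thesis by blast
qed

definition square_elem :: "'a ^ 'n" where "square_elem = \<tau> (\<tau> quad_x) + sharp_x"
definition pivot :: "'a ^ 'n" where "pivot = half_norm *s e + act (\<tau> quad_x) x"

lemma square_elem_alg_x: "square_elem \<in> alg_x"
  unfolding square_elem_def by (intro alg_x_add alg_x_adjoin sharp_x_alg_x tau_adjoin quad_x_adjoin)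

lemma pivot_alg_x: "pivot \<in> alg_x"
  unfolding pivot_def by (intro alg_x_add alg_x_adjoin alg_x_act_x adjoin_scale adjoin_unit tau_adjoin
    quad_x_adjoin)

lemma act_pivot:
  "y \<in> S_perp \<Longrightarrow> act pivot y = half_norm *s y + zeta (zeta (zeta_star y)) + zeta (zeta_star (zeta_star y))"
  unfolding pivot_def
  by (simp add: act_linear act_unit_S_perp act_act_x tau_adjoin quad_x_adjoin tau_cubed zeta_zeta_star
      S_perp_intros zeta_act zeta_star_act_adjoin)

lemma act_square_elem:
  "y \<in> S_perp \<Longrightarrow> act square_elem y = zeta (zeta y) + zeta (zeta_star y) + zeta_star (zeta_star y)"
  using act_act_sharp_x[OF adjoin_unit, of y]
  by (simp add: square_elem_def act_linear act_unit_perp[OF sharp_x] zeta_zeta_star tau_unit act_unit_S_perp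
      zeta_S_perp)

lemma zeta_act_square_elem: "y \<in> S_perp \<Longrightarrow> zeta (act square_elem y) = delta y + act pivot y"
  by (simp add: act_square_elem act_pivot zeta_linear delta_def)

lemma act_square_elem_zeta_star: "y \<in> S_perp \<Longrightarrow> act square_elem (zeta_star y) = act pivot y - delta y"
  by (simp add: act_square_elem act_pivot delta_zeta_star zeta_star_S_perp)

lemma quad_x_nonzero: "quad_x \<noteq> 0"
  using form_x_nonzero two_nonzero by (simp add: quad_x_def sharp_def proj_scale)

lemma x_nonzero: "x \<noteq> 0"
  using form_x_nonzero proj_scale[of m 0 0] by auto

lemma square_elem_nonzero: "square_elem \<noteq> 0"
proof
  assume zero: "square_elem = 0"
  then have "sharp_x = - \<tau> (\<tau> quad_x)" by (simp add: square_elem_def add_eq_0_iff)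
  then have "sharp_x \<in> adjoin m" by (simp add: adjoin_minus tau_adjoin quad_x_adjoin)
  then have "sharp_x = 0" using adjoin_perp_disjoint sharp_x by blast
  then have "\<tau> (\<tau> quad_x) = 0" using zero by (simp add: square_elem_def)
  then show False using tau_nonzero tau_adjoin quad_x_adjoin quad_x_nonzero by metis
qed

lemma pivot_not_scalar: "pivot \<notin> scalars"
proof
  have l: "\<tau> quad_x \<in> adjoin m" "\<tau> quad_x \<noteq> 0"
    using tau_nonzero tau_adjoin quad_x_adjoin quad_x_nonzero by auto
  assume "pivot \<in> scalars"
  then obtain k where "pivot = k *s e" by (auto simp: scalars_def)
  then have "act (\<tau> quad_x) x = (k - half_norm) *s e" by (simp add: pivot_def vec_eq_iff algebra_simps)
  then have "act (\<tau> quad_x) x = 0" using adjoin_perp_disjoint adjoin_scale[OF adjoin_unit] act_perp[OF l(1) x]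
    by metis
  then have "act (jordan (jinverse (\<tau> quad_x)) (\<tau> quad_x)) x = 0"
    using act_act[OF jinverse_adjoin[OF l(1)] l(1) x] by (simp add: act_linear)
  then show False using x_nonzero by (simp add: jordan_jinverse[OF l] act_unit_perp[OF x])
qed

lemma disc_nonzero: "disc \<noteq> 0"
proof
  assume zero: "disc = 0"
  let ?l = "half_norm *s jinverse quad_x"
  have l: "?l \<in> adjoin m" by (intro adjoin_scale jinverse_adjoin quad_x_adjoin)
  have norm: "cnorm quad_x \<noteq> 0" using quad_x_nonzero anisotropic by blast
  have "sharp x = sharp_x - quad_x" by (simp add: sharp_x_def quad_x_def)
  then have "T ?l (sharp x) = - (3 * half_norm)"
    using norm trace_sharp_self(2)[of quad_x] trace_perp_adjoin[OF sharp_x adjoin_sharp[OF quad_x_adjoin]]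
    by (simp add: bilinear_simps trace_commute[of _ sharp_x] jinverse_def)
  moreover have "T (sharp ?l) x = 0" using trace_perp_adjoin[OF x adjoin_sharp[OF l]] by (simp add: trace_commute)
  moreover have "cnorm ?l = half_norm"
  proof -
    have "cnorm ?l = half_norm ^ 3 / cnorm quad_x"
      using norm by (simp add: cnorm_scale jinverse_def cnorm_sharp field_simps eval_nat_numeral)
    then show ?thesis using zero norm by (simp add: disc_def field_simps power2_eq_square power3_eq_cube)
  qed
  ultimately have "cnorm (?l + x) = 0" unfolding cnorm_add cnorm_half_norm by simp
  then have "x = - ?l" using anisotropic by (metis add_eq_0_iff)
  then have "x \<in> adjoin m" using adjoin_minus[OF l] by simp
  then show False using adjoin_perp_disjoint x x_nonzero by blast
qed

definition pivot_inv :: "'a ^ 'n" where "pivot_inv = jinverse pivot"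
definition curve_elem :: "'a ^ 'n" where "curve_elem = (- disc) *s jordan pivot_inv pivot_inv"

lemma pivot_nonzero: "pivot \<noteq> 0"
  using pivot_not_scalar scalarsI[of 0] by auto

lemma pivot_inv_alg_x: "pivot_inv \<in> alg_x"
  unfolding pivot_inv_def by (rule S_jinverse[OF pivot_alg_x])

lemma act_pivot_inv_pivot: "y \<in> S_perp \<Longrightarrow> act pivot_inv (act pivot y) = y"
  and act_pivot_pivot_inv: "y \<in> S_perp \<Longrightarrow> act pivot (act pivot_inv y) = y"
  unfolding pivot_inv_def using act_jinverse[OF pivot_alg_x pivot_nonzero] by auto

lemma pivot_inv_not_scalar: "pivot_inv \<notin> scalars"
proof -
  interpret pivot: cubic_field cr T e pivot by unfold_locales (rule pivot_not_scalar)
  show ?thesis unfolding pivot_inv_def by (rule pivot.jinverse_not_scalar)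
qed

lemma cubic_field_pivot_inv: "cubic_field cr T e pivot_inv"
  by unfold_locales (rule pivot_inv_not_scalar)

lemma adjoin_curve_elem: "adjoin curve_elem = adjoin pivot_inv"
  unfolding curve_elem_def using disc_nonzero
  by (intro cubic_field.adjoin_scaled_square[OF cubic_field_pivot_inv]) simp

lemma curve_elem_not_scalar: "curve_elem \<notin> scalars"
  unfolding curve_elem_def
  using disc_nonzero by (intro cubic_field.scaled_square_not_scalar[OF cubic_field_pivot_inv]) simp

lemma perp_curve_elem: "perp curve_elem = perp pivot_inv"
  by (rule perp_eq[OF adjoin_curve_elem])

lemma curve_elem_alg_x: "curve_elem \<in> alg_x"
  unfolding curve_elem_def by (intro S_scale S_jordan pivot_inv_alg_x)

lemma act_curve_elem: "y \<in> S_perp \<Longrightarrow> act curve_elem y = - (disc *s act pivot_inv (act pivot_inv y))"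
  unfolding curve_elem_def act_linear by (simp add: act_square pivot_inv_alg_x)

definition delta_commutator :: "'a ^ 'n \<Rightarrow> 'a ^ 'n \<Rightarrow> bool" where
  "delta_commutator s t \<longleftrightarrow>
    (\<forall>y\<in>S_perp. act t y = delta (act pivot_inv (act s y)) - delta (act s (act pivot_inv y)))"

lemma act_delta_commutator:
  "delta_commutator s t \<Longrightarrow> y \<in> S_perp \<Longrightarrow> act t y = delta (act pivot_inv (act s y)) - delta (act s (act pivot_inv y))"
  by (simp add: delta_commutator_def)

lemma delta_commutator_exists:
  assumes s: "s \<in> alg_x" shows "\<exists>t\<in>alg_x. delta_commutator s t"
proof -
  obtain t where t: "t \<in> alg_x" "\<And>y. y \<in> S_perp \<Longrightarrow> act t y = zeta (act (U_op square_elem s) (zeta_star y))"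
    using zeta_conjugate_exists[OF S_U_op[OF square_elem_alg_x s]] by blast
  let ?t = "U_op pivot_inv t - s + disc *s U_op pivot_inv s"
  have "act ?t y = delta (act pivot_inv (act s y)) - delta (act s (act pivot_inv y))" if y: "y \<in> S_perp" for y
  proof -
    let ?u = "act pivot_inv y" and ?v = "y - delta (act pivot_inv y)"
    have u: "?u \<in> S_perp" by (rule act_S_perp[OF pivot_inv_alg_x y])
    have v: "?v \<in> S_perp" by (intro S_perp_diff y delta_S_perp u)
    have "act square_elem (zeta_star ?u) = ?v"
      unfolding act_square_elem_zeta_star[OF u] by (simp add: act_pivot_pivot_inv y)
    then have "act t ?u = zeta (act square_elem (act s ?v))"
      unfolding t(2)[OF u] act_U_op[OF square_elem_alg_x s zeta_star_S_perp[OF u]] by simp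
    also have "\<dots> = delta (act s ?v) + act pivot (act s ?v)"
      by (rule zeta_act_square_elem[OF act_S_perp[OF s v]])
    finally have "act (U_op pivot_inv t) y = act pivot_inv (delta (act s ?v) + act pivot (act s ?v))"
      by (simp add: act_U_op[OF pivot_inv_alg_x t(1) y])
    also have "\<dots> = delta (act pivot_inv (act s y)) - disc *s act pivot_inv (act s ?u) + act s y - delta (act s ?u)"
      using y s u
      by (simp add: act_linear delta_linear delta_act[symmetric] pivot_inv_alg_x pivot_alg_x act_S_perp
          delta_S_perp act_pivot_inv_pivot act_pivot_pivot_inv delta_delta)
    finally show ?thesis by (simp add: act_linear act_U_op pivot_inv_alg_x s y)
  qed
  moreover have "?t \<in> alg_x" by (intro S_add S_diff S_scale S_U_op pivot_inv_alg_x s t(1))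
  ultimately show ?thesis unfolding delta_commutator_def by blast
qed

lemma delta_commutator_perp:
  assumes s: "s \<in> alg_x" and t: "t \<in> alg_x" and commutator: "delta_commutator s t"
    and y: "y \<in> S_perp" "y \<noteq> 0"
  shows "t \<in> perp curve_elem"
proof -
  let ?p = pivot_inv
  let ?lin = "2 *s jordan (jordan ?p ?p) t + U_op ?p t - T ?p e *s (2 *s jordan ?p t) + T (sharp ?p) e *s t"
  have "act ?lin y = act ?p (act ?p (act t y)) + act ?p (act t (act ?p y)) + act t (act ?p (act ?p y))
      - T ?p e *s (act ?p (act t y) + act t (act ?p y)) + T (sharp ?p) e *s act t y"
    by (rule act_linearized_characteristic[OF pivot_inv_alg_x t y(1)])
  also have "\<dots> = delta (act ?p (act ?p (act ?p (act s y))) - act s (act ?p (act ?p (act ?p y)))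
      - T ?p e *s (act ?p (act ?p (act s y)) - act s (act ?p (act ?p y)))
      + T (sharp ?p) e *s (act ?p (act s y) - act s (act ?p y)))"
    using y s
    by (simp add: act_delta_commutator[OF commutator] act_S_perp pivot_inv_alg_x act_linear delta_linear
        delta_act[symmetric] delta_S_perp vec.scale_right_diff_distrib)
  also have "\<dots> = delta 0"
    unfolding act_cubed[OF pivot_inv_alg_x act_S_perp[OF s y(1)]] act_cubed[OF pivot_inv_alg_x y(1)]
    by (rule arg_cong[of _ _ delta]) (simp add: act_linear vec_eq_iff algebra_simps)
  finally have "act ?lin y = act 0 y" by (simp add: act_linear delta_linear)
  moreover have "?lin \<in> alg_x" by (intro S_add S_diff S_scale S_U_op S_jordan pivot_inv_alg_x t)
  ultimately have "?lin = 0" using act_inj[OF _ S_zero y] by blast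
  then show ?thesis
    unfolding perp_curve_elem by (rule perp_if_linearized_characteristic_zero[OF pivot_inv_not_scalar])
qed

end

context cyclic_element
begin

lemma adjoin_curve_elem_alg_x: "l \<in> adjoin curve_elem \<Longrightarrow> l \<in> alg_x"
  using adjoin_S[OF curve_elem_alg_x] by blast

lemma S_perp_perp_curve_elem: "y \<in> S_perp \<Longrightarrow> y \<in> perp curve_elem"
  by (rule S_perp_subset_perp[OF curve_elem_alg_x])

lemma cubic_field_curve_elem: "cubic_field cr T e curve_elem"
  by unfold_locales (rule curve_elem_not_scalar)

lemma act_pivot_inv_commute:
  assumes l: "l \<in> adjoin curve_elem" and y: "y \<in> S_perp"
  shows "act l (act pivot_inv y) = act pivot_inv (act l y)"
proof -
  interpret pivot_inv: cubic_field cr T e pivot_inv by (rule cubic_field_pivot_inv)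
  have "y \<in> perp pivot_inv" using y by (rule S_perp_subset_perp[OF pivot_inv_alg_x])
  then show ?thesis
    using l by (simp add: pivot_inv.act_act adjoin_curve_elem adjoin_self jordan_commute[of l pivot_inv])
qed

definition partner :: "'a ^ 'n \<Rightarrow> 'a ^ 'n" where
  "partner v = act pivot_inv (delta v)"

lemma partner_S_perp: "v \<in> S_perp \<Longrightarrow> partner v \<in> S_perp"
  unfolding partner_def by (intro act_S_perp pivot_inv_alg_x delta_S_perp)

lemma form_partner_right_zero: assumes v: "v \<in> S_perp" shows "form curve_elem v (partner v) = 0"
proof (rule proj_of_perp, rule perpI)
  fix l assume l: "l \<in> adjoin curve_elem"
  have lv: "act l v \<in> S_perp" by (rule act_S_perp[OF adjoin_curve_elem_alg_x[OF l] v])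
  have "T v (act l (partner v)) = T (act pivot_inv (act l v)) (delta v)" by (simp only: partner_def trace_act)
  also have "\<dots> = - T (delta (act pivot_inv (act l v))) v"
    using trace_delta[OF act_S_perp[OF pivot_inv_alg_x lv] v] by simp
  also have "\<dots> = - T v (act l (partner v))"
    by (simp only: partner_def delta_act[OF pivot_inv_alg_x lv] delta_act[OF adjoin_curve_elem_alg_x[OF l] v]
        act_pivot_inv_commute[OF l delta_S_perp[OF v]] trace_commute[of _ v])
  finally have "2 * T v (act l (partner v)) = 0" by simp
  then show "T (v \<bowtie> partner v) l = 0" using two_nonzero by (simp add: trace_cross_act)
qed

lemma form_partner_partner:
  assumes v: "v \<in> S_perp"
  shows "form curve_elem (partner v) (partner v) = jordan curve_elem (form curve_elem v v)"
proof (rule proj_eqI)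
  interpret curve_elem: cubic_field cr T e curve_elem by (rule cubic_field_curve_elem)
  show "jordan curve_elem (form curve_elem v v) \<in> adjoin curve_elem"
    by (intro adjoin_jordan adjoin_self proj_adjoin)
  show "partner v \<bowtie> partner v - jordan curve_elem (form curve_elem v v) \<in> perp curve_elem"
  proof (rule perpI)
    fix l assume l: "l \<in> adjoin curve_elem"
    note l_alg = adjoin_curve_elem_alg_x[OF l]
    have "T (jordan curve_elem (form curve_elem v v)) l = T (v \<bowtie> v) (jordan curve_elem l)"
      by (simp add: trace_jordan trace_proj adjoin_jordan adjoin_self l)
    also have "\<dots> = - T v (act curve_elem (act l v))"
      by (simp only: trace_cross_act curve_elem.act_act[OF adjoin_self l S_perp_perp_curve_elem[OF v]])
    also have "\<dots> = disc * T v (act pivot_inv (act pivot_inv (act l v)))"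
      using act_curve_elem[OF act_S_perp[OF l_alg v]] by (simp add: bilinear_simps)
    finally have scaled: "T (jordan curve_elem (form curve_elem v v)) l
      = disc * T v (act pivot_inv (act pivot_inv (act l v)))" .
    have "T (partner v \<bowtie> partner v) l = - T (delta v) (act pivot_inv (act l (partner v)))"
      unfolding trace_cross_act by (subst (1) partner_def) (rule arg_cong[OF trace_act])
    also have "\<dots> = T v (delta (act pivot_inv (act l (partner v))))"
      using trace_delta[OF v act_S_perp[OF pivot_inv_alg_x act_S_perp[OF l_alg partner_S_perp[OF v]]]] by simp
    also have "delta (act pivot_inv (act l (partner v))) = disc *s act pivot_inv (act l (act pivot_inv v))"
      using v l_alg
      by (simp add: partner_def delta_act pivot_inv_alg_x act_S_perp delta_S_perp delta_delta act_linear)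
    also have "act l (act pivot_inv v) = act pivot_inv (act l v)" by (rule act_pivot_inv_commute[OF l v])
    finally show "T (partner v \<bowtie> partner v - jordan curve_elem (form curve_elem v v)) l = 0"
      by (simp add: trace_diff_left scaled bilinear_simps)
  qed
qed

lemma act_curve_elem_partner: "v \<in> S_perp \<Longrightarrow> act curve_elem (partner v) = partner (act curve_elem v)"
  unfolding partner_def
  by (simp add: act_pivot_inv_commute adjoin_self delta_S_perp delta_act curve_elem_alg_x)

text \<open>
  Conjugating by the U-operators of \<open>square_elem\<close> and \<open>pivot\<close> turns \<open>s \<mapsto> \<zeta> s \<zeta>\<^sub>*\<close> into
  \<open>s \<mapsto> factor s cofactor\<close>. The product of the two commuting factors is the action of \<open>1 - disc pivot_inv\<^sup>2\<close>.
\<close>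
definition factor :: "'a ^ 'n \<Rightarrow> 'a ^ 'n" where "factor y = y + delta (act pivot_inv y)"
definition cofactor :: "'a ^ 'n \<Rightarrow> 'a ^ 'n" where "cofactor y = y - delta (act pivot_inv y)"

lemma factor_add: "factor (y + y') = factor y + factor y'"
  by (simp add: factor_def act_linear delta_linear)

lemma cofactor_S_perp: "y \<in> S_perp \<Longrightarrow> cofactor y \<in> S_perp"
  unfolding cofactor_def by (intro S_perp_diff delta_S_perp act_S_perp pivot_inv_alg_x)

lemma factor_act_cofactor:
  assumes s: "s \<in> alg_x" and y: "y \<in> S_perp"
  shows "factor (act s (cofactor y)) = act s y
      + (delta (act pivot_inv (act s y)) - delta (act s (act pivot_inv y)))
    - disc *s act pivot_inv (act s (act pivot_inv y))"
  unfolding factor_def cofactor_def using assms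
  by (simp add: act_linear delta_linear delta_act act_S_perp pivot_inv_alg_x delta_S_perp delta_delta)

definition factor_conjugate :: "'a ^ 'n \<Rightarrow> 'a ^ 'n \<Rightarrow> bool" where
  "factor_conjugate s s' \<longleftrightarrow> s' \<in> alg_x \<and> (\<forall>y\<in>S_perp. act s' y = factor (act s (cofactor y)))"

lemma factor_conjugate_add:
  "factor_conjugate s s' \<Longrightarrow> factor_conjugate t t' \<Longrightarrow> factor_conjugate (s + t) (s' + t')"
  by (simp add: factor_conjugate_def S_add act_linear factor_add)

end

locale semilinear_curve = cyclic_element cr T e m p q r x \<tau>
  for cr :: "'a::field ^ 'n \<Rightarrow> 'a ^ 'n \<Rightarrow> 'a ^ 'n"  (infixl "\<bowtie>" 75)
    and T :: "'a ^ 'n \<Rightarrow> 'a ^ 'n \<Rightarrow> 'a" and e m :: "'a ^ 'n" and p q r :: "'a alg_closure"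
    and x :: "'a ^ 'n" and \<tau> :: "'a ^ 'n \<Rightarrow> 'a ^ 'n" +
  fixes v :: "'a ^ 'n" and p' q' r' :: "'a alg_closure"
  assumes v: "v \<in> S_perp" and form_v_nonzero: "form curve_elem v v \<noteq> 0"
    and roots': "E.characteristic_roots (embed curve_elem) p' q' r'"

sublocale semilinear_curve \<subseteq> curve: reflection_data cr T e curve_elem p' q' r' v "partner v"
  by unfold_locales
    (simp_all add: curve_elem_not_scalar roots' v form_v_nonzero partner_S_perp S_perp_perp_curve_elem
      form_partner_right_zero form_partner_partner)

context semilinear_curve
begin

lemma v_nonzero: "v \<noteq> 0"
  using form_v_nonzero proj_scale[of curve_elem 0 0] by auto

lemma form_S_perp_alg_x: "y \<in> S_perp \<Longrightarrow> s \<in> alg_x \<Longrightarrow> form curve_elem y s = 0"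
  using proj_of_perp[OF perp_minus[OF S_perp_perp_curve_elem[OF act_S_perp]]]
  by (simp add: act_def cross_commute[of y])

lemma cross_perp_curve_elem: "y \<in> S_perp \<Longrightarrow> s \<in> alg_x \<Longrightarrow> cross_perp curve_elem y s = - act s y"
  by (simp add: cross_perp_def form_S_perp_alg_x act_def cross_commute[of s])

lemma refl_alg_x:
  assumes "y0 \<in> alg_x" "y1 \<in> alg_x" "y2 \<in> alg_x"
  shows "curve.refl0 y0 = y0" "curve.refl1 y0 y1 = y1" "curve.refl2 y0 y1 y2 = y2 + act curve_elem y0"
    "curve.refl3 y1 y2 = act curve_elem y1" "curve.refl4 y2 = act curve_elem y2"
  unfolding curve.refl_defs curve.form_triple_def
  by (simp_all add: assms form_S_perp_alg_x v partner_S_perp act_linear)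

lemma act_act_curve_elem:
  assumes z: "z \<in> alg_x" "z \<in> perp curve_elem" and y: "y \<in> S_perp"
  shows "act (act curve_elem z) y
      = T curve_elem e *s act z y - act curve_elem (act z y) - act z (act curve_elem y)"
proof -
  have "T (curve_elem \<bowtie> z) e = 0" "T z e = 0"
    using trace_perp_adjoin[OF z(2) adjoin_self] trace_perp_unit[OF z(2)]
    by (simp_all add: trace_cross_unit trace_commute[of curve_elem])
  then have "act curve_elem z = T curve_elem e *s z - 2 *s jordan curve_elem z" by (simp add: two_jordan act_def)
  then have "act (act curve_elem z) y = T curve_elem e *s act z y - act (2 *s jordan curve_elem z) y"
    by (simp only: act_linear)
  then show ?thesis unfolding act_jordan[OF curve_elem_alg_x z(1) y, symmetric] by (simp add: algebra_simps)
qed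

end

context semilinear_curve
begin

context
  fixes s t y2 :: "'a ^ 'n"
  assumes s: "s \<in> alg_x" "s \<in> perp curve_elem" and t: "t \<in> alg_x" "delta_commutator s t"
  defines "y2 \<equiv> (- disc) *s U_op pivot_inv s"
begin

lemma t_perp: "t \<in> perp curve_elem"
  by (rule delta_commutator_perp[OF s(1) t v v_nonzero])

lemma y2_alg_x: "y2 \<in> alg_x"
  unfolding y2_def by (intro S_scale S_U_op pivot_inv_alg_x s)

lemma y2_perp: "y2 \<in> perp curve_elem"
  unfolding y2_def
proof (intro perp_scale perpI)
  fix l assume "l \<in> adjoin curve_elem"
  then have "U_op pivot_inv l \<in> adjoin curve_elem" unfolding adjoin_curve_elem by (intro adjoin_U_op adjoin_self)
  then show "T (U_op pivot_inv s) l = 0" unfolding trace_U_op by (rule trace_perp_adjoin[OF s(2)])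
qed

lemma act_y2: "y \<in> S_perp \<Longrightarrow> act y2 y = - (disc *s act pivot_inv (act s (act pivot_inv y)))"
  unfolding y2_def by (simp add: act_linear act_U_op[OF pivot_inv_alg_x s(1)])

lemma act_y2_partner:
  assumes u: "u \<in> S_perp"
  shows "act y2 (partner u) = act t (act curve_elem u) + act s (act curve_elem (partner u))"
proof -
  have delta_minus: "delta (- u) = - delta u" for u using delta_linear(3)[of "-1" u] by simp
  show ?thesis
    unfolding act_y2[OF partner_S_perp[OF u]] using u s
    by (simp add: partner_def act_delta_commutator[OF t(2)] act_curve_elem act_S_perp pivot_inv_alg_x
        curve_elem_alg_x delta_S_perp act_linear delta_linear delta_minus delta_act[symmetric] vec_eq_iff)
qed

lemma lattice_eq_zero:
  assumes u: "u \<in> S_perp" shows "curve.lattice_eq u (partner u) s t y2 = 0"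
proof -
  let ?c = "act curve_elem"
  note alg_x = s(1) t(1) y2_alg_x S_act[OF curve_elem_alg_x]
  have S_perp: "?c u \<in> S_perp" "?c (?c u) \<in> S_perp" "partner u \<in> S_perp" "?c (partner u) \<in> S_perp"
    "?c (?c (partner u)) \<in> S_perp"
    by (intro act_S_perp curve_elem_alg_x partner_S_perp u)+
  have "curve.lattice_eq u (partner u) s t y2
      = - act t (?c (?c u)) - act s (?c (?c (partner u))) + act (?c t) (?c u)
        + act (y2 + ?c s) (?c (partner u)) - act (?c y2) (partner u)"
    unfolding curve.lattice_eq_def refl_alg_x[OF s(1) t(1) y2_alg_x]
    by (simp add: cross_perp_curve_elem S_perp alg_x S_add)
  also have "\<dots> = 0"
    unfolding act_linear(6) act_act_curve_elem[OF t(1) t_perp S_perp(1)] act_act_curve_elem[OF s S_perp(4)]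
      act_act_curve_elem[OF y2_alg_x y2_perp S_perp(3)] act_y2_partner[OF u]
    unfolding act_curve_elem_partner[OF u] act_y2_partner[OF S_perp(1)] act_linear(1)
    by (simp add: vec_eq_iff algebra_simps)
  finally show ?thesis .
qed

lemma lattice_sol: "curve.lattice_sol s t y2"
  unfolding curve.lattice_sol_def act_curve_elem_partner[OF v]
  by (simp add: s t_perp y2_perp lattice_eq_zero v act_S_perp curve_elem_alg_x)

lemma sim_curve_lattice_sol: "curve.sim_curve 1 s = s + t + y2"
proof -
  have perp: "s + t + y2 \<in> perp curve_elem" by (intro perp_add s(2) t_perp y2_perp)
  have "curve.refl_poly s t y2 1 = act (curve.multiplier 1) (s + t + y2)"
    unfolding curve.refl_poly_def refl_alg_x[OF s(1) t(1) y2_alg_x] curve.multiplier_def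
    by (auto simp: act_linear act_unit_perp[OF s(2)] act_unit_perp[OF t_perp] act_unit_perp[OF y2_perp])
  then have "curve.sim_curve 1 s = act (jinverse (curve.multiplier 1)) (act (curve.multiplier 1) (s + t + y2))"
    using curve.sim_curve_refl0[OF lattice_sol, of 1] by (simp only: refl_alg_x[OF s(1) t(1) y2_alg_x])
  also have "\<dots> = s + t + y2"
    using curve.act_act[OF jinverse_adjoin[OF curve.multiplier_adjoin] curve.multiplier_adjoin perp]
    by (simp add: curve.jordan_jinverse curve.multiplier_adjoin curve.multiplier_nonzero act_unit_perp[OF perp])
  finally show ?thesis .
qed

lemma factor_conjugate_lattice_sol: "factor_conjugate s (s + t + y2)"
  unfolding factor_conjugate_def
  by (simp add: S_add s(1) t(1) y2_alg_x act_linear act_y2 act_delta_commutator[OF t(2)] factor_act_cofactor)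

end

lemma factor_conjugate_sim_curve_perp:
  assumes s: "s \<in> alg_x" "s \<in> perp curve_elem" shows "factor_conjugate s (curve.sim_curve 1 s)"
proof -
  obtain t where "t \<in> alg_x" "delta_commutator s t" using delta_commutator_exists[OF s(1)] by blast
  then show ?thesis
    using sim_curve_lattice_sol[OF s, of t] factor_conjugate_lattice_sol[OF s, of t] by simp
qed

lemma factor_conjugate_sim_curve_adjoin:
  assumes l: "l \<in> adjoin curve_elem" shows "factor_conjugate l (curve.sim_curve 1 l)"
  unfolding factor_conjugate_def curve.sim_curve_adjoin[OF l]
proof (intro conjI ballI)
  note l_alg = adjoin_curve_elem_alg_x[OF l]
  show "jordan (curve.multiplier 1) l \<in> alg_x"
    by (intro S_jordan adjoin_curve_elem_alg_x curve.multiplier_adjoin l)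
  fix y assume y: "y \<in> S_perp"
  have "act (jordan (curve.multiplier 1) l) y = act (curve.multiplier 1) (act l y)"
    by (rule curve.act_act[OF curve.multiplier_adjoin l S_perp_perp_curve_elem[OF y], symmetric])
  also have "\<dots> = act l y - disc *s act pivot_inv (act pivot_inv (act l y))"
    unfolding curve.multiplier_def act_linear
    by (simp add: act_unit_S_perp act_curve_elem act_S_perp[OF l_alg y])
  also have "\<dots> = factor (act l (cofactor y))"
    unfolding factor_act_cofactor[OF l_alg y] act_pivot_inv_commute[OF l y] by simp
  finally show "act (jordan (curve.multiplier 1) l) y = factor (act l (cofactor y))" .
qed

lemma factor_conjugate_sim_curve:
  assumes s: "s \<in> alg_x" shows "factor_conjugate s (curve.sim_curve 1 s)"
proof -
  have "proj curve_elem s \<in> alg_x" using proj_adjoin adjoin_curve_elem_alg_x by blast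
  then have "factor_conjugate (proj curve_elem s + (s - proj curve_elem s))
      (curve.sim_curve 1 (proj curve_elem s) + curve.sim_curve 1 (s - proj curve_elem s))"
    by (intro factor_conjugate_add factor_conjugate_sim_curve_adjoin factor_conjugate_sim_curve_perp
        proj_adjoin proj_residual S_diff s)
  then show ?thesis by (simp add: curve.sim_curve_add[symmetric])
qed

end

context cyclic_element
begin

lemma R_trivial_factor_conjugate:
  assumes y: "y \<in> S_perp" "y \<noteq> 0"
  obtains \<rho> where "R_trivial \<rho>" and "\<And>s. s \<in> alg_x \<Longrightarrow> factor_conjugate s (\<rho> s)"
proof -
  obtain v where v: "v \<in> S_perp" "form curve_elem v v \<noteq> 0" using S_perp_anisotropic[OF y] by blast
  obtain p' q' r' where "split_field cr T e curve_elem p' q' r'"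
    by (rule cubic_field.split_fieldE[OF cubic_field_curve_elem])
  then have "E.characteristic_roots (embed curve_elem) p' q' r'" by (rule split_field.roots)
  then interpret semilinear_curve cr T e m p q r x \<tau> v p' q' r' by unfold_locales (simp_all add: v)
  show ?thesis by (rule that[OF curve.R_trivial_sim_curve factor_conjugate_sim_curve])
qed

lemma factor_act_pivot:
  assumes s: "s \<in> alg_x" and y: "y \<in> S_perp"
  shows "act pivot (factor (act s (cofactor (act pivot y))))
      = zeta (act square_elem (act s (act square_elem (zeta_star y))))"
proof -
  have cofactor: "cofactor (act pivot y) = act square_elem (zeta_star y)"
    using y by (simp add: cofactor_def act_pivot_inv_pivot act_square_elem_zeta_star)
  then have "act square_elem (zeta_star y) \<in> S_perp"
    using cofactor_S_perp[OF act_S_perp[OF pivot_alg_x y]] by simp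
  then show ?thesis
    unfolding cofactor using s
    by (simp add: factor_def act_linear zeta_act_square_elem act_S_perp delta_act pivot_inv_alg_x delta_S_perp
        act_pivot_pivot_inv add.commute)
qed

theorem semilinear_R_trivial:
  assumes y: "y \<in> S_perp" "y \<noteq> 0"
  shows "R_trivial_on (adjoin m) (\<lambda>l. jordan (\<tau> l) (\<tau> (\<tau> quad_x)))"
proof -
  obtain \<rho> where \<rho>: "R_trivial \<rho>" and conjugate: "\<And>s. s \<in> alg_x \<Longrightarrow> factor_conjugate s (\<rho> s)"
    using R_trivial_factor_conjugate[OF y] by blast
  let ?i = "jinverse square_elem"
  have i: "?i \<in> alg_x" by (rule S_jinverse[OF square_elem_alg_x])
  have "cnorm ?i \<noteq> 0" "cnorm pivot \<noteq> 0"
    using jinverse_nonzero[OF square_elem_nonzero] pivot_nonzero anisotropic by blast+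
  then have path: "R_trivial (\<lambda>x. U_op pivot (\<rho> (U_op ?i x)))"
    by (intro R_trivial_comp[OF R_trivial_comp[OF R_trivial_U_op \<rho>] R_trivial_U_op])
  show ?thesis
  proof (rule R_trivial_onI[OF path], rule act_inj[OF _ _ y])
    fix l assume l: "l \<in> adjoin m"
    let ?s = "U_op ?i l" and ?z = "zeta_star y"
    note zeta_star_y = zeta_star_S_perp[OF y(1)]
    have s: "?s \<in> alg_x" by (intro S_U_op i alg_x_adjoin l)
    have \<rho>_s: "\<rho> ?s \<in> alg_x" and act_\<rho>_s: "act (\<rho> ?s) u = factor (act ?s (cofactor u))" if "u \<in> S_perp" for u
      using conjugate[OF s] that by (simp_all add: factor_conjugate_def)
    show "U_op pivot (\<rho> ?s) \<in> alg_x" by (intro S_U_op pivot_alg_x \<rho>_s[OF y(1)])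
    show "jordan (\<tau> l) (\<tau> (\<tau> quad_x)) \<in> alg_x" by (intro alg_x_adjoin adjoin_jordan tau_adjoin l quad_x_adjoin)
    have "act square_elem (act ?s (act square_elem ?z))
        = act square_elem (act ?i (act l (act ?i (act square_elem ?z))))"
      by (simp only: act_U_op[OF i alg_x_adjoin[OF l] act_S_perp[OF square_elem_alg_x zeta_star_y]])
    also have "\<dots> = act l ?z"
      by (simp only: act_jinverse(1)[OF square_elem_alg_x square_elem_nonzero zeta_star_y]
          act_jinverse(2)[OF square_elem_alg_x square_elem_nonzero act_adjoin_S_perp[OF l zeta_star_y]])
    finally have unwind: "act square_elem (act ?s (act square_elem ?z)) = act l ?z" .
    have "act (U_op pivot (\<rho> ?s)) y = act pivot (factor (act ?s (cofactor (act pivot y))))"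
      by (simp only: act_U_op[OF pivot_alg_x \<rho>_s[OF y(1)] y(1)] act_\<rho>_s[OF act_S_perp[OF pivot_alg_x y(1)]])
    also have "\<dots> = zeta (act l ?z)" by (simp only: factor_act_pivot[OF s y(1)] unwind)
    also have "\<dots> = act (jordan (\<tau> l) (\<tau> (\<tau> quad_x))) y" by (rule zeta_act_zeta_star(1)[OF l y(1)])
    finally show "act (U_op pivot (\<rho> ?s)) y = act (jordan (\<tau> l) (\<tau> (\<tau> quad_x))) y" .
  qed
qed

end

section \<open>Similarities stabilising a cubic subfield\<close>

lemma (in division_cubic) subalgebra_adjoin: "subalgebra cr T e (adjoin m)"
  by unfold_locales (simp_all add: subspace_adjoin adjoin_unit adjoin_cross)

lemma (in division_cubic) S_perp_adjoin: "subalgebra.S_perp T (adjoin m) = perp m"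
proof -
  interpret subalgebra cr T e "adjoin m" by (rule subalgebra_adjoin)
  show ?thesis using S_perp_subset_perp[OF adjoin_self] trace_perp_adjoin by (auto simp: S_perp_def)
qed

lemma (in division_cubic) adjoin_nondegenerate:
  "x \<in> adjoin m \<Longrightarrow> (\<And>l. l \<in> adjoin m \<Longrightarrow> T x l = 0) \<Longrightarrow> x = 0"
  using adjoin_perp_disjoint perpI by blast

lemma (in division_cubic) perp_if_trace_cross_zero:
  assumes zero: "\<And>k l. k \<in> adjoin m \<Longrightarrow> l \<in> adjoin m \<Longrightarrow> T x (k \<bowtie> l) = 0"
  shows "x \<in> perp m"
proof (rule perpI)
  fix l assume l: "l \<in> adjoin m"
  have "2 * T x e = 0" using zero[OF adjoin_unit adjoin_unit] by (simp add: cross_self bilinear_simps)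
  then have "T x e = 0" using two_nonzero by simp
  then show "T x l = 0" using zero[OF adjoin_unit l] by (simp add: cross_unit_left bilinear_simps)
qed

context cubic_field
begin

lemma anisotropic_perp_exists: assumes "CARD('n) > 3" shows "\<exists>x\<in>perp m. form m x x \<noteq> 0"
proof -
  interpret subalgebra cr T e "adjoin m" by (rule subalgebra_adjoin)
  show ?thesis
    using S_perp_nonzero_exists S_perp_anisotropic[of _ m] assms by (auto simp: dim_adjoin S_perp_adjoin)
qed

lemma R_trivial_on_jordan_mult:
  assumes "h \<in> adjoin m" "k \<in> adjoin m"
    and "R_trivial_on (adjoin m) (jordan h)" "R_trivial_on (adjoin m) (jordan k)"
  shows "R_trivial_on (adjoin m) (jordan (jordan h k))"
  by (rule R_trivial_on_cong[OF R_trivial_on_comp[OF assms(4,3)]]) (simp_all add: assms(1,2) adjoin_jordan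
      jordan_assoc)

lemma R_trivial_on_jordan_square:
  assumes k: "k \<in> adjoin m" "k \<noteq> 0" shows "R_trivial_on (adjoin m) (jordan (jordan k k))"
proof (rule R_trivial_onI[OF R_trivial_U_op])
  show "cnorm k \<noteq> 0" using k anisotropic by blast
qed (simp add: U_op_adjoin k jordan_assoc)

lemma R_trivial_on_jordan_scalar: "c \<noteq> 0 \<Longrightarrow> R_trivial_on (adjoin m) (jordan (c *s e))"
  by (rule R_trivial_onI[OF R_trivial_scale[of c]]) (simp_all add: jordan_linear_left jordan_unit)

text \<open>The element \<open>h - 1\<close> is the ratio \<open>q(w) / q(x)\<close>, so the similarity curve for \<open>x + t w\<close> ends in multiplication by \<open>h\<close>.\<close>
lemma R_trivial_on_jordan_orthogonal:
  assumes h: "h \<in> adjoin m" "h \<noteq> 0" and x: "x \<in> perp m" "form m x x \<noteq> 0" and w: "w \<in> perp m" "form m x w = 0"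
    and sum: "form m x x + form m w w = jordan h (form m x x)"
  shows "R_trivial_on (adjoin m) (jordan h)"
proof (cases "h - e \<in> scalars")
  case True
  then obtain c where "h - e = c *s e" by (auto simp: scalars_def)
  then have scalar: "h = (c + 1) *s e" by (simp add: vec_eq_iff algebra_simps)
  then have "c + 1 \<noteq> 0" using h(2) by (metis vec.scale_zero_left)
  then show ?thesis unfolding scalar by (rule R_trivial_on_jordan_scalar)
next
  case False
  let ?m = "h - e"
  interpret m': cubic_field cr T e ?m by unfold_locales (rule False)
  have adjoin: "adjoin ?m = adjoin m" by (intro adjoin_eq False adjoin_diff h adjoin_unit)
  have perp: "perp ?m = perp m" by (rule perp_eq[OF adjoin])
  have proj: "proj ?m = proj m" by (rule ext) (simp add: proj_def adjoin perp)
  have ratio: "jordan ?m (form m x x) = form m w w"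
    using sum jordan_linear_left(1)[of ?m e "form m x x"] by (simp add: jordan_unit algebra_simps)
  obtain p q r where "split_field cr T e ?m p q r" by (rule m'.split_fieldE)
  then interpret split_field cr T e ?m p q r .
  interpret reflection_data cr T e ?m p q r x w
    by unfold_locales (use x w ratio perp proj in auto)
  show ?thesis
  proof (rule R_trivial_onI[OF R_trivial_sim_curve])
    fix l assume "l \<in> adjoin m"
    then show "sim_curve 1 l = jordan h l" using sim_curve_adjoin[of l 1] adjoin by (simp add: multiplier_def)
  qed
qed

definition form_ratio :: "'a ^ 'n \<Rightarrow> 'a ^ 'n \<Rightarrow> 'a ^ 'n" where
  "form_ratio y x = jordan (jinverse (form m x x)) (form m y y)"

lemma form_ratio_adjoin: "form_ratio y x \<in> adjoin m"
  unfolding form_ratio_def by (intro adjoin_jordan jinverse_adjoin proj_adjoin)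

lemma form_ratio_mult:
  assumes "form m y y \<noteq> 0" shows "jordan (form_ratio z y) (form_ratio y x) = form_ratio z x"
proof -
  have "jordan (form_ratio z y) (form_ratio y x)
      = jordan (form m y y) (jordan (jinverse (form m y y)) (jordan (jinverse (form m x x)) (form m z z)))"
    by (simp add: form_ratio_def adjoin_jordan_ac adjoin_jordan jinverse_adjoin proj_adjoin)
  then show ?thesis
    using assms by (simp add: form_ratio_def jordan_jinverse_right adjoin_jordan jinverse_adjoin proj_adjoin)
qed

lemma R_trivial_on_form_ratio_nonorthogonal:
  assumes x: "x \<in> perp m" "form m x x \<noteq> 0" and y: "y \<in> perp m" "form m y y \<noteq> 0" and nonzero: "form m x y \<noteq> 0"
  shows "R_trivial_on (adjoin m) (jordan (form_ratio y x))"
proof -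
  define k where "k = jordan (jinverse (form m x y)) (form m x x)"
  have k: "k \<in> adjoin m" "k \<noteq> 0"
    unfolding k_def by (intro adjoin_jordan jinverse_adjoin proj_adjoin jordan_nonzero jinverse_nonzero x nonzero)+
  have projection: "jordan k (form m x y) = form m x x"
    using jordan_jinverse_right[OF proj_adjoin nonzero proj_adjoin] by (simp add: k_def jordan_commute)
  let ?z = "act k y" and ?h = "form_ratio (act k y) x"
  have z: "?z \<in> perp m" by (rule act_perp[OF k(1) y(1)])
  have form_xz: "form m x ?z = form m x x" by (simp add: form_act_right k x y projection)
  have form_zz: "form m ?z ?z = jordan k (jordan k (form m y y))"
    by (simp add: form_act_right form_act_left k y z)
  then have "form m ?z ?z \<noteq> 0" using k y(2) by (simp add: jordan_nonzero adjoin_jordan proj_adjoin)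
  then have h: "?h \<noteq> 0"
    unfolding form_ratio_def by (intro jordan_nonzero jinverse_adjoin jinverse_nonzero proj_adjoin x)
  have "R_trivial_on (adjoin m) (jordan ?h)"
  proof (rule R_trivial_on_jordan_orthogonal[OF form_ratio_adjoin h x])
    show "?z - x \<in> perp m" by (intro perp_diff z x)
    show "form m x (?z - x) = 0" by (simp add: bilinear_simps proj_diff form_xz)
    have "jordan ?h (form m x x) = form m ?z ?z"
      unfolding form_ratio_def
      by (subst jordan_commute) (rule jordan_jinverse_right[OF proj_adjoin x(2) proj_adjoin])
    moreover have "form m (?z - x) (?z - x) = form m ?z ?z - form m x x"
      by (simp only: cross_diff_left cross_diff_right proj_diff form_xz cross_commute[of ?z x]) simp
    ultimately show "form m x x + form m (?z - x) (?z - x) = jordan ?h (form m x x)" by simp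
  qed
  then have "R_trivial_on (adjoin m) (jordan (jordan (jordan (jinverse k) (jinverse k)) ?h))"
    by (intro R_trivial_on_jordan_mult R_trivial_on_jordan_square adjoin_jordan jinverse_adjoin jinverse_nonzero k
        form_ratio_adjoin)
  moreover have "jordan (jordan (jinverse k) (jinverse k)) ?h = form_ratio y x"
  proof -
    have "jordan (jordan (jinverse k) (jinverse k)) ?h
        = jordan (jinverse k) (jordan k (jordan (jinverse k) (jordan k (form_ratio y x))))"
      unfolding form_ratio_def form_zz
      by (simp add: adjoin_jordan_ac adjoin_jordan jinverse_adjoin k proj_adjoin)
    then show ?thesis using k by (simp add: jordan_jinverse_left form_ratio_adjoin adjoin_jordan)
  qed
  ultimately show ?thesis by simp
qed

text \<open>If \<open>x\<close> and \<open>y\<close> are orthogonal, one of \<open>x + y\<close> and \<open>x + 2 y\<close> is anisotropic, and it is orthogonal to neither.\<close>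
lemma R_trivial_on_form_ratio:
  assumes x: "x \<in> perp m" "form m x x \<noteq> 0" and y: "y \<in> perp m" "form m y y \<noteq> 0"
  shows "R_trivial_on (adjoin m) (jordan (form_ratio y x))"
proof (cases "form m x y = 0")
  case False
  then show ?thesis using R_trivial_on_form_ratio_nonorthogonal assms by blast
next
  case orthogonal: True
  have form_sum: "form m (x + k *s y) (x + k *s y) = form m x x + k^2 *s form m y y" for k
  proof -
    have "(x + k *s y) \<bowtie> (x + k *s y) = x \<bowtie> x + (2 * k) *s (x \<bowtie> y) + k^2 *s (y \<bowtie> y)"
      by (simp add: bilinear_simps cross_commute[of y x] vec_eq_iff algebra_simps power2_eq_square)
    then show ?thesis by (simp add: proj_add proj_scale orthogonal)
  qed
  have "\<exists>k. k \<noteq> 0 \<and> form m x x + k^2 *s form m y y \<noteq> 0"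
  proof (rule ccontr)
    assume "\<not> ?thesis"
    then have "form m x x + 1^2 *s form m y y = 0" "form m x x + 2^2 *s form m y y = 0"
      using two_nonzero by (metis one_neq_zero)+
    then have "3 *s form m y y = 0" by (simp add: vec_eq_iff add_eq_0_iff)
    then show False using three_nonzero y(2) by simp
  qed
  then obtain k where k: "k \<noteq> 0" "form m x x + k^2 *s form m y y \<noteq> 0" by blast
  let ?z = "x + k *s y"
  have z: "?z \<in> perp m" "form m ?z ?z \<noteq> 0" using x y k by (simp_all add: perp_add perp_scale form_sum)
  have "form m x ?z \<noteq> 0" "form m ?z y \<noteq> 0"
    using orthogonal k(1) x y by (simp_all add: bilinear_simps proj_add proj_scale)
  then have "R_trivial_on (adjoin m) (jordan (jordan (form_ratio y ?z) (form_ratio ?z x)))"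
    by (intro R_trivial_on_jordan_mult R_trivial_on_form_ratio_nonorthogonal form_ratio_adjoin x y z)
  then show ?thesis by (simp add: form_ratio_mult z)
qed

end

context cubic_field
begin

context
  fixes g :: "'a ^ 'n \<Rightarrow> 'a ^ 'n" and \<nu> :: 'a and u :: "'a ^ 'n"
  assumes g: "similarity \<nu> g" and u: "u \<in> adjoin m" and g_adjoin: "\<And>l. l \<in> adjoin m \<Longrightarrow> g l = jordan u l"
begin

lemma cnorm_multiplication: "cnorm u = \<nu>"
  using similarityD(5)[OF g, of e] g_adjoin[OF adjoin_unit] by (simp add: jordan_commute[of u] jordan_unit)

lemma multiplication_nonzero: "u \<noteq> 0"
  using cnorm_multiplication similarityD(4)[OF g] by auto

lemma trace_multiplication: "T (g x \<bowtie> g y) (g z) = \<nu> * T (x \<bowtie> y) z"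
  by (rule similarity_polarized(2)[where W = UNIV]) (simp_all add: similarityD[OF g])

lemma multiplication_perp: assumes x: "x \<in> perp m" shows "g x \<in> perp m"
proof (rule perp_if_trace_cross_zero)
  have surj: "g (jordan (jinverse u) l) = l" if "l \<in> adjoin m" for l
    using that by (simp add: g_adjoin adjoin_jordan jinverse_adjoin u multiplication_nonzero jordan_jinverse_right)
  fix k l assume kl: "k \<in> adjoin m" "l \<in> adjoin m"
  let ?k = "jordan (jinverse u) k" and ?l = "jordan (jinverse u) l"
  have "T x (?k \<bowtie> ?l) = 0"
    by (intro trace_perp_adjoin[OF x] adjoin_cross adjoin_jordan jinverse_adjoin u kl)
  then have "T (g ?k \<bowtie> g ?l) (g x) = 0" unfolding trace_multiplication by (simp add: trace_commute[of _ x])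
  then show "T (g x) (k \<bowtie> l) = 0" by (simp add: surj kl trace_commute)
qed

lemma form_multiplication: "jordan u (form m (g x) (g x)) = \<nu> *s form m x x"
proof -
  have "jordan u (form m (g x) (g x)) - \<nu> *s form m x x = 0"
  proof (rule adjoin_nondegenerate)
    show "jordan u (form m (g x) (g x)) - \<nu> *s form m x x \<in> adjoin m"
      by (intro adjoin_diff adjoin_jordan adjoin_scale u proj_adjoin)
    fix l assume l: "l \<in> adjoin m"
    have "T (jordan u (form m (g x) (g x))) l = T (g x \<bowtie> g x) (g l)"
      by (simp add: trace_jordan trace_proj adjoin_jordan u l g_adjoin)
    also have "\<dots> = \<nu> * T (form m x x) l" by (simp add: trace_multiplication trace_proj l)
    finally show "T (jordan u (form m (g x) (g x)) - \<nu> *s form m x x) l = 0" by (simp add: bilinear_simps)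
  qed
  then show ?thesis by simp
qed

lemma R_trivial_on_multiplication:
  assumes "CARD('n) > 3" shows "R_trivial_on (adjoin m) g"
proof -
  obtain x where x: "x \<in> perp m" "form m x x \<noteq> 0" using anisotropic_perp_exists[OF assms] by blast
  have \<nu>: "\<nu> \<noteq> 0" by (rule similarityD(4)[OF g])
  have gx: "form m (g x) (g x) \<noteq> 0" using form_multiplication[of x] x(2) \<nu> by (auto simp: jordan_zero)
  let ?h = "form_ratio (g x) x"
  have "jordan u ?h = jordan (jinverse (form m x x)) (jordan u (form m (g x) (g x)))"
    unfolding form_ratio_def by (rule jordan_left_commute[OF u jinverse_adjoin[OF proj_adjoin] proj_adjoin])
  also have "\<dots> = \<nu> *s e"
    by (simp add: form_multiplication jordan_linear_right jordan_jinverse[OF proj_adjoin x(2)])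
  finally have h: "jordan u ?h = \<nu> *s e" .
  have "R_trivial_on (adjoin m) (jordan (jordan (inverse \<nu> *s e) (jordan (jordan u u) ?h)))"
    using \<nu> by (intro R_trivial_on_jordan_mult R_trivial_on_jordan_scalar R_trivial_on_jordan_square
        R_trivial_on_form_ratio adjoin_jordan adjoin_scale adjoin_unit form_ratio_adjoin u multiplication_nonzero
        x multiplication_perp gx) simp
  moreover have "jordan (inverse \<nu> *s e) (jordan (jordan u u) ?h) = u"
    using \<nu> by (simp add: jordan_assoc u form_ratio_adjoin h jordan_linear_left jordan_linear_right
        jordan_unit jordan_commute[of u e])
  ultimately show ?thesis by (intro R_trivial_on_cong[of "adjoin m" "jordan u" g]) (simp_all add: g_adjoin)
qed

end

end

locale adjoin_automorphism = cubic_field cr T e m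
  for cr :: "'a::field ^ 'n \<Rightarrow> 'a ^ 'n \<Rightarrow> 'a ^ 'n"  (infixl "\<bowtie>" 75)
    and T :: "'a ^ 'n \<Rightarrow> 'a ^ 'n \<Rightarrow> 'a" and e m :: "'a ^ 'n" +
  fixes \<sigma> :: "'a ^ 'n \<Rightarrow> 'a ^ 'n"
  assumes linear_sigma: "Vector_Spaces.linear (*s) (*s) \<sigma>" and sigma_image: "\<sigma> ` adjoin m = adjoin m"
    and sigma_unit: "\<sigma> e = e" and cnorm_sigma: "l \<in> adjoin m \<Longrightarrow> cnorm (\<sigma> l) = cnorm l"
begin

lemmas sigma_add = vec.linear_add[OF linear_sigma]
lemmas sigma_scale = vec.linear_scale[OF linear_sigma]
lemmas sigma_diff = vec.linear_diff[OF linear_sigma]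

lemma sigma_adjoin: "l \<in> adjoin m \<Longrightarrow> \<sigma> l \<in> adjoin m"
  using sigma_image by blast

lemma sigma_nonzero: "l \<in> adjoin m \<Longrightarrow> l \<noteq> 0 \<Longrightarrow> \<sigma> l \<noteq> 0"
  using cnorm_sigma[of l] anisotropic[of l] by auto

lemma sigma_polarized:
  assumes "l \<in> adjoin m" "k \<in> adjoin m" "j \<in> adjoin m"
  shows "T (sharp (\<sigma> l)) (\<sigma> k) = T (sharp l) k" "T (\<sigma> l \<bowtie> \<sigma> k) (\<sigma> j) = T (l \<bowtie> k) j"
  using similarity_polarized[OF linear_sigma _ subspace_adjoin assms, of 1] cnorm_sigma by auto

lemma trace_sigma_unit: "l \<in> adjoin m \<Longrightarrow> T (\<sigma> l) e = T l e"
  using sigma_polarized(1)[OF adjoin_unit _ adjoin_unit, of l] by (simp add: sigma_unit trace_commute)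

lemma trace_sigma: "l \<in> adjoin m \<Longrightarrow> k \<in> adjoin m \<Longrightarrow> T (\<sigma> l) (\<sigma> k) = T l k"
  using sigma_polarized(2)[of l k e] by (simp add: sigma_unit trace_cross_unit trace_sigma_unit adjoin_unit)

lemma sigma_cross: assumes l: "l \<in> adjoin m" and k: "k \<in> adjoin m" shows "\<sigma> (l \<bowtie> k) = \<sigma> l \<bowtie> \<sigma> k"
proof -
  have "\<sigma> (l \<bowtie> k) - \<sigma> l \<bowtie> \<sigma> k = 0"
  proof (rule adjoin_nondegenerate)
    show "\<sigma> (l \<bowtie> k) - \<sigma> l \<bowtie> \<sigma> k \<in> adjoin m" by (intro adjoin_diff sigma_adjoin adjoin_cross l k)
    fix j assume "j \<in> adjoin m"
    then obtain i where i: "i \<in> adjoin m" "j = \<sigma> i" using sigma_image by blast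
    show "T (\<sigma> (l \<bowtie> k) - \<sigma> l \<bowtie> \<sigma> k) j = 0"
      using l k i by (simp add: trace_diff_left trace_sigma adjoin_cross sigma_polarized)
  qed
  then show ?thesis by simp
qed

lemma sigma_sharp: "l \<in> adjoin m \<Longrightarrow> \<sigma> (sharp l) = sharp (\<sigma> l)"
  by (simp add: sharp_def sigma_scale sigma_cross)

lemma sigma_jordan: "l \<in> adjoin m \<Longrightarrow> k \<in> adjoin m \<Longrightarrow> \<sigma> (jordan l k) = jordan (\<sigma> l) (\<sigma> k)"
  using trace_sigma_unit[OF adjoin_cross[of l m k]]
  by (simp add: jordan_def sigma_add sigma_diff sigma_scale sigma_cross sigma_unit trace_sigma_unit)

end

locale split_automorphism = split_field cr T e m p q r + adjoin_automorphism cr T e m \<sigma>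
  for cr :: "'a::field ^ 'n \<Rightarrow> 'a ^ 'n \<Rightarrow> 'a ^ 'n"  (infixl "\<bowtie>" 75)
    and T :: "'a ^ 'n \<Rightarrow> 'a ^ 'n \<Rightarrow> 'a" and e m :: "'a ^ 'n" and p q r :: "'a alg_closure"
    and \<sigma> :: "'a ^ 'n \<Rightarrow> 'a ^ 'n"

sublocale split_automorphism \<subseteq> rot: split_automorphism cr T e m q r p \<sigma> ..

context split_automorphism
begin

lemma characteristic_roots_coords:
  "l \<in> adjoin m \<Longrightarrow> E.characteristic_roots (embed l) (coord a l) (coord b l) (coord c l)"
  unfolding E.characteristic_roots_def
  by (simp add: extend_form_embed to_ac_trace_unit adjoin_sharp coord_sharp rot.coord_sharp rot.rot.coord_sharp
      cnorm_embed to_ac_cnorm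
      flip: embed_sharp)

lemma sigma_generator_not_scalar: "\<sigma> m \<notin> scalars"
proof
  assume "\<sigma> m \<in> scalars"
  then obtain k where "\<sigma> (m - k *s e) = 0" by (auto simp: scalars_def sigma_diff sigma_scale sigma_unit)
  then have "m = k *s e" using sigma_nonzero[of "m - k *s e"]
    by (auto intro: adjoin_diff adjoin_scale adjoin_self adjoin_unit)
  then show False using not_scalar scalarsI by metis
qed

lemma coord_sigma_generator_cases: "coord a (\<sigma> m) = p \<or> coord a (\<sigma> m) = q \<or> coord a (\<sigma> m) = r"
proof -
  let ?x = "coord a (\<sigma> m)" and ?y = "coord b (\<sigma> m)" and ?z = "coord c (\<sigma> m)"
  have roots_eq: "?x + ?y + ?z = p + q + r" "?x * ?y + ?y * ?z + ?z * ?x = p * q + q * r + r * p"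
    "?x * ?y * ?z = p * q * r"
    using characteristic_roots_coords[OF sigma_adjoin[OF adjoin_self]] roots
      trace_sigma_unit[OF adjoin_self] trace_sigma_unit[OF adjoin_sharp_self]
    by (simp_all add: E.characteristic_roots_def extend_form_embed cnorm_embed cnorm_sigma adjoin_self sigma_sharp
        flip: embed_sharp)
  have "(?x - p) * (?x - q) * (?x - r) = ?x^3 - (p + q + r) * ?x^2 + (p * q + q * r + r * p) * ?x - p * q * r"
    by (simp add: algebra_simps power2_eq_square power3_eq_cube)
  also have "\<dots> = 0"
    unfolding roots_eq[symmetric] by (simp add: algebra_simps power2_eq_square power3_eq_cube)
  finally show ?thesis by auto
qed

lemma coord_sigma_generator_distinct: "coord a (\<sigma> m) \<noteq> coord b (\<sigma> m)"
proof -
  interpret \<sigma>: split_field cr T e "\<sigma> m" "coord a (\<sigma> m)" "coord b (\<sigma> m)" "coord c (\<sigma> m)"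
    by unfold_locales (rule sigma_generator_not_scalar, rule
        characteristic_roots_coords[OF sigma_adjoin[OF adjoin_self]])
  show ?thesis by (rule \<sigma>.roots_distinct)
qed

end
context division_cubic
begin

lemma similarity_bij: assumes g: "similarity \<nu> g" shows "bij g"
proof -
  note linear = similarityD(1)[OF g]
  have "x = y" if "g x = g y" for x y
  proof -
    have "\<nu> * cnorm (x - y) = 0"
      using that similarityD(5)[OF g, of "x - y"] by (simp add: vec.linear_diff[OF linear])
    then show ?thesis using similarityD(4)[OF g] anisotropic[of "x - y"] by simp
  qed
  then have "inj g" by (rule injI)
  then show ?thesis using vec.linear_inj_imp_surj[OF linear] by (simp add: bij_def)
qed

lemma similarity_inv: assumes g: "similarity \<nu> g" shows "similarity (inverse \<nu>) (inv_into UNIV g)"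
proof (rule similarityI)
  have g_inv: "g (inv_into UNIV g x) = x" and inv_g: "inv_into UNIV g (g x) = x" for x
    using similarity_bij[OF g] by (simp_all add: bij_is_surj surj_f_inv_f bij_is_inj)
  show "inv_into UNIV g (x + y) = inv_into UNIV g x + inv_into UNIV g y" for x y
    using inv_g[of "inv_into UNIV g x + inv_into UNIV g y"] by (simp add: similarityD(2)[OF g] g_inv)
  show "inv_into UNIV g (k *s x) = k *s inv_into UNIV g x" for k x
    using inv_g[of "k *s inv_into UNIV g x"] by (simp add: similarityD(3)[OF g] g_inv)
  show "inverse \<nu> \<noteq> 0" using similarityD(4)[OF g] by simp
  show "cnorm (inv_into UNIV g x) = inverse \<nu> * cnorm x" for x
    using similarityD(5)[OF g, of "inv_into UNIV g x"] similarityD(4)[OF g] by (simp add: g_inv)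
qed

lemma adjoin_squareE:
  assumes "l \<in> adjoin m"
  obtains \<alpha> \<beta> \<gamma> where "l = \<alpha> *s e + \<beta> *s m + \<gamma> *s jordan m m"
proof -
  obtain \<alpha> \<beta> \<gamma> where "l = \<alpha> *s e + \<beta> *s m + \<gamma> *s sharp m" using assms by (auto simp: adjoin_altdef)
  then have "l = (\<alpha> + \<gamma> * T (sharp m) e) *s e + (\<beta> - \<gamma> * T m e) *s m + \<gamma> *s jordan m m"
    by (simp add: jordan_self vec_eq_iff algebra_simps)
  then show thesis by (rule that)
qed

end

lemma (in split_field) R_trivial_on_cyclic:
  assumes big: "CARD('n) > 9"
    and \<tau>: "\<And>l. l \<in> adjoin m \<Longrightarrow> \<tau> l \<in> adjoin m" "\<And>l. l \<in> adjoin m \<Longrightarrow> coord a (\<tau> l) = coord c l"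
      "\<And>l. l \<in> adjoin m \<Longrightarrow> coord b (\<tau> l) = coord a l" "\<And>l. l \<in> adjoin m \<Longrightarrow> coord c (\<tau> l) = coord b l"
  obtains k where "k \<in> adjoin m" "k \<noteq> 0" "R_trivial_on (adjoin m) (\<lambda>l. jordan k (\<tau> l))"
proof -
  obtain x where x: "x \<in> perp m" "form m x x \<noteq> 0" using anisotropic_perp_exists big by auto
  interpret cyclic_element cr T e m p q r x \<tau>
    by unfold_locales (simp_all add: x \<tau>)
  obtain y where y: "y \<in> S_perp" "y \<noteq> 0" using S_perp_nonzero_exists dim_alg_x big by auto
  show thesis
  proof (rule that)
    show "\<tau> (\<tau> quad_x) \<in> adjoin m" by (intro tau_adjoin quad_x_adjoin)
    show "\<tau> (\<tau> quad_x) \<noteq> 0" by (intro tau_nonzero tau_adjoin quad_x_adjoin quad_x_nonzero)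
    show "R_trivial_on (adjoin m) (\<lambda>l. jordan (\<tau> (\<tau> quad_x)) (\<tau> l))"
      using semilinear_R_trivial[OF y] by (simp only: jordan_commute)
  qed
qed

context split_automorphism
begin

lemma coord_sigma:
  assumes l: "l \<in> adjoin m"
  shows "coord a (\<sigma> m) = p \<Longrightarrow> coord a (\<sigma> l) = coord a l"
    and "coord a (\<sigma> m) = q \<Longrightarrow> coord a (\<sigma> l) = coord b l"
    and "coord a (\<sigma> m) = r \<Longrightarrow> coord a (\<sigma> l) = coord c l"
proof -
  obtain \<alpha> \<beta> \<gamma> where expansion: "l = \<alpha> *s e + \<beta> *s m + \<gamma> *s jordan m m" using l by (rule adjoin_squareE)
  note coord_rules = sigma_add sigma_scale sigma_unit sigma_jordan sigma_adjoin adjoin_self coord_linear coord_unit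
    rot.coord_unit rot.rot.coord_unit coord_jordan rot.coord_jordan rot.rot.coord_jordan coord_generator
    rot.coord_generator rot.rot.coord_generator
  show "coord a (\<sigma> m) = p \<Longrightarrow> coord a (\<sigma> l) = coord a l" unfolding expansion by (simp add: coord_rules)
  show "coord a (\<sigma> m) = q \<Longrightarrow> coord a (\<sigma> l) = coord b l" unfolding expansion by (simp add: coord_rules)
  show "coord a (\<sigma> m) = r \<Longrightarrow> coord a (\<sigma> l) = coord c l" unfolding expansion by (simp add: coord_rules)
qed

lemma sigma_identity: "coord a (\<sigma> m) = p \<Longrightarrow> l \<in> adjoin m \<Longrightarrow> \<sigma> l = l"
  by (rule coord_eqI) (simp_all add: sigma_adjoin coord_sigma)

end

context split_automorphism
begin

lemma sigma_cases:
  obtains (identity) "\<And>l. l \<in> adjoin m \<Longrightarrow> \<sigma> l = l"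
  | (cyclic) "\<And>l. l \<in> adjoin m \<Longrightarrow> coord a (\<sigma> l) = coord c l"
      "\<And>l. l \<in> adjoin m \<Longrightarrow> coord b (\<sigma> l) = coord a l" "\<And>l. l \<in> adjoin m \<Longrightarrow> coord c (\<sigma> l) = coord b l"
  | (anticyclic) "\<And>l. l \<in> adjoin m \<Longrightarrow> coord a (\<sigma> l) = coord b l"
      "\<And>l. l \<in> adjoin m \<Longrightarrow> coord b (\<sigma> l) = coord c l" "\<And>l. l \<in> adjoin m \<Longrightarrow> coord c (\<sigma> l) = coord a l"
proof -
  consider "coord a (\<sigma> m) = p \<or> coord b (\<sigma> m) = q \<or> coord c (\<sigma> m) = r"
    | "coord a (\<sigma> m) = r" "coord b (\<sigma> m) = p" "coord c (\<sigma> m) = q"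
    | "coord a (\<sigma> m) = q" "coord b (\<sigma> m) = r" "coord c (\<sigma> m) = p"
    using coord_sigma_generator_cases rot.coord_sigma_generator_cases rot.rot.coord_sigma_generator_cases
      coord_sigma_generator_distinct rot.coord_sigma_generator_distinct rot.rot.coord_sigma_generator_distinct
    by metis
  then show thesis
  proof cases
    case 1
    then show thesis using sigma_identity rot.sigma_identity rot.rot.sigma_identity identity by blast
  next
    case 2
    then show thesis using coord_sigma rot.coord_sigma rot.rot.coord_sigma by (intro cyclic) auto
  next
    case 3
    then show thesis using coord_sigma rot.coord_sigma rot.rot.coord_sigma by (intro anticyclic) auto
  qed
qed

lemma R_trivial_on_sigma_multiple:
  assumes big: "CARD('n) > 9"
  obtains k where "k \<in> adjoin m" "k \<noteq> 0" "R_trivial_on (adjoin m) (\<lambda>l. jordan k (\<sigma> l))"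
proof (cases rule: sigma_cases)
  case identity
  show thesis
  proof (rule that[OF adjoin_unit unit_nonzero], rule R_trivial_onI[OF R_trivial_id])
    show "l = jordan e (\<sigma> l)" if "l \<in> adjoin m" for l by (simp add: identity that jordan_unit)
  qed
next
  case cyclic
  show thesis by (rule R_trivial_on_cyclic[OF big, of \<sigma>]) (simp_all add: sigma_adjoin cyclic that)
next
  case anticyclic
  have sigma_cubed: "\<sigma> (\<sigma> (\<sigma> l)) = l" if "l \<in> adjoin m" for l
    by (rule coord_eqI) (simp_all add: sigma_adjoin anticyclic that)
  obtain k where k: "k \<in> adjoin m" "k \<noteq> 0" and path: "R_trivial_on (adjoin m) (\<lambda>l. jordan k (\<sigma> (\<sigma> l)))"
    using R_trivial_on_cyclic[OF big, of "\<lambda>l. \<sigma> (\<sigma> l)"] by (auto simp: sigma_adjoin anticyclic)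
  let ?k = "jordan k (\<sigma> (\<sigma> k))"
  show thesis
  proof (rule that)
    show "?k \<in> adjoin m" "?k \<noteq> 0" using k
      by (simp_all add: adjoin_jordan sigma_adjoin jordan_nonzero sigma_nonzero)
    have "R_trivial_on (adjoin m) (\<lambda>l. jordan k (\<sigma> (\<sigma> (jordan k (\<sigma> (\<sigma> l))))))"
      by (rule R_trivial_on_comp[OF path path]) (simp add: adjoin_jordan k sigma_adjoin)
    then show "R_trivial_on (adjoin m) (\<lambda>l. jordan ?k (\<sigma> l))"
      by (rule R_trivial_on_cong) (simp add: sigma_jordan sigma_adjoin adjoin_jordan k sigma_cubed jordan_assoc)
  qed
qed

end

lemma (in adjoin_automorphism) R_trivial_on_similarity:
  assumes big: "CARD('n) > 9" and g: "similarity \<nu> g"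
    and u: "u \<in> adjoin m" and g_sigma: "\<And>l. l \<in> adjoin m \<Longrightarrow> g l = jordan u (\<sigma> l)"
  shows "R_trivial_on (adjoin m) g"
proof -
  obtain p q r where "split_field cr T e m p q r" by (rule split_fieldE)
  then interpret split_field cr T e m p q r .
  interpret split_automorphism cr T e m p q r \<sigma> ..
  obtain k \<rho> where k: "k \<in> adjoin m" "k \<noteq> 0" and \<rho>: "R_trivial \<rho>" "\<And>l. l \<in> adjoin m \<Longrightarrow> \<rho> l = jordan k (\<sigma> l)"
    using R_trivial_on_sigma_multiple[OF big] unfolding R_trivial_on_def by metis
  obtain \<mu> where \<mu>: "similarity \<mu> \<rho>" using R_trivial_imp_similarity[OF \<rho>(1)] by blast
  have \<rho>_inv: "\<rho> (inv_into UNIV \<rho> x) = x" and inv_\<rho>: "inv_into UNIV \<rho> (\<rho> x) = x" for x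
    using similarity_bij[OF \<mu>] by (simp_all add: bij_is_surj surj_f_inv_f bij_is_inj)
  have "jordan (jinverse k) u \<in> \<sigma> ` adjoin m" unfolding sigma_image by (intro adjoin_jordan jinverse_adjoin k u)
  then obtain u' where u': "u' \<in> adjoin m" "\<sigma> u' = jordan (jinverse k) u" by auto
  have "g l = \<rho> (jordan u' l)" if l: "l \<in> adjoin m" for l
    by (simp add: g_sigma l \<rho>(2) adjoin_jordan u' sigma_jordan sigma_adjoin u k jinverse_adjoin jordan_assoc
        jordan_jinverse_right)
  then have "inv_into UNIV \<rho> (g l) = jordan u' l" if "l \<in> adjoin m" for l using that inv_\<rho> by simp
  then have "R_trivial_on (adjoin m) (\<lambda>x. inv_into UNIV \<rho> (g x))"
    using R_trivial_on_multiplication[OF similarity_comp[OF g similarity_inv[OF \<mu>]] u'(1)] big by simp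
  then have "R_trivial_on (adjoin m) (\<lambda>x. \<rho> (inv_into UNIV \<rho> (g x)))"
    by (rule R_trivial_on_comp[OF _ R_trivial_onI[of \<rho> UNIV]]) (simp_all add: \<rho>(1))
  then show ?thesis by (simp add: \<rho>_inv)
qed

theorem (in cubic_field) similarity_R_trivial_on_adjoin:
  assumes big: "CARD('n) > 9" and g: "similarity \<nu> g" and image: "g ` adjoin m = adjoin m"
  shows "R_trivial_on (adjoin m) g"
proof -
  let ?u = "g e" and ?\<sigma> = "\<lambda>l. jordan (jinverse (g e)) (g l)"
  have u: "?u \<in> adjoin m" using image adjoin_unit by blast
  have norm_u: "cnorm ?u = \<nu>" using similarityD(5)[OF g, of e] by simp
  then have nonzero: "?u \<noteq> 0" using similarityD(4)[OF g] by auto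
  have g_adjoin: "g l \<in> adjoin m" if "l \<in> adjoin m" for l using image that by blast
  interpret adjoin_automorphism cr T e m ?\<sigma>
  proof
    show "?\<sigma> (x + y) = ?\<sigma> x + ?\<sigma> y" "?\<sigma> (k *s x) = k *s ?\<sigma> x" for x y k
      by (simp_all add: similarityD(2,3)[OF g] jordan_linear_right)
    show "?\<sigma> e = e" by (rule jordan_jinverse[OF u nonzero])
    show "cnorm (?\<sigma> l) = cnorm l" if "l \<in> adjoin m" for l
    proof -
      have "cnorm (jinverse ?u) * \<nu> = 1"
        using cnorm_jordan[OF jinverse_adjoin[OF u] u] jordan_jinverse[OF u nonzero] by (simp add: norm_u)
      then show ?thesis
        by (simp add: cnorm_jordan jinverse_adjoin u g_adjoin that similarityD(5)[OF g] flip: mult.assoc)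
    qed
    show "?\<sigma> ` adjoin m = adjoin m"
    proof (intro equalityI image_subsetI subsetI)
      show "?\<sigma> l \<in> adjoin m" if "l \<in> adjoin m" for l by (intro adjoin_jordan jinverse_adjoin u g_adjoin that)
      fix k assume k: "k \<in> adjoin m"
      then have "jordan ?u k \<in> g ` adjoin m" unfolding image by (intro adjoin_jordan u)
      then obtain l where "l \<in> adjoin m" "g l = jordan ?u k" by auto
      then show "k \<in> ?\<sigma> ` adjoin m" using jordan_jinverse_left[OF u nonzero k] by (metis image_eqI)
    qed
  qed
  show ?thesis
    by (rule R_trivial_on_similarity[OF big g u]) (simp add: jordan_jinverse_right[OF u nonzero] g_adjoin)
qed

section \<open>Albert algebras\<close>

locale symmetric_quartic =
  fixes F :: "'a::field ^ 'n \<Rightarrow> 'a ^ 'n \<Rightarrow> 'a ^ 'n \<Rightarrow> 'a ^ 'n \<Rightarrow> 'a"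
  assumes two_nonzero: "(2::'a) \<noteq> 0" and three_nonzero: "(3::'a) \<noteq> 0"
    and add1: "F (x + x') y z w = F x y z w + F x' y z w"
    and scale1: "F (k *s x) y z w = k * F x y z w"
    and commute12: "F x y z w = F y x z w" and commute23: "F x y z w = F x z y w"
      and commute34: "F x y z w = F x y w z"
begin

lemma add2: "F x (y + y') z w = F x y z w + F x y' z w" by (metis add1 commute12)
lemma add3: "F x y (z + z') w = F x y z w + F x y z' w" by (metis add2 commute23)
lemma add4: "F x y z (w + w') = F x y z w + F x y z w'" by (metis add3 commute34)
lemma scale2: "F x (k *s y) z w = k * F x y z w" by (metis scale1 commute12)
lemma scale3: "F x y (k *s z) w = k * F x y z w" by (metis scale2 commute23)
lemma scale4: "F x y z (k *s w) = k * F x y z w" by (metis scale3 commute34)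

lemmas multilinear = add1 add2 add3 add4 scale1 scale2 scale3 scale4
lemmas symmetric = commute12 commute23 commute34

lemmas six_nonzero = six_neq_zero[OF two_nonzero three_nonzero]

context
  assumes diagonal: "F x x x x = 0"
begin

lemma cube_zero: "F x x x y = 0"
proof -
  have expansion: "4 * k * F x x x y + 6 * k^2 * F x x y y + 4 * k^3 * F x y y y = 0" for k
  proof -
    have "F (x + k *s y) (x + k *s y) (x + k *s y) (x + k *s y)
        = 4 * k * F x x x y + 6 * k^2 * F x x y y + 4 * k^3 * F x y y y"
      by (simp only: multilinear) (simp add: diagonal symmetric algebra_simps power2_eq_square power3_eq_cube)
    then show ?thesis by (simp only: diagonal)
  qed
  have "(2 * 2) * 6 * F x x x y
      = (4 * 1 * F x x x y + 6 * 1^2 * F x x y y + 4 * 1^3 * F x y y y) * 6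
        - (4 * (-1) * F x x x y + 6 * (-1)^2 * F x x y y + 4 * (-1)^3 * F x y y y) * 2
        - (4 * 2 * F x x x y + 6 * 2^2 * F x x y y + 4 * 2^3 * F x y y y)"
    by (simp add: algebra_simps)
  also have "\<dots> = 0" unfolding expansion by simp
  finally show ?thesis using two_nonzero six_nonzero by (metis mult_eq_0_iff)
qed

lemma square_zero: "F x z z y = 0"
proof -
  have expansion: "3 * F x x z y + 3 * k * F x z z y = 0" if "k \<noteq> 0" for k
  proof -
    have "F (x + k *s z) (x + k *s z) (x + k *s z) y = k * (3 * F x x z y + 3 * k * F x z z y)"
      by (simp only: multilinear) (simp add: cube_zero commute12 commute23 algebra_simps)
    then show ?thesis using that by (simp add: cube_zero)
  qed
  have "6 * F x z z y = (3 * F x x z y + 3 * 1 * F x z z y) - (3 * F x x z y + 3 * (-1) * F x z z y)" by simp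
  also have "\<dots> = 0 - 0" by (intro arg_cong2[of _ _ _ _ "(-)"] expansion) simp_all
  finally show ?thesis using six_nonzero by simp
qed

lemma quartic_zero: "F x y z w = 0"
proof -
  have "2 * F x y z w = F x (y + z) (y + z) w - F x y y w - F x z z w"
    unfolding add2 add3 commute23[of x z y w] by simp
  then show ?thesis using two_nonzero by (simp add: square_zero)
qed

end

end

lemma lin_eqI:
  fixes f :: "'k::field ^ 27 \<Rightarrow> 'k"
  assumes infinite_field: "infinite (UNIV :: 'k set)"
    and eq: "\<And>t. f (x + t *s y) = f x + t * b + t^2 * c + t^3 * d"
  shows "lin f x y = b"
  unfolding lin_def
proof (rule the_equality)
  show "\<exists>c d. \<forall>t. f (x + t *s y) = f x + t * b + t^2 * c + t^3 * d" using eq by blast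
  fix b' assume "\<exists>c d. \<forall>t. f (x + t *s y) = f x + t * b' + t^2 * c + t^3 * d"
  then obtain c' d' where eq': "\<And>t. f (x + t *s y) = f x + t * b' + t^2 * c' + t^3 * d'" by blast
  have "poly [:f x, b', c', d':] t = poly [:f x, b, c, d:] t" for t
    using eq[of t] eq'[of t] by (simp add: algebra_simps power2_eq_square power3_eq_cube)
  then have "[:f x, b', c', d':] = [:f x, b, c, d:]" by (rule poly_eqI_infinite[OF infinite_field])
  then show "b' = b" by simp
qed

locale symmetric_trilinear =
  fixes F :: "'a::field ^ 'n \<Rightarrow> 'a ^ 'n \<Rightarrow> 'a ^ 'n \<Rightarrow> 'a"
  assumes add1: "F (x + x') y z = F x y z + F x' y z" and scale1: "F (k *s x) y z = k * F x y z"
    and commute12: "F x y z = F y x z" and commute23: "F x y z = F x z y"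
begin

lemma add2: "F x (y + y') z = F x y z + F x y' z" by (metis add1 commute12)
lemma add3: "F x y (z + z') = F x y z + F x y z'" by (metis add2 commute23)
lemma scale2: "F x (k *s y) z = k * F x y z" by (metis scale1 commute12)
lemma scale3: "F x y (k *s z) = k * F x y z" by (metis scale2 commute23)

lemmas multilinear = add1 add2 add3 scale1 scale2 scale3
lemmas symmetric = commute12 commute23

end

lemma cubic_form_polarization:
  assumes "cubic_form N"
  obtains F where "symmetric_trilinear F" "\<And>x. F x x x = 6 * N x"
proof -
  obtain c where N: "\<And>x. N x = (\<Sum>i\<in>UNIV. \<Sum>j\<in>UNIV. \<Sum>k\<in>UNIV. c i j k * x$i * x$j * x$k)"
    using assms by (auto simp: cubic_form_def)
  define C where "C x y z = (\<Sum>i\<in>UNIV. \<Sum>j\<in>UNIV. \<Sum>k\<in>UNIV. c i j k * x$i * y$j * z$k)" for x y z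
  have C: "C (x + x') y z = C x y z + C x' y z" "C x (y + y') z = C x y z + C x y' z"
    "C x y (z + z') = C x y z + C x y z'" "C (k *s x) y z = k * C x y z" "C x (k *s y) z = k * C x y z"
    "C x y (k *s z) = k * C x y z" for x x' y y' z z' k
    by (simp_all add: C_def sum.distrib sum_distrib_left algebra_simps)
  let ?F = "\<lambda>x y z. C x y z + C y x z + C x z y + C y z x + C z x y + C z y x"
  show thesis
  proof (rule that)
    show "symmetric_trilinear ?F" by unfold_locales (simp_all add: C algebra_simps)
    show "?F x x x = 6 * N x" for x by (simp add: N C_def)
  qed
qed

lemma quadratic_map_cross:
  assumes "quadratic_map S"
  shows "cross S (x + y) z = cross S x z + cross S y z" and "cross S (k *s x) z = k *s cross S x z"
    and "S (k *s x) = k^2 *s S x" and "cross S x x = 2 *s S x"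
proof -
  obtain d where S: "\<And>x l. S x $ l = (\<Sum>i\<in>UNIV. \<Sum>j\<in>UNIV. d l i j * x$i * x$j)"
    using assms by (auto simp: quadratic_map_def)
  have cross: "cross S x y $ l = (\<Sum>i\<in>UNIV. \<Sum>j\<in>UNIV. d l i j * (x$i * y$j + y$i * x$j))" for x y l
    by (simp add: cross_def S sum_subtractf[symmetric] sum.distrib[symmetric] algebra_simps)
  show "cross S (x + y) z = cross S x z + cross S y z" "cross S (k *s x) z = k *s cross S x z"
    by (simp_all add: vec_eq_iff cross sum.distrib[symmetric] sum_distrib_left algebra_simps)
  show scale: "S (k *s x) = k^2 *s S x" for k x
    by (simp add: vec_eq_iff S sum_distrib_left power2_eq_square algebra_simps)
  have "x + x = 2 *s x" by (simp add: vec_eq_iff)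
  then have "cross S x x = S (2 *s x) - S x - S x" by (simp only: cross_def)
  then show "cross S x x = 2 *s S x" unfolding scale by (simp add: vec_eq_iff)
qed

lemma cross_commute: "cross S x y = cross S y x"
  by (simp add: cross_def add.commute)

locale division_albert_algebra = symmetric_trilinear F
  for F :: "'k::field ^ 27 \<Rightarrow> 'k ^ 27 \<Rightarrow> 'k ^ 27 \<Rightarrow> 'k" +
  fixes N :: "'k ^ 27 \<Rightarrow> 'k" and S :: "'k ^ 27 \<Rightarrow> 'k ^ 27" and e :: "'k ^ 27"
  assumes infinite_field: "infinite (UNIV :: 'k set)" and two_nonzero: "(2::'k) \<noteq> 0"
    and three_nonzero: "(3::'k) \<noteq> 0"
    and division_albert: "division_albert N S e" and polarization: "F x x x = 6 * N x"
begin

lemma quadratic_map: "quadratic_map S"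
  and norm_unit: "N e = 1" and S_unit: "S e = e" and S_S: "S (S x) = N x *s x"
  and trace2_S: "trace2 N e (S x) y = lin N x y" and cross_unit: "cross S e x = trace1 N e x *s e - x"
  and norm_nonzero: "x \<noteq> 0 \<Longrightarrow> N x \<noteq> 0"
  using division_albert by (auto simp: division_albert_def cubic_norm_structure_def)

lemmas six_nonzero = six_neq_zero[OF two_nonzero three_nonzero]

lemma unit_nonzero: "e \<noteq> 0"
  using polarization[of 0] scale1[of 0 0 0 0] six_nonzero norm_unit by auto

lemma half_add_half: "x / 2 + x / 2 = (x::'k)"
  using two_nonzero by (simp add: field_simps)

lemma lin_norm: "lin N x y = F x x y / 2"
proof (rule lin_eqI[OF infinite_field])
  fix t
  define h k where "h = F x x y / 2" and "k = F x y y / 2"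
  have halves: "F x x y = h + h" "F x y y = k + k" unfolding h_def k_def by (simp_all only: half_add_half)
  have "6 * N (x + t *s y) = F (x + t *s y) (x + t *s y) (x + t *s y)" by (simp only: polarization)
  also have "\<dots> = F x x x + 3 * t * F x x y + 3 * t^2 * F x y y + t^3 * F y y y"
    by (simp add: multilinear symmetric algebra_simps power2_eq_square power3_eq_cube)
  also have "\<dots> = 6 * (N x + t * h + t^2 * k + t^3 * N y)"
    unfolding halves polarization by (simp add: algebra_simps)
  finally show "N (x + t *s y) = N x + t * (F x x y / 2) + t^2 * (F x y y / 2) + t^3 * N y"
    unfolding h_def k_def by (rule mult_left_cancel[THEN iffD1, OF six_nonzero])
qed

lemma lin_lin_norm: "lin (\<lambda>x. lin N x y) x z = F x y z"
proof (rule lin_eqI[OF infinite_field])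
  fix t
  have "F (x + t *s z) (x + t *s z) y = F x x y + t * (F x y z + F x y z) + t^2 * F z z y"
    by (simp add: multilinear symmetric algebra_simps power2_eq_square)
  then show "lin N (x + t *s z) y = lin N x y + t * F x y z + t^2 * (F z z y / 2) + t^3 * 0"
    using two_nonzero by (simp add: lin_norm field_simps)
qed

lemma trace2_eq: "trace2 N e x y = (F e e x / 2) * (F e e y / 2) - F e x y"
  by (simp add: trace2_def lin_norm lin_lin_norm[unfolded lin_norm])

lemma trace2_linear:
  "trace2 N e (x + y) z = trace2 N e x z + trace2 N e y z" "trace2 N e (k *s x) y = k * trace2 N e x y"
  "trace2 N e (x - y) z = trace2 N e x z - trace2 N e y z"
proof -
  show add: "trace2 N e (x + y) z = trace2 N e x z + trace2 N e y z" for x y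
    by (simp add: trace2_eq multilinear add_divide_distrib algebra_simps)
  show "trace2 N e (k *s x) y = k * trace2 N e x y" by (simp add: trace2_eq multilinear algebra_simps)
  show "trace2 N e (x - y) z = trace2 N e x z - trace2 N e y z" using add[of "x - y" y] by simp
qed

lemma trace2_commute: "trace2 N e x y = trace2 N e y x"
  by (simp add: trace2_eq commute23[of e x y])

lemma trace2_cross: "trace2 N e (cross S x y) z = F x y z"
proof -
  have "trace2 N e (cross S x y) z = F (x + y) (x + y) z / 2 - F x x z / 2 - F y y z / 2"
    by (simp add: cross_def trace2_linear trace2_S lin_norm)
  also have "\<dots> = F x y z / 2 + F x y z / 2"
    by (simp add: multilinear commute12[of y x] add_divide_distrib)
  finally show ?thesis by (simp only: half_add_half)
qed

lemma trace2_cross_assoc: "trace2 N e (cross S x y) z = trace2 N e x (cross S y z)"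
  by (simp add: trace2_commute[of x] trace2_cross symmetric)

lemma trace2_unit_unit: "trace2 N e e e = 3"
proof -
  have "2 *s e = trace2 N e e e *s e - e"
    using cross_unit[of e] by (simp add: quadratic_map_cross[OF quadratic_map] S_unit trace1_def)
  then have "(trace2 N e e e - 3) *s e = 0" by (simp add: vec_eq_iff algebra_simps)
  then show ?thesis using unit_nonzero by simp
qed

lemma sharp_sharp_polarized:
  "cross S (cross S w x) (cross S y z) + cross S (cross S w y) (cross S x z) + cross S (cross S w z) (cross S x y)
    = F x y z *s w + F w y z *s x + F w x z *s y + F w x y *s z"
proof -
  let ?D = "\<lambda>i w x y z. (cross S (cross S w x) (cross S y z) + cross S (cross S w y) (cross S x z)
    + cross S (cross S w z) (cross S x y)
    - (F x y z *s w + F w y z *s x + F w x z *s y + F w x y *s z)) $ i"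
  note bilinear = quadratic_map_cross(1,2)[OF quadratic_map]
  have bilinear_right: "cross S z (x + y) = cross S z x + cross S z y" "cross S z (k *s x) = k *s cross S z x"
    for x y z k
    using bilinear by (simp_all add: cross_commute[of _ z])
  have quartic: "symmetric_quartic (?D i)" for i
  proof
    fix x x' y z w :: "'k ^ 27" and k
    show "?D i (x + x') y z w = ?D i x y z w + ?D i x' y z w"
      by (simp add: bilinear bilinear_right multilinear algebra_simps)
    show "?D i (k *s x) y z w = k * ?D i x y z w"
      by (simp add: bilinear bilinear_right multilinear algebra_simps)
    show "?D i x y z w = ?D i y x z w"
      using cross_commute[of S y x] cross_commute[of S "cross S y z" "cross S x w"]
        cross_commute[of S "cross S y w" "cross S x z"] commute12[of y x]
      by (simp add: algebra_simps)
    show "?D i x y z w = ?D i x z y w"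
      using cross_commute[of S z y] commute12[of z y w] commute23[of x z y] by (simp add: algebra_simps)
    show "?D i x y z w = ?D i x y w z"
      using cross_commute[of S w z] commute23[of y w z] commute23[of x w z] by (simp add: algebra_simps)
  qed (rule two_nonzero three_nonzero)+
  have "?D i x x x x = 0" for i x
  proof -
    have "cross S (cross S x x) (cross S x x) = 8 *s (N x *s x)"
      by (simp add: quadratic_map_cross(3,4)[OF quadratic_map] S_S vec_eq_iff)
    then show ?thesis by (simp add: polarization)
  qed
  then have "?D i w x y z = 0" for i by (rule symmetric_quartic.quartic_zero[OF quartic])
  then show ?thesis by (simp add: vec_eq_iff)
qed

lemma cubic_jordan: "cubic_jordan (cross S) (trace2 N e) e"
proof
  fix w x y z :: "'k ^ 27"
  show "cross S (cross S w x) (cross S y z) + cross S (cross S w y) (cross S x z)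
      + cross S (cross S w z) (cross S x y)
      = trace2 N e (cross S x y) z *s w + trace2 N e (cross S w y) z *s x + trace2 N e (cross S w x) z *s y
        + trace2 N e (cross S w x) y *s z"
    unfolding trace2_cross by (rule sharp_sharp_polarized)
  show "cross S e x = trace2 N e x e *s e - x" using cross_unit by (simp add: trace1_def)
qed (rule two_nonzero three_nonzero quadratic_map_cross[OF quadratic_map] cross_commute trace2_linear
  trace2_commute
    trace2_cross_assoc trace2_unit_unit)+

lemma cnorm_eq: "cubic_jordan.cnorm (cross S) (trace2 N e) = N"
proof
  interpret cubic_jordan "cross S" "trace2 N e" e by (rule cubic_jordan)
  fix x
  have "sharp x = S x" unfolding sharp_def quadratic_map_cross(4)[OF quadratic_map] using two_nonzero by simp
  moreover have "trace2 N e x (S x) = 3 * N x"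
    unfolding trace2_commute[of x] trace2_S lin_norm polarization
    using nonzero_mult_div_cancel_left[OF two_nonzero, of "3 * N x"] by (simp add: mult.assoc[symmetric])
  ultimately show "cnorm x = N x" unfolding cnorm_def using three_nonzero by simp
qed

lemma jordan_eq: "cubic_jordan.jordan (cross S) (trace2 N e) e = jprod N S e"
  using cubic_jordan by (intro ext) (simp add: cubic_jordan.jordan_def jprod_def trace1_def)

lemma division_cubic: "division_cubic (cross S) (trace2 N e) e"
  by (intro division_cubic.intro cubic_jordan division_cubic_axioms.intro infinite_field)
    (use norm_nonzero cnorm_eq in auto)

end

lemma division_albert_cubic:
  fixes N :: "'k::field ^ 27 \<Rightarrow> 'k"
  assumes "infinite (UNIV :: 'k set)" "(2::'k) \<noteq> 0" "(3::'k) \<noteq> 0" "division_albert N S e"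
  shows "division_cubic (cross S) (trace2 N e) e" and "cubic_jordan.cnorm (cross S) (trace2 N e) = N"
    and "cubic_jordan.jordan (cross S) (trace2 N e) e = jprod N S e"
proof -
  have "cubic_form N" using assms(4) by (simp add: division_albert_def cubic_norm_structure_def)
  then obtain F where F: "symmetric_trilinear F" "\<And>x. F x x x = 6 * N x" using cubic_form_polarization by blast
  have "division_albert_algebra F N S e"
    by (intro division_albert_algebra.intro division_albert_algebra_axioms.intro F assms)
  then show "division_cubic (cross S) (trace2 N e) e" "cubic_jordan.cnorm (cross S) (trace2 N e) = N"
    "cubic_jordan.jordan (cross S) (trace2 N e) e = jprod N S e"
    by (rule division_albert_algebra.division_cubic division_albert_algebra.cnorm_eq
        division_albert_algebra.jordan_eq)+
qed

lemma (in division_cubic) cubic_subfield_adjoin: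
  assumes L: "L = {a1 *s b1 + a2 *s b2 + a3 *s b3 | a1 a2 a3. True}"
    and independent: "\<And>a1 a2 a3. a1 *s b1 + a2 *s b2 + a3 *s b3 = 0 \<Longrightarrow> a1 = 0 \<and> a2 = 0 \<and> a3 = 0"
    and unit: "e \<in> L" and closed: "\<And>x y. x \<in> L \<Longrightarrow> y \<in> L \<Longrightarrow> jordan x y \<in> L"
  obtains m where "m \<notin> scalars" "L = adjoin m"
proof -
  have span: "L = vec.span {b1, b2, b3}" unfolding L by (rule span_three[symmetric])
  have subspace: "vec.subspace L" unfolding span by (rule vec.subspace_span)
  have dim: "vec.dim L = 3" unfolding span by (rule dim_span_three[OF independent])
  have "\<not> L \<subseteq> vec.span {e}"
    using vec.dim_le_card[of L "{e}"] dim by auto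
  then obtain m where m: "m \<in> L" "m \<notin> scalars" by (auto simp: scalars_def vec.span_singleton)
  interpret cubic_field cr T e m by unfold_locales (rule m(2))
  have "jordan m m - T m e *s m + T (sharp m) e *s e \<in> L"
    by (intro vec.subspace_add[OF subspace] vec.subspace_diff[OF subspace] vec.subspace_scale[OF subspace] closed m
        unit)
  then have "sharp m \<in> L" by (simp add: jordan_self)
  then have "adjoin m \<subseteq> L" by (intro adjoin_subset subspace unit m(1))
  then have "adjoin m = L" by (rule vec.subspace_dim_equal[OF subspace_adjoin subspace]) (simp add: dim dim_adjoin)
  then show thesis using that m(2) by blast
qed

locale albert = division_cubic cr T e
  for cr :: "'a::field ^ 27 \<Rightarrow> 'a ^ 27 \<Rightarrow> 'a ^ 27"  (infixl "\<bowtie>" 75)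
    and T :: "'a ^ 27 \<Rightarrow> 'a ^ 27 \<Rightarrow> 'a" and e :: "'a ^ 27"
begin

lemma matrix_similarity: "similarity \<nu> g \<Longrightarrow> matrix g *v x = g x"
  by (rule matrix_works) (rule similarityD(1))

lemma matrix_similarity_Str: assumes g: "similarity \<nu> g" shows "matrix g \<in> Str cnorm"
proof -
  have "(*v) (matrix g) = g" using matrix_similarity[OF g] by blast
  then obtain B where "B ** matrix g = mat 1"
    using similarity_bij[OF g] matrix_left_invertible_injective[of "matrix g"] by (auto simp: bij_def)
  then have "det (matrix g) \<noteq> 0" using invertible_det_nz invertible_left_inverse by blast
  then show ?thesis using similarityD(5)[OF g] matrix_similarity[OF g] by (auto simp: Str_def)
qed

lemma similarity_Str: assumes "g \<in> Str cnorm" obtains \<nu> where "similarity \<nu> ((*v) g)"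
proof -
  obtain \<nu> where det: "det g \<noteq> 0" and \<nu>: "\<And>x. cnorm (g *v x) = \<nu> * cnorm x" using assms by (auto simp: Str_def)
  obtain h where "g ** h = mat 1" using det invertible_det_nz[of g] by (auto simp: invertible_def)
  then have "\<nu> * cnorm (h *v e) = 1" using \<nu>[of "h *v e"] by (simp add: matrix_vector_mul_assoc)
  then have "similarity \<nu> ((*v) g)"
    using \<nu> by (intro similarityI) (auto simp: matrix_vector_right_distrib vector_scalar_commute)
  then show thesis by (rule that)
qed

lemma poly_curve_matrix:
  fixes R :: "'a \<Rightarrow> 'a ^ 27 \<Rightarrow> 'a ^ 27" and h :: "'a ^ 27 \<Rightarrow> 'a ^ 27"
  assumes curve: "\<And>x. \<exists>d. poly_curve d (\<lambda>t. f t *s R t x)" and h: "similarity \<nu> h"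
  shows "\<exists>P. \<forall>i j t. poly (P i j) t = f t * h (R t (axis j 1)) $ i"
proof -
  have entry: "\<exists>p. \<forall>t. poly p t = f t * h (R t (axis j 1)) $ i" for i j
  proof -
    obtain d where d: "poly_curve d (\<lambda>t. f t *s R t (axis j 1))" using curve by blast
    have "f t * h (R t (axis j 1)) $ i = (\<Sum>k\<in>UNIV. matrix h $ i $ k * (f t *s R t (axis j 1)) $ k)" for t
    proof -
      have "f t * h (R t (axis j 1)) $ i = (matrix h *v (f t *s R t (axis j 1))) $ i"
        by (simp add: matrix_similarity[OF h] similarityD(3)[OF h])
      then show ?thesis by (simp add: matrix_vector_mult_def)
    qed
    moreover have "poly_fun d (\<lambda>t. \<Sum>k\<in>UNIV. matrix h $ i $ k * (f t *s R t (axis j 1)) $ k)"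
      by (intro poly_fun_sum poly_fun_cmult) (use d in \<open>simp add: poly_curve_def\<close>)
    ultimately show ?thesis by (auto simp: poly_fun_def)
  qed
  define P where "P i j = (SOME p. \<forall>t. poly p t = f t * h (R t (axis j 1)) $ i)" for i j
  have "poly (P i j) t = f t * h (R t (axis j 1)) $ i" for i j t
    unfolding P_def by (rule someI_ex[OF entry, THEN spec])
  then show ?thesis by blast
qed

lemma R_link_rational_path:
  fixes h :: "'a ^ 27 \<Rightarrow> 'a ^ 27"
  assumes path: "rational_path \<rho>" and h: "similarity \<nu> h"
  shows "R_link cnorm (matrix h) (matrix (\<lambda>x. h (\<rho> x)))"
proof -
  obtain R :: "'a \<Rightarrow> 'a ^ 27 \<Rightarrow> 'a ^ 27" and f where f: "\<exists>d. poly_fun d f" "f 0 \<noteq> 0" "f 1 \<noteq> 0"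
    and R: "\<forall>x. \<exists>d. poly_curve d (\<lambda>t. f t *s R t x)" "\<forall>t. f t \<noteq> 0 \<longrightarrow> (\<exists>\<nu>. similarity \<nu> (R t))"
      "R 0 = (\<lambda>x. x)" "R 1 = \<rho>"
    using path unfolding rational_path_def by (elim exE conjE) (rule that; (assumption | rule exI))
  obtain Q where Q: "\<And>t. poly Q t = f t" using f(1) by (auto simp: poly_fun_def)
  obtain P where P: "\<forall>i j t. poly (P i j) t = f t * h (R t (axis j 1)) $ i"
    by (rule exE[OF poly_curve_matrix[of f R, OF R(1)[rule_format] h]])
  have curve: "curve_at P Q t = matrix (\<lambda>x. h (R t x))" if "f t \<noteq> 0" for t
    using that by (simp add: curve_at_def matrix_def vec_eq_iff P Q)
  have Str: "curve_at P Q t \<in> Str cnorm" if t: "f t \<noteq> 0" for t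
  proof -
    obtain \<mu> where "similarity \<mu> (R t)" using R(2) t by blast
    then show ?thesis unfolding curve[OF t] by (rule matrix_similarity_Str[OF similarity_comp[OF _ h]])
  qed
  then have "defined_at P Q t \<longleftrightarrow> f t \<noteq> 0" for t by (auto simp: defined_at_def Str_def Q)
  then show ?thesis
    unfolding R_link_def using Str f(2,3) curve[OF f(2)] curve[OF f(3)] R(3,4)
    by (intro exI[of _ P] exI[of _ Q]) auto
qed

lemma R_trivial_imp_R_equiv_one: "R_trivial \<rho> \<Longrightarrow> R_equiv_one cnorm (matrix \<rho>)"
proof (induction rule: R_trivial.induct)
  case R_trivial_id
  have "matrix (\<lambda>x :: 'a ^ 27. x) = mat 1" using matrix_id_mat_1 by (simp add: id_def)
  then show ?case by (simp add: R_equiv_one_def)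
next
  case (R_trivial_step \<rho> \<rho>')
  obtain \<nu> where "similarity \<nu> \<rho>'" using R_trivial_imp_similarity[OF R_trivial_step(2)] by blast
  then have "R_link cnorm (matrix \<rho>') (matrix (\<lambda>x. \<rho>' (\<rho> x)))" by (rule R_link_rational_path[OF R_trivial_step(1)])
  then show ?case using R_trivial_step.IH
    unfolding R_equiv_one_def by (rule rtranclp.rtrancl_into_rtrancl[rotated])
qed

lemma Str_stabilizer_R_equiv_one:
  assumes g: "g \<in> Str cnorm" and m: "m \<notin> scalars" and image: "(\<lambda>x. g *v x) ` adjoin m = adjoin m"
  obtains r where "r \<in> Str cnorm" "R_equiv_one cnorm r" "\<And>l. l \<in> adjoin m \<Longrightarrow> r *v l = g *v l"
proof -
  interpret cubic_field cr T e m by unfold_locales (rule m)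
  obtain \<nu> where "similarity \<nu> ((*v) g)" using g by (rule similarity_Str)
  then have "R_trivial_on (adjoin m) ((*v) g)" by (intro similarity_R_trivial_on_adjoin image) simp_all
  then obtain \<rho> where \<rho>: "R_trivial \<rho>" "\<And>l. l \<in> adjoin m \<Longrightarrow> \<rho> l = g *v l" unfolding R_trivial_on_def by blast
  obtain \<mu> where "similarity \<mu> \<rho>" using R_trivial_imp_similarity[OF \<rho>(1)] by blast
  then show thesis
    using that[of "matrix \<rho>"] \<rho> matrix_similarity_Str matrix_similarity R_trivial_imp_R_equiv_one by simp
qed

end

lemma GL_fix_factor:
  assumes r: "r \<in> Str N" and g: "g \<in> Str N" and unit: "e \<in> L" "N e = 1" and agree: "\<And>l. l \<in> L \<Longrightarrow> r *v l = g *v l"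
  obtains h where "h \<in> GL_fix N L" "g = r ** h"
proof -
  obtain \<nu> where r: "det r \<noteq> 0" "\<And>x. N (r *v x) = \<nu> * N x" using r by (auto simp: Str_def)
  obtain \<nu>' where g: "det g \<noteq> 0" "\<And>x. N (g *v x) = \<nu>' * N x" using g by (auto simp: Str_def)
  obtain s where s: "r ** s = mat 1" "s ** r = mat 1"
    using r(1) invertible_det_nz[of r] by (auto simp: invertible_def)
  have "\<nu>' = \<nu>" using r(2)[of e] g(2)[of e] agree[OF unit(1)] unit(2) by simp
  moreover have "\<nu> * N (s *v e) = 1" using r(2)[of "s *v e"] unit(2) by (simp add: matrix_vector_mul_assoc s)
  ultimately have norm: "N (s *v (g *v x)) = N x" for x
    using r(2)[of "s *v (g *v x)"] g(2)[of x] by (auto simp: matrix_vector_mul_assoc matrix_mul_assoc s)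
  have factor: "g = r ** (s ** g)" by (simp add: matrix_mul_assoc s)
  then have "det (s ** g) \<noteq> 0" using g(1) by (metis det_mul mult_zero_right)
  moreover have "s *v (g *v l) = l" if "l \<in> L" for l
    by (simp add: agree[OF that, symmetric] matrix_vector_mul_assoc s)
  ultimately have "s ** g \<in> GL_fix N L"
    using norm by (simp add: GL_fix_def Gpts_def matrix_vector_mul_assoc[symmetric])
  then show thesis using factor by (rule that)
qed

lemma mat_one_normalizer:
  fixes N :: "'k::field ^ 27 \<Rightarrow> 'k"
  shows "mat 1 \<in> normalizer_H N S e L"
proof -
  have "matrix_inv (mat 1 :: 'k ^ 27 ^ 27) = mat 1"
    unfolding matrix_inv_def by (rule some_equality) auto
  then show ?thesis by (simp add: normalizer_H_def Aut_def)
qed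

theorem mainTheorem16:
  fixes N :: "'k::field ^ 27 \<Rightarrow> 'k"
    and S :: "'k ^ 27 \<Rightarrow> 'k ^ 27"
    and e :: "'k ^ 27"
    and L :: "('k ^ 27) set"
    and g :: "'k ^ 27 ^ 27"
  assumes "infinite (UNIV :: 'k set)"
    and "(2::'k) \<noteq> 0" and "(3::'k) \<noteq> 0"
    and "division_albert N S e"
    and "cubic_subfield N S e L"
    and "g \<in> Str N"
    and "(\<lambda>x. g *v x) ` L = L"
  shows "\<exists>r g1 g2. r \<in> Str N \<and> R_equiv_one N r \<and>
           g1 \<in> normalizer_H N S e L \<and> g2 \<in> GL_fix N L \<and>
           (\<lambda>x. g1 *v x) ` L = L \<and> (\<lambda>x. g2 *v x) ` L = L \<and>
           g = r ** g1 ** g2"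
proof -
  note cubic = division_albert_cubic[OF assms(1-4)]
  interpret A: division_cubic "cross S" "trace2 N e" e by (rule cubic(1))
  interpret A: albert "cross S" "trace2 N e" e ..
  have unit: "e \<in> L" "N e = 1"
    using assms(5) A.cnorm_unit by (simp_all add: cubic_subfield_def cubic(2))
  have closed: "A.jordan x y \<in> L" if "x \<in> L" "y \<in> L" for x y
    using assms(5) that by (simp add: cubic_subfield_def cubic(3))
  obtain b1 b2 b3 where basis: "L = {a1 *s b1 + a2 *s b2 + a3 *s b3 | a1 a2 a3. True}"
    "\<forall>a1 a2 a3. a1 *s b1 + a2 *s b2 + a3 *s b3 = 0 \<longrightarrow> a1 = 0 \<and> a2 = 0 \<and> a3 = 0"
    using assms(5) unfolding cubic_subfield_def by blast
  obtain m where m: "m \<notin> A.scalars" "L = A.adjoin m"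
    by (rule A.cubic_subfield_adjoin[OF basis(1) basis(2)[rule_format] unit(1) closed])
  obtain r where r: "r \<in> Str N" "R_equiv_one N r" "\<And>l. l \<in> L \<Longrightarrow> r *v l = g *v l"
    using A.Str_stabilizer_R_equiv_one[of g m] assms(6,7) m cubic(2) by auto
  obtain h where h: "h \<in> GL_fix N L" "g = r ** h" by (rule GL_fix_factor[OF r(1) assms(6) unit r(3)])
  then have "(\<lambda>x. h *v x) ` L = L" by (force simp: GL_fix_def)
  then show ?thesis
    using r(1,2) h mat_one_normalizer[of N S e L] by (intro exI[of _ r] exI[of _ "mat 1"] exI[of _ h]) simp
qed

end
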